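(* Let $d\ge2$, $\frac d2<p<\frac d2+1$, and suppose that the sequence $\{a_n\}_{n\ge0}$ satisfies, for some constant $C$ and all $n\ge1$, $$|a_n|\le\frac{C}{n^p},\qquad |a_n-a_{n-1}|\le\frac{C}{n^{p+1}}.$$ Let $f=\sum_{n\ge0}a_nY_n$ be the function on $\mathbb{S}^d$ supported on the zonal harmonics with Fourier coefficients $\{a_n\}$, and let $u$ be the solution of $iu_t+\Delta_{\mathbb{S}^d}u=0$, $u(\cdot,0)=f$. Then for almost every $t$, $u(\cdot,t)\in C^{\gamma'}(\mathbb{S}^d)$ for every $0<\gamma'<p-\frac d2$, and $$\dim_t(f)\le(d+1)-\left(p-\tfrac d2\right).$$
   Context: $Y_n$ is the zonal harmonic of degree $n$ on $\mathbb{S}^d$ about a fixed pole: the function of the polar angle $\theta\in[0,\pi]$ that is a positive multiple of the Jacobi polynomial $P_n^{(\frac{d-2}2,\frac{d-2}2)}(\cos\theta)$, normalized so that $\frac1{\omega_d}\int_{\mathbb{S}^d}Y_n^2\,d\sigma=1$ ($\sigma$ surface measure, $\omega_d=\sigma(\mathbb{S}^d)$). One has $\Delta_{\mathbb{S}^d}Y_n=-n(n+d-1)Y_n$. The fractal (upper Minkowski) dimension of a bounded set $E$ is $\limsup_{\epsilon\to0}\frac{\log\mathcal N(E,\epsilon)}{\log(1/\epsilon)}$, where $\mathcal N(E,\epsilon)$ is the minimum number of boxes of sidelength $\epsilon$ needed to cover $E$. $\dim_t(f)$ denotes the maximum of the fractal dimensions of the graphs of the real and imaginary parts of $u(\cdot,t)$.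 $C^{\gamma'}$ is the Hölder space. *)

theory Defs
  imports "HOL-Analysis.Analysis"
begin

text \<open>
  The sphere \<open>S\<^sup>d\<close> is \<open>sphere 0 1\<close> in a Euclidean space \<open>'a\<close> with \<open>DIM('a) = d + 1\<close>.
  A function on the sphere is a function on \<open>'a\<close> of which only the values on \<open>sphere 0 1\<close> matter.
\<close>

text \<open>
  Surface measure, through integration in polar coordinates: the measure of \<open>A\<close> is \<open>d + 1\<close> times
  the Lebesgue measure of the cone \<open>{r *\<^sub>R x | x \<in> A, 0 < r < 1}\<close>.
\<close>
definition surface_measure :: "'a::euclidean_space measure" where
  "surface_measure =
     scale_measure (ennreal (real DIM('a)))
       (distr (restrict_space lborel (ball 0 1 - {0})) (restrict_space borel (sphere 0 1))
          (\<lambda>x. x /\<^sub>R norm x))"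

definition square_integrable :: "'a measure \<Rightarrow> ('a \<Rightarrow> 'b::{real_normed_vector}) \<Rightarrow> bool" where
  "square_integrable M f \<longleftrightarrow> f \<in> borel_measurable M \<and> integrable M (\<lambda>x. (norm (f x))\<^sup>2)"

definition L2_dist_sq :: "'a measure \<Rightarrow> ('a \<Rightarrow> 'b::{real_normed_vector}) \<Rightarrow> ('a \<Rightarrow> 'b) \<Rightarrow> real" where
  "L2_dist_sq M f g = (\<integral>x. (norm (f x - g x))\<^sup>2 \<partial>M)"

definition jacobi :: "real \<Rightarrow> real \<Rightarrow> nat \<Rightarrow> real \<Rightarrow> real" where
  "jacobi \<alpha> \<beta> n x =
     (\<Sum>s\<le>n. ((real n + \<alpha>) gchoose (n - s)) * ((real n + \<beta>) gchoose s) *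
        ((x - 1) / 2) ^ s * ((x + 1) / 2) ^ (n - s))"

text \<open>
  The zonal harmonic about the pole \<open>e\<close>, with \<open>x \<bullet> e = cos \<theta>\<close>; the divisor makes the mean of
  \<open>(zonal e n)\<^sup>2\<close> over the sphere equal to 1.
\<close>
definition zonal :: "'a::euclidean_space \<Rightarrow> nat \<Rightarrow> 'a \<Rightarrow> real" where
  "zonal e n x =
     (let \<alpha> = (real (DIM('a) - 1) - 2) / 2;
          \<omega> = measure surface_measure (sphere (0::'a) 1)
      in jacobi \<alpha> \<alpha> n (x \<bullet> e) / sqrt ((1 / \<omega>) * (\<integral>y. (jacobi \<alpha> \<alpha> n (y \<bullet> e))\<^sup>2 \<partial>surface_measure)))"

primrec iterated_deriv :: "'a::real_normed_vector list \<Rightarrow> ('a \<Rightarrow> real) \<Rightarrow> 'a \<Rightarrow> real" where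
  "iterated_deriv [] F = F"
| "iterated_deriv (v # vs) F = (\<lambda>x. frechet_derivative (iterated_deriv vs F) (at x) v)"

text \<open>Class \<open>C\<^sup>\<infinity>\<close>, intended for open \<open>S\<close>.\<close>
definition smooth_on :: "'a::real_normed_vector set \<Rightarrow> ('a \<Rightarrow> real) \<Rightarrow> bool" where
  "smooth_on S F \<longleftrightarrow> (\<forall>vs. iterated_deriv vs F differentiable_on S)"

definition radial_extension :: "('a::euclidean_space \<Rightarrow> real) \<Rightarrow> 'a \<Rightarrow> real" where
  "radial_extension \<phi> x = \<phi> (x /\<^sub>R norm x)"

definition smooth_sphere :: "('a::euclidean_space \<Rightarrow> real) \<Rightarrow> bool" where
  "smooth_sphere \<phi> \<longleftrightarrow> smooth_on (- {0}) (radial_extension \<phi>)"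

text \<open>
  The Laplace-Beltrami operator of the unit sphere: the Euclidean Laplacian of the extension that
  is homogeneous of degree 0, evaluated on the sphere.
\<close>
definition sphere_laplacian :: "('a::euclidean_space \<Rightarrow> real) \<Rightarrow> 'a \<Rightarrow> real" where
  "sphere_laplacian \<phi> x = (\<Sum>b\<in>Basis. iterated_deriv [b, b] (radial_extension \<phi>) x)"

text \<open>
  \<open>u\<close> solves \<open>i u\<^sub>t + \<Delta> u = 0\<close>, \<open>u 0 = f\<close> on the sphere: \<open>u\<close> is a continuous curve in \<open>L\<^sup>2\<close>, and
  the equation \<open>u\<^sub>t = i \<Delta> u\<close> holds when paired with any smooth test function, with the
  (symmetric) Laplacian moved to the test function.
\<close>
definition schroedinger_solution ::
    "('a::euclidean_space \<Rightarrow> complex) \<Rightarrow> (real \<Rightarrow> 'a \<Rightarrow> complex) \<Rightarrow> bool" where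
  "schroedinger_solution f u \<longleftrightarrow>
     (\<forall>t. square_integrable surface_measure (u t)) \<and>
     (\<forall>t. ((\<lambda>s. L2_dist_sq surface_measure (u s) (u t)) \<longlongrightarrow> 0) (at t)) \<and>
     (AE x in surface_measure. u 0 x = f x) \<and>
     (\<forall>\<phi> t. smooth_sphere \<phi> \<longrightarrow>
        ((\<lambda>s. \<integral>x. u s x * of_real (\<phi> x) \<partial>surface_measure) has_vector_derivative
           \<i> * (\<integral>x. u t x * of_real (sphere_laplacian \<phi> x) \<partial>surface_measure)) (at t))"

text \<open>The minimal number of closed axis-parallel boxes of side length \<open>\<epsilon>\<close> that cover \<open>E\<close> (for bounded \<open>E\<close>).\<close>
definition covering_number :: "'a::euclidean_space set \<Rightarrow> real \<Rightarrow> nat" where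
  "covering_number E \<epsilon> = Inf {card A | A. finite A \<and> E \<subseteq> (\<Union>a\<in>A. cbox a (a + \<epsilon> *\<^sub>R One))}"

definition fractal_dim :: "'a::euclidean_space set \<Rightarrow> ereal" where
  "fractal_dim E =
     Limsup (at_right 0) (\<lambda>\<epsilon>. ereal (ln (real (covering_number E \<epsilon>)) / ln (1 / \<epsilon>)))"

definition graph_on :: "'a set \<Rightarrow> ('a \<Rightarrow> 'b) \<Rightarrow> ('a \<times> 'b) set" where
  "graph_on S g = (\<lambda>x. (x, g x)) ` S"

definition max_graph_dim :: "('a::euclidean_space \<Rightarrow> complex) \<Rightarrow> ereal" where
  "max_graph_dim g =
     max (fractal_dim (graph_on (sphere 0 1) (\<lambda>x. Re (g x))))
         (fractal_dim (graph_on (sphere 0 1) (\<lambda>x. Im (g x))))"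

text \<open>The Hoelder class \<open>C\<^sup>\<gamma>\<close> for \<open>0 < \<gamma> < 1\<close> on a compact set \<open>S\<close>, where boundedness is automatic.
  On the sphere the chordal distance used here is equivalent to the geodesic one.\<close>
definition hoelder_on :: "real \<Rightarrow> 'a::metric_space set \<Rightarrow> ('a \<Rightarrow> 'b::metric_space) \<Rightarrow> bool" where
  "hoelder_on \<gamma> S g \<longleftrightarrow> (\<exists>K. \<forall>x\<in>S. \<forall>y\<in>S. dist (g x) (g y) \<le> K * dist x y powr \<gamma>)"

end

theory Submission
  imports Defs
begin

text \<open>
  The zonal harmonic \<open>Y\<^sub>n\<close> is \<open>\<kappa>\<^sub>n Z\<^sub>n\<close> with \<open>Z\<^sub>n = 1\<close> at the pole and \<open>\<kappa>\<^sub>n\<close> of size \<open>n\<^bsup>(d-1)/2\<^esup>\<close>, and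
  Laplace's integral writes \<open>Z\<^sub>n(cos \<theta>)\<close> as an average of \<open>z\<^sup>n\<close> over points \<open>z = cos \<theta> + i sin \<theta> cos \<phi>\<close> of
  the closed unit disc. Estimates for the power series \<open>\<Sum>\<^sub>n a\<^sub>n \<kappa>\<^sub>n e\<^bsup>-itn(n+d-1)\<^esup> z\<^sup>n\<close> that are uniform
  in the disc therefore pass to the sphere without any asymptotics for Jacobi polynomials.

  Squaring a Weyl sum \<open>\<Sum> e\<^bsup>-itn\<^sup>2\<^esup> z\<^sup>n\<close> over a subinterval of \<open>[0, L)\<close> bounds it, uniformly in \<open>|z| = 1\<close>, by a
  sum over \<open>h < L\<close> of \<open>min L (1 / |sin (t h)|)\<close>. Each term has mean \<open>O(log L)\<close> in \<open>t\<close>, so along dyadic \<open>L\<close>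
  almost every \<open>t\<close> has square-root cancellation up to \<open>L\<^sup>\<epsilon>\<close>. Summation by parts turns this into
  bounds for the dyadic blocks and their derivatives, hence into Hoelder continuity of any order
  below \<open>p - d/2\<close> and the bound for the dimension of the graphs.

  A weak solution is identified with the series through its moments against \<open>(x \<bullet> w)\<^sup>k\<close>: the spherical
  Laplacian maps \<open>(x \<bullet> w)\<^sup>k\<close> into the span of itself and \<open>(x \<bullet> w)\<^bsup>k-2\<^esup>\<close>, so the moments obey a
  triangular system of differential equations, and together they determine an integrable function.
\<close>

section \<open>Integration on the sphere\<close>

text \<open>With \<gamma> = p - d/2, the coefficients a_n \<kappa>_n have size n^(-\<gamma>-1/2) and
  increments of size n^(-\<gamma>-3/2), so over the k-th dyadic block both their size and their
  total variation are O(2^(-k(\<gamma>+1/2))). Square-root cancellation 2^(k/2), up to an \<epsilon>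
  in the exponent, leaves 2^(-k\<gamma>) for the block and 2^(k(1-\<gamma>)) for its derivative;
  this is where the threshold p - d/2 comes from. The Weyl bound lives on the circle while Laplace's
  points lie inside the disc; monotone weights r^n carry it inwards. The linear part n(d-1) of the
  phase is only a rotation of z. On the side of the equation the obstacle is that a weak solution is
  an arbitrary continuous curve in L2, with no expansion of u(t) given. Testing with powers (x
  \<bullet> w)^k reduces uniqueness to scalar equations and avoids a theory of general spherical
  harmonics. Since u(t) is determined only up to null sets, regularity is shown for a continuous
  representative.\<close>

lemma scale_measure_eq_density:
  "scale_measure (ennreal c) M = density M (\<lambda>_. ennreal c)"
  by (rule measure_eqI) (auto simp: emeasure_density nn_integral_cmult)

lemma space_surface_measure [simp]: "space surface_measure = sphere 0 1"
  by (simp add: surface_measure_def scale_measure_eq_density space_restrict_space)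

lemma sets_surface_measure [measurable_cong, simp]:
  "sets surface_measure = sets (restrict_space borel (sphere 0 1))"
  by (simp add: surface_measure_def)

lemma radial_projection_measurable [measurable]:
  "(\<lambda>x::'a::euclidean_space. x /\<^sub>R norm x)
     \<in> measurable (restrict_space lborel (ball 0 1 - {0})) (restrict_space borel (sphere 0 1))"
  by (rule measurable_restrict_space3) auto

lemma integral_surface_measure:
  fixes g :: "'a::euclidean_space \<Rightarrow> 'b::{banach, second_countable_topology}"
  assumes g: "g \<in> borel_measurable surface_measure"
  shows "(\<integral>x. g x \<partial>surface_measure) =
    real DIM('a) *\<^sub>R (\<integral>x. indicator (ball 0 1 - {0}) x *\<^sub>R g (x /\<^sub>R norm x) \<partial>lborel)"
proof -
  have g': "g \<in> borel_measurable (restrict_space borel (sphere 0 1))"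
    using g by simp
  show ?thesis
    unfolding surface_measure_def scale_measure_eq_density
    using g'
    by (subst integral_density) (auto simp: integral_distr integral_restrict_space)
qed

lemma finite_surface_measure: "finite_measure (surface_measure :: 'a::euclidean_space measure)"
proof (rule finite_measureI)
  have "emeasure lborel (ball (0::'a) 1 - {0}) \<le> emeasure lborel (ball (0::'a) 1)"
    by (rule emeasure_mono) auto
  also have "\<dots> < \<infinity>"
    by (rule emeasure_bounded_finite) simp
  finally have fin: "emeasure lborel (ball (0::'a) 1 - {0}) < \<infinity>" .
  have *: "(\<lambda>x::'a. x /\<^sub>R norm x) -` sphere 0 1 \<inter> (ball 0 1 - {0}) = ball 0 1 - {0}"
    by auto
  show "emeasure (surface_measure :: 'a measure) (space surface_measure) \<noteq> \<infinity>"
    unfolding space_surface_measure using fin *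
    by (simp add: surface_measure_def emeasure_distr emeasure_restrict_space space_restrict_space sets_restrict_space_iff
        ennreal_mult_eq_top_iff less_top[symmetric])
qed

interpretation surface_measure: finite_measure "surface_measure :: 'a::euclidean_space measure"
  by (rule finite_surface_measure)

lemma borel_measurable_surface_measure:
  fixes g :: "'a::euclidean_space \<Rightarrow> 'b::topological_space"
  assumes "continuous_on (sphere 0 1) g"
  shows "g \<in> borel_measurable surface_measure"
  using borel_measurable_continuous_on_restrict[OF assms] by simp

lemma integrable_surface_measure:
  fixes g :: "'a::euclidean_space \<Rightarrow> 'b::{banach, second_countable_topology}"
  assumes "continuous_on (sphere 0 1) g"
  shows "integrable surface_measure g"
proof -
  have "bounded (g ` sphere 0 1)"
    using assms by (intro compact_imp_bounded compact_continuous_image) auto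
  then obtain B where "\<And>x. x \<in> sphere 0 1 \<Longrightarrow> norm (g x) \<le> B"
    unfolding bounded_iff by blast
  then show ?thesis
    using borel_measurable_surface_measure[OF assms]
    by (intro surface_measure.integrable_const_bound[where B = B] AE_I2) auto
qed

lemma measure_surface_pos: "0 < measure surface_measure (sphere (0::'a::euclidean_space) 1)"
proof -
  have "measure surface_measure (sphere (0::'a) 1) = (\<integral>x. 1 \<partial>(surface_measure :: 'a measure))"
    by simp
  also have "\<dots> = real DIM('a) * measure lborel (ball (0::'a) 1 - {0})"
    by (subst integral_surface_measure) auto
  also have "measure lborel (ball (0::'a) 1 - {0}) = measure lborel (ball (0::'a) 1)"
    by (rule measure_Diff_null_set) auto
  finally show ?thesis
    using content_ball_pos[of 1 "0::'a"] by simp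
qed

section \<open>Polar coordinates for homogeneous functions and the divergence theorem\<close>

lemma integral_lborel_scale:
  fixes h :: "'a::euclidean_space \<Rightarrow> real"
  assumes [measurable]: "h \<in> borel_measurable borel" and "0 < r"
  shows "(\<integral>x. h (x /\<^sub>R r) \<partial>lborel) = r ^ DIM('a) * (\<integral>x. h x \<partial>lborel)"
proof -
  have "(\<integral>x. h (x /\<^sub>R r) \<partial>lborel) =
      (\<integral>x. h (x /\<^sub>R r) \<partial>density (distr lborel borel (\<lambda>x. 0 + r *\<^sub>R x)) (\<lambda>x. ennreal (\<bar>r\<bar> ^ DIM('a))))"
    using lborel_affine[of r "0::'a"] assms by auto
  also have "\<dots> = r ^ DIM('a) * (\<integral>x. h x \<partial>lborel)"
    using assms by (subst integral_density) (auto simp: integral_distr)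
  finally show ?thesis .
qed

lemma integral_power_interval:
  fixes n :: nat and a :: real
  assumes "0 < n" "0 \<le> a" "a \<le> 1"
  shows "(\<integral>r. indicator {a<..<1} r * (real n * r ^ (n - 1)) \<partial>lborel) = 1 - a ^ n"
proof -
  have "(\<integral>r. indicator {a<..<1} r * (real n * r ^ (n - 1)) \<partial>lborel)
     = (\<integral>r. (real n * r ^ (n - 1)) * indicator {a..1} r \<partial>lborel)"
  proof (rule integral_cong_AE)
    have "AE r in lborel. r \<noteq> a" "AE r in lborel. r \<noteq> 1"
      by (rule AE_lborel_singleton)+
    then show "AE r in lborel. indicator {a<..<1} r * (real n * r ^ (n - 1)) =
       (real n * r ^ (n - 1)) * indicator {a..1} r"
      by eventually_elim (auto simp: indicator_def)
  qed auto
  also have "\<dots> = 1 ^ n - a ^ n"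
    using assms
    by (intro integral_FTC_Icc_real) (auto intro!: derivative_eq_intros)
  finally show ?thesis by simp
qed

text \<open>Surface measure is defined through cones, so the sphere integral is already D times the
  ball integral of the degree-0 extension \<open>h\<close>. It remains to integrate out the weight
  |x|^n, which is done by writing 1 - |x|^n as the integral of n r^(n-1) over |x| < r < 1.\<close>

lemma integral_ball_homogeneous:
  fixes P :: "'a::euclidean_space \<Rightarrow> real"
  assumes cont: "continuous_on UNIV P" and hom: "\<And>r x. 0 < r \<Longrightarrow> P (r *\<^sub>R x) = r ^ n * P x"
  shows "real (DIM('a) + n) * (\<integral>x. indicator (ball 0 1) x * P x \<partial>lborel) =
     (\<integral>x. P x \<partial>surface_measure)"
proof -
  define D where "D = DIM('a)"
  define h where "h = (\<lambda>x. indicator (ball 0 1 - {0}) x * P (x /\<^sub>R norm x))"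
  have [measurable]: "ball (0::'a) 1 \<in> sets borel"
    by simp
  have Pm [measurable]: "P \<in> borel_measurable borel"
    using cont by (rule borel_measurable_continuous_onI)
  have hm [measurable]: "h \<in> borel_measurable borel"
    unfolding h_def
    by (intro borel_measurable_times borel_measurable_indicator measurable_compose[OF _ Pm]) auto
  have surf: "(\<integral>x. P x \<partial>surface_measure) = D * (\<integral>x. h x \<partial>lborel)"
    unfolding D_def h_def using continuous_on_subset[OF cont]
    by (subst integral_surface_measure) (auto intro!: borel_measurable_surface_measure)
  have PH: "P x = norm x ^ n * P (x /\<^sub>R norm x)" if "x \<noteq> 0" for x
    using hom[of "norm x" "x /\<^sub>R norm x"] that by simp
  have ballP: "(\<integral>x. indicator (ball 0 1) x * P x \<partial>lborel) = (\<integral>x. norm x ^ n * h x \<partial>lborel)"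
  proof (rule integral_cong_AE)
    have "AE x in lborel. x \<noteq> (0::'a)"
      by (rule AE_lborel_singleton)
    then show "AE x in lborel. indicator (ball 0 1) x * P x = norm x ^ n * h x"
      by eventually_elim (auto simp: h_def indicator_def PH[symmetric])
  qed auto
  have "bounded (P ` sphere 0 1)"
    using continuous_on_subset[OF cont] by (intro compact_imp_bounded compact_continuous_image) auto
  then obtain B where B: "\<And>x. norm x = 1 \<Longrightarrow> \<bar>P x\<bar> \<le> B"
    unfolding bounded_iff by force
  have B0: "0 \<le> B"
  proof -
    obtain b :: 'a where "b \<in> Basis" using nonempty_Basis by blast
    then show ?thesis using B[of b] by auto
  qed
  have hB: "\<bar>h x\<bar> \<le> B * indicator (ball 0 1) x" for x
    using B0 B[of "x /\<^sub>R norm x"] by (auto simp: h_def indicator_def)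
  have ib: "integrable lborel (\<lambda>x::'a. B * indicator (ball 0 1) x)"
    by (intro integrable_mult_right integrable_real_indicator emeasure_bounded_finite) auto
  have ih: "integrable lborel h"
    by (rule Bochner_Integration.integrable_bound[OF ib]) (use hB B0 in \<open>auto simp: order_trans[OF hB]\<close>)
  have "(\<integral>x. norm x ^ n * h x \<partial>lborel) * real (D + n) = D * (\<integral>x. h x \<partial>lborel)"
  proof (cases "n = 0")
    case False
    \<comment> \<open>Fubini for \<open>F\<close>: integrating over r first gives (1 - |x|^n) h(x);
      integrating over x first gives, by scaling, a constant times r^(D+n-1).\<close>
    define F where "F = (\<lambda>(x::'a, r::real). indicator {0<..<1} r * (real n * r ^ (n - 1)) * (indicator (ball 0 r) x * h x))"
    have "emeasure lborel (ball (0::'a) 1 \<times> {0<..<1::real}) < \<infinity>"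
      by (intro emeasure_bounded_finite bounded_Times) auto
    then have "integrable (lborel \<Otimes>\<^sub>M lborel) (\<lambda>z. (real n * B) * indicator (ball (0::'a) 1 \<times> {0<..<1::real}) z :: real)"
      unfolding lborel_prod
      by (intro integrable_mult_right integrable_real_indicator) (auto intro!: borel_open open_Times)
    then have iF: "integrable (lborel \<Otimes>\<^sub>M lborel) F"
    proof (rule Bochner_Integration.integrable_bound)
      show "F \<in> borel_measurable (lborel \<Otimes>\<^sub>M lborel)"
        unfolding F_def ball_def case_prod_beta by measurable
      have "norm (F (x, r)) \<le> norm ((real n * B) * indicator (ball 0 1 \<times> {0<..<1}) (x, r) :: real)" for x r
      proof (cases "r \<in> {0<..<1} \<and> x \<in> ball 0 1")
        case True
        have "r ^ (n - 1) \<le> 1" using True by (intro power_le_one) auto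
        moreover have "\<bar>indicator (ball 0 r) x * h x\<bar> \<le> B"
          using order_trans[OF hB[of x], of B] B0 by (auto simp: indicator_def)
        ultimately have "\<bar>r ^ (n - 1) * (indicator (ball 0 r) x * h x)\<bar> \<le> 1 * B"
          unfolding abs_mult[of "r ^ (n - 1)"] using True by (intro mult_mono) auto
        then show ?thesis using True B0
          by (auto simp: F_def abs_mult indicator_def mult.assoc intro!: mult_left_mono)
      qed (auto simp: F_def indicator_def h_def)
      then show "AE z in lborel \<Otimes>\<^sub>M lborel. norm (F z) \<le> norm ((real n * B) * indicator (ball 0 1 \<times> {0<..<1}) z :: real)"
        by (intro AE_I2) auto
    qed
    have x_first: "(\<integral>x. F (x, r) \<partial>lborel) =
        indicator {0<..<1} r * (real n * r ^ (n - 1)) * (r ^ D * (\<integral>x. h x \<partial>lborel))" for r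
    proof (cases "0 < r \<and> r < 1")
      case True
      have "indicator (ball 0 r) x * h x = h (x /\<^sub>R r)" for x
        using True by (auto simp: h_def indicator_def divide_simps)
      then have "(\<integral>x. indicator (ball 0 r) x * h x \<partial>lborel) = r ^ D * (\<integral>x. h x \<partial>lborel)"
        using integral_lborel_scale[of h r] True by (simp add: D_def)
      then show ?thesis by (simp add: F_def)
    qed (auto simp: F_def indicator_def)
    have r_first: "(\<integral>r. F (x, r) \<partial>lborel) = (1 - norm x ^ n) * h x" for x
    proof (cases "norm x < 1")
      case True
      have "(\<integral>r. F (x, r) \<partial>lborel) = (\<integral>r. indicator {norm x<..<1} r * (real n * r ^ (n - 1)) * h x \<partial>lborel)"
        unfolding F_def by (intro Bochner_Integration.integral_cong) (auto simp: indicator_def dest: le_less_trans[OF norm_ge_zero])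
      then show ?thesis
        using integral_power_interval[of n "norm x"] True False by simp
    qed (auto simp: F_def h_def indicator_def)
    have "(\<integral>x. (1 - norm x ^ n) * h x \<partial>lborel) =
       (\<integral>r. indicator {0<..<1} r * (real n * r ^ (n - 1)) * (r ^ D * (\<integral>x. h x \<partial>lborel)) \<partial>lborel)"
      using lborel_pair.Fubini_integral[of "\<lambda>x r. F (x, r)"] iF x_first r_first by simp
    also have "\<dots> = (\<integral>r. (real n / real (D + n)) * (\<integral>x. h x \<partial>lborel) *
         (indicator {0<..<1} r * (real (D + n) * r ^ (D + n - 1))) \<partial>lborel)"
    proof (rule Bochner_Integration.integral_cong)
      fix r :: real
      have "r ^ (n - 1) * r ^ D = r ^ (D + n - 1)"
        using False by (simp add: power_add[symmetric] add.commute)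
      then show "indicator {0<..<1} r * (real n * r ^ (n - 1)) * (r ^ D * (\<integral>x. h x \<partial>lborel)) =
        (real n / real (D + n)) * (\<integral>x. h x \<partial>lborel) *
         (indicator {0<..<1} r * (real (D + n) * r ^ (D + n - 1)))"
        using False by (simp add: field_simps)
    qed simp
    also have "\<dots> = (real n / real (D + n)) * (\<integral>x. h x \<partial>lborel)"
      unfolding integral_mult_right_zero
      by (subst integral_power_interval[of "D + n" 0]) (use False in auto)
    finally have *: "(\<integral>x. (1 - norm x ^ n) * h x \<partial>lborel) = (real n / real (D + n)) * (\<integral>x. h x \<partial>lborel)" .
    have inh: "integrable lborel (\<lambda>x. norm x ^ n * h x)"
    proof (rule Bochner_Integration.integrable_bound[OF ih])
      have "norm x ^ n * \<bar>h x\<bar> \<le> \<bar>h x\<bar>" for x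
      proof (cases "norm x < 1")
        case True
        then show ?thesis by (intro mult_left_le_one_le power_le_one) auto
      qed (auto simp: h_def)
      then show "AE x in lborel. norm (norm x ^ n * h x) \<le> norm (h x)"
        by (auto simp: abs_mult)
    qed auto
    have "(\<integral>x. h x \<partial>lborel) - (\<integral>x. norm x ^ n * h x \<partial>lborel) = (real n / real (D + n)) * (\<integral>x. h x \<partial>lborel)"
      using * ih inh by (simp add: left_diff_distrib)
    then show ?thesis using False by (simp add: field_simps)
  qed simp
  then show ?thesis using surf ballP by (simp add: D_def mult.commute)
qed

text \<open>The difference quotients of \<open>G\<close> along \<open>v\<close> have integral 0 by
  translation invariance. They are bounded by \<open>L\<close> through the mean value theorem and
  live in one fixed ball, so dominated convergence passes to the derivative.\<close>

lemma integral_directional_derivative: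
  fixes G :: "'a::euclidean_space \<Rightarrow> real"
  assumes der: "\<And>x. (G has_derivative G' x) (at x)"
    and bound: "\<And>x. \<bar>G' x v\<bar> \<le> L"
    and supp: "\<And>x. 1 \<le> norm x \<Longrightarrow> G x = 0"
  shows "(\<integral>x. G' x v \<partial>lborel) = 0"
proof -
  define \<delta> where "\<delta> n = inverse (real (Suc n))" for n
  have \<delta>: "0 < \<delta> n" "\<delta> n \<le> 1" for n
    by (auto simp: \<delta>_def field_simps)
  define s where "s n x = (G (x + \<delta> n *\<^sub>R v) - G x) / \<delta> n" for n x
  have Gc: "continuous_on UNIV G"
    using der by (intro differentiable_imp_continuous_on)
      (auto simp: differentiable_on_def differentiable_def intro: has_derivative_at_withinI)
  have [measurable]: "G \<in> borel_measurable borel"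
    using Gc by (rule borel_measurable_continuous_onI)
  have L0: "0 \<le> L" using bound[of undefined] by linarith
  have sm: "s n \<in> borel_measurable lborel" for n
    unfolding s_def by measurable
  have line: "((\<lambda>h. G (x + h *\<^sub>R v)) has_real_derivative G' (x + h *\<^sub>R v) v) (at h)" for x h
  proof -
    have "((\<lambda>h. G (x + h *\<^sub>R v)) has_derivative (\<lambda>k. G' (x + h *\<^sub>R v) (k *\<^sub>R v))) (at h)"
      by (rule has_derivative_compose[OF _ der, where f = "\<lambda>h. x + h *\<^sub>R v", unfolded o_def])
        (auto intro!: derivative_eq_intros)
    moreover have "(\<lambda>k. G' (x + h *\<^sub>R v) (k *\<^sub>R v)) = (*) (G' (x + h *\<^sub>R v) v)"
      using linear_scale[OF has_derivative_linear[OF der]] by (auto simp: fun_eq_iff)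
    ultimately show ?thesis by (simp add: has_field_derivative_def)
  qed
  have lim: "(\<lambda>n. s n x) \<longlonglongrightarrow> G' x v" for x
  proof -
    have "((\<lambda>h. (G (x + h *\<^sub>R v) - G x) / h) \<longlongrightarrow> G' x v) (at 0)"
      using line[of x 0] by (simp add: has_field_derivative_iff)
    moreover have "filterlim \<delta> (at 0) sequentially"
      unfolding filterlim_at using \<delta>(1) LIMSEQ_inverse_real_of_nat
      by (auto simp: \<delta>_def[abs_def] simp del: of_nat_Suc)
    ultimately show ?thesis unfolding s_def by (rule filterlim_compose)
  qed
  have sL: "\<bar>s n x\<bar> \<le> L" for n x
  proof -
    have "norm (G (x + \<delta> n *\<^sub>R v) - G (x + 0 *\<^sub>R v)) \<le> L * norm (\<delta> n - 0)"
      by (rule field_differentiable_bound[where S = UNIV and f = "\<lambda>h. G (x + h *\<^sub>R v)"])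
        (use line bound in auto)
    then show ?thesis using \<delta>(1)[of n] by (simp add: s_def field_simps)
  qed
  \<comment> \<open>The steps \<open>\<delta> n\<close> are at most 1, so a point moves by at most
    \<open>norm v\<close>; this fixes the radius of the common support.\<close>
  have s0: "s n x = 0" if "norm x \<ge> 1 + norm v" for n x
  proof -
    have "norm (\<delta> n *\<^sub>R v) \<le> norm v"
      using mult_right_mono[OF \<delta>(2)[of n], of "norm v"] \<delta>(1)[of n] by simp
    then have "1 \<le> norm (x + \<delta> n *\<^sub>R v)"
      using that norm_triangle_ineq4[of "x + \<delta> n *\<^sub>R v" "\<delta> n *\<^sub>R v"] by simp
    moreover have "1 \<le> norm x" using that norm_ge_zero[of v] by linarith
    ultimately show ?thesis by (simp add: s_def supp)
  qed
  have "(\<lambda>n. \<integral>x. s n x \<partial>lborel) \<longlonglongrightarrow> (\<integral>x. G' x v \<partial>lborel)"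
  proof (rule integral_dominated_convergence)
    show "integrable lborel (\<lambda>x::'a. L * indicator (ball 0 (1 + norm v)) x)"
      by (intro integrable_mult_right integrable_real_indicator emeasure_bounded_finite) auto
    show "AE x in lborel. norm (s n x) \<le> L * indicator (ball 0 (1 + norm v)) x" for n
      using sL s0 by (auto simp: indicator_def not_less)
    show "(\<lambda>x. G' x v) \<in> borel_measurable lborel"
      using lim sm by (rule borel_measurable_LIMSEQ_real)
    show "AE x in lborel. (\<lambda>n. s n x) \<longlonglongrightarrow> G' x v"
      using lim by auto
  qed (rule sm)
  moreover have "(\<integral>x. s n x \<partial>lborel) = 0" for n
  proof -
    have "bounded (G ` cball 0 1)"
      using continuous_on_subset[OF Gc] by (intro compact_imp_bounded compact_continuous_image) auto
    then obtain B where B: "\<And>x. x \<in> cball 0 1 \<Longrightarrow> \<bar>G x\<bar> \<le> B"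
      unfolding bounded_iff by force
    have iG: "integrable lborel G"
    proof (rule Bochner_Integration.integrable_bound)
      show "integrable lborel (\<lambda>x::'a. B * indicator (cball 0 1) x)"
        by (intro integrable_mult_right integrable_real_indicator emeasure_bounded_finite) auto
      show "AE x in lborel. norm (G x) \<le> norm (B * indicator (cball 0 1) x)"
        using B supp by (intro AE_I2) (auto simp: indicator_def not_le intro: order_trans[OF _ abs_ge_self])
    qed measurable
    have "(\<integral>x. G (x + \<delta> n *\<^sub>R v) \<partial>lborel) = (\<integral>x. G x \<partial>distr lborel borel ((+) (\<delta> n *\<^sub>R v)))"
      by (subst integral_distr) (auto simp: add.commute)
    then have 1: "(\<integral>x. G (x + \<delta> n *\<^sub>R v) \<partial>lborel) = (\<integral>x. G x \<partial>lborel)"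
      by (simp add: lborel_distr_plus)
    have "integrable (distr lborel borel ((+) (\<delta> n *\<^sub>R v))) G"
      using iG by (simp add: lborel_distr_plus)
    then have "integrable lborel (\<lambda>x. G (x + \<delta> n *\<^sub>R v))"
      by (subst (asm) integrable_distr_eq) (auto simp: add.commute)
    then show ?thesis using iG 1 by (simp add: s_def)
  qed
  ultimately show ?thesis by (simp add: LIMSEQ_const_iff)
qed

text \<open>Squaring smooths the kink of the positive part at 0. Hence the cut-off weight
  \<open>(max 0 (1 - x \<bullet> x))\<^sup>2\<close> is differentiable across the unit
  sphere.\<close>

lemma has_real_derivative_max_0_square:
  "((\<lambda>y::real. (max 0 y)\<^sup>2) has_real_derivative 2 * max 0 y) (at y)"
proof (cases "y = 0")
  case True
  have "((\<lambda>h. (max 0 h)\<^sup>2 / h) \<longlongrightarrow> 0) (at (0::real))"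
  proof (rule Lim_null_comparison)
    show "\<forall>\<^sub>F h in at (0::real). norm ((max 0 h)\<^sup>2 / h) \<le> \<bar>h\<bar>"
      by (auto simp: max_def power2_eq_square intro!: always_eventually)
    show "((\<lambda>h::real. \<bar>h\<bar>) \<longlongrightarrow> 0) (at 0)"
      by (intro tendsto_rabs_zero) auto
  qed
  then show ?thesis using True by (simp add: has_field_derivative_iff)
next
  case False
  show ?thesis
  proof (cases "0 < y")
    case True
    have "((\<lambda>y::real. y\<^sup>2) has_real_derivative 2 * y) (at y)"
      by (auto intro!: derivative_eq_intros)
    then show ?thesis
      using True by (subst has_field_derivative_cong_eventually[where g = "\<lambda>y. y\<^sup>2"])
        (auto simp: max_def eventually_at intro!: exI[of _ y] simp: dist_real_def)
  next
    case False
    with \<open>y \<noteq> 0\<close> have "y < 0" by simp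
    then show ?thesis
      by (subst has_field_derivative_cong_eventually[where g = "\<lambda>y. 0"])
        (auto simp: max_def eventually_at intro!: exI[of _ "-y"] simp: dist_real_def)
  qed
qed

text \<open>The divergence theorem in the ball for \<open>(1 - |x|\<^sup>2)\<^sup>2 P(x) v\<close>: the weight vanishes at the
  boundary to second order, and homogeneity turns each term into an integral over the sphere.\<close>
lemma integral_sphere_derivative:
  fixes P :: "'a::euclidean_space \<Rightarrow> real"
  assumes der: "\<And>x. (P has_derivative P' x) (at x)"
    and contQ: "continuous_on UNIV (\<lambda>x. P' x v)"
    and homP: "\<And>r x. 0 < r \<Longrightarrow> P (r *\<^sub>R x) = r ^ n * P x"
    and homQ: "\<And>r x. 0 < r \<Longrightarrow> P' (r *\<^sub>R x) v = r ^ j * P' x v"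
    and degree: "Suc j = n \<or> (\<forall>x. P' x v = 0)"
  shows "(\<integral>x. P' x v \<partial>surface_measure) = (real (DIM('a) + n) - 1) * (\<integral>x. (x \<bullet> v) * P x \<partial>surface_measure)"
proof -
  define D where "D = DIM('a)"
  have D1: "1 \<le> D" using DIM_positive[where 'a = 'a] unfolding D_def by linarith
  define q :: "'a \<Rightarrow> real" where "q x = max 0 (1 - x \<bullet> x)" for x
  define G where "G x = P x * (q x)\<^sup>2" for x
  define G' where "G' x v = P' x v * (q x)\<^sup>2 + P x * (2 * q x * (- 2 * (x \<bullet> v)))" for x v
  have qder: "((\<lambda>x. (q x)\<^sup>2) has_derivative (\<lambda>v. 2 * q x * (- 2 * (x \<bullet> v)))) (at x)" for x
  proof -
    have "((\<lambda>x::'a. 1 - x \<bullet> x) has_derivative (\<lambda>v. - 2 * (x \<bullet> v))) (at x)"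
      by (auto intro!: derivative_eq_intros simp: inner_commute)
    from has_derivative_compose[OF this has_real_derivative_max_0_square[unfolded has_field_derivative_def]]
    show ?thesis by (simp add: q_def)
  qed
  have Gder: "(G has_derivative G' x) (at x)" for x
    unfolding G_def G'_def
    by (rule has_derivative_eq_rhs[OF has_derivative_mult[OF der qder]]) (auto simp: fun_eq_iff)
  have Pc: "continuous_on UNIV P"
    using der by (intro differentiable_imp_continuous_on)
      (auto simp: differentiable_on_def differentiable_def intro: has_derivative_at_withinI)
  have qc: "continuous_on UNIV q"
    unfolding q_def by (intro continuous_intros)
  have cG': "continuous_on UNIV (\<lambda>x. G' x v)"
    unfolding G'_def by (intro continuous_intros Pc qc contQ)
  have out: "q x = 0" if "1 \<le> norm x" for x :: 'a
    using that one_le_power[of "norm x" 2] by (auto simp: q_def max_def power2_norm_eq_inner)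
  have qin: "q x = 1 - x \<bullet> x" if "norm x < 1" for x :: 'a
    using that power_less_one_iff[of "norm x" 2] by (auto simp: q_def max_def power2_norm_eq_inner)
  have "bounded ((\<lambda>x. G' x v) ` cball 0 1)"
    using continuous_on_subset[OF cG'] by (intro compact_imp_bounded compact_continuous_image) auto
  then obtain B where B: "\<And>x. x \<in> cball 0 1 \<Longrightarrow> \<bar>G' x v\<bar> \<le> B"
    unfolding bounded_iff by force
  have "\<bar>G' x v\<bar> \<le> max 0 B" for x
    using B[of x] out[of x] by (cases "norm x \<le> 1") (auto simp: G'_def)
  from integral_directional_derivative[OF Gder this]
  have zero: "(\<integral>x. G' x v \<partial>lborel) = 0"
    by (simp add: G_def out)
  define R where "R x = (x \<bullet> v) * P x" for x
  have Rc: "continuous_on UNIV R"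
    unfolding R_def by (intro continuous_intros Pc)
  have homR: "R (r *\<^sub>R x) = r ^ Suc n * R x" if "0 < r" for r x
    using homP[OF that] by (simp add: R_def)
  define I where "I F = (\<integral>x. indicator (ball 0 1) x * F x \<partial>lborel)" for F :: "'a \<Rightarrow> real"
  have int: "integrable lborel (\<lambda>x. indicator (ball 0 1) x * F x)" if F: "continuous_on UNIV F" for F :: "'a \<Rightarrow> real"
  proof -
    have "integrable lborel (\<lambda>x. indicator (cball 0 1) x *\<^sub>R F x)"
      using continuous_on_subset[OF F] by (intro borel_integrable_compact) auto
    then show ?thesis
    proof (rule Bochner_Integration.integrable_bound)
      have [measurable]: "F \<in> borel_measurable borel" "ball (0::'a) 1 \<in> sets borel"
        using F by (auto intro: borel_measurable_continuous_onI)
      show "(\<lambda>x. indicator (ball 0 1) x * F x) \<in> borel_measurable lborel"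
        by measurable
    qed (auto simp: indicator_def)
  qed
  \<comment> \<open>A factor (x \<bullet> x)^i equals 1 on the sphere, so it only raises the degree
    that appears in the denominator.\<close>
  have weighted: "I (\<lambda>x. F x * (x \<bullet> x) ^ i) = (\<integral>x. F x \<partial>surface_measure) / real (D + m + 2 * i)"
    if F: "continuous_on UNIV F" and hom: "\<And>r x. 0 < r \<Longrightarrow> F (r *\<^sub>R x) = r ^ m * F x"
    for F :: "'a \<Rightarrow> real" and m i
  proof -
    have "real (D + (m + 2 * i)) * I (\<lambda>x. F x * (x \<bullet> x) ^ i) =
       (\<integral>x. F x * (x \<bullet> x) ^ i \<partial>surface_measure)"
      unfolding I_def D_def
    proof (rule integral_ball_homogeneous)
      show "continuous_on UNIV (\<lambda>x. F x * (x \<bullet> x) ^ i)"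
        by (intro continuous_intros F)
      show "F (r *\<^sub>R x) * (r *\<^sub>R x \<bullet> r *\<^sub>R x) ^ i = r ^ (m + 2 * i) * (F x * (x \<bullet> x) ^ i)"
        if "0 < r" for r x
        using hom[OF that] by (simp add: power_add power_mult power_mult_distrib power2_eq_square)
    qed
    also have "\<dots> = (\<integral>x. F x \<partial>surface_measure)"
      by (rule Bochner_Integration.integral_cong) (auto simp: norm_eq_1)
    finally show ?thesis using D1 by (simp add: field_simps)
  qed
  \<comment> \<open>Expanding the weight and its derivative in powers of x \<bullet> x leaves
    homogeneous summands, each of which \<open>weighted\<close> evaluates.\<close>
  have "G' x v = indicator (ball 0 1) x * (P' x v * (x \<bullet> x) ^ 0) - 2 * (indicator (ball 0 1) x * (P' x v * (x \<bullet> x) ^ 1))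
     + indicator (ball 0 1) x * (P' x v * (x \<bullet> x) ^ 2)
     - 4 * (indicator (ball 0 1) x * (R x * (x \<bullet> x) ^ 0)) + 4 * (indicator (ball 0 1) x * (R x * (x \<bullet> x) ^ 1))" for x
  proof (cases "norm x < 1")
    case True
    then show ?thesis
      by (simp add: G'_def qin R_def) (simp add: algebra_simps power2_eq_square)
  qed (auto simp: G'_def out)
  then have "(\<integral>x. G' x v \<partial>lborel) = I (\<lambda>x. P' x v * (x \<bullet> x) ^ 0) - 2 * I (\<lambda>x. P' x v * (x \<bullet> x) ^ 1)
     + I (\<lambda>x. P' x v * (x \<bullet> x) ^ 2) - 4 * I (\<lambda>x. R x * (x \<bullet> x) ^ 0) + 4 * I (\<lambda>x. R x * (x \<bullet> x) ^ 1)"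
    by (simp add: I_def int continuous_intros contQ Rc del: power_0 power_one_right)
  also have "\<dots> = (\<integral>x. P' x v \<partial>surface_measure) * (1 / (D + j) - 2 / (D + j + 2) + 1 / (D + j + 4))
     - 4 * (\<integral>x. R x \<partial>surface_measure) * (1 / (D + Suc n) - 1 / (D + Suc n + 2))"
    by (simp only: weighted[OF contQ homQ] weighted[OF Rc homR])
      (simp add: algebra_simps)
  finally have main: "(\<integral>x. P' x v \<partial>surface_measure) * (1 / (D + j) - 2 / (D + j + 2) + 1 / (D + j + 4))
     = 4 * (\<integral>x. R x \<partial>surface_measure) * (1 / (D + Suc n) - 1 / (D + Suc n + 2))"
    using zero by simp
  define M where "M = real (D + n) - 1"
  define A where "A = (\<integral>x. P' x v \<partial>surface_measure)"
  define b where "b = (\<integral>x. R x \<partial>surface_measure)"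
  have M0: "0 \<le> M" using D1 by (simp add: M_def)
  have "A = M * b"
  \<comment> \<open>In the generic case the two brackets of \<open>main\<close> are 8/(M(M+2)(M+4))
    and, with the factor 4, 8/((M+2)(M+4)), whose quotient is M. Otherwise the derivative vanishes
    identically, and \<open>main\<close> forces \<open>b\<close> to vanish as well.\<close>
  proof (cases "Suc j = n")
    case True
    then have "real (D + j) = M" "real (D + Suc n) = M + 2" "0 < M"
      using D1 by (auto simp: M_def)
    then have "A * (1 / M - 2 / (M + 2) + 1 / (M + 4)) = 4 * b * (1 / (M + 2) - 1 / (M + 4))"
      using main by (simp add: A_def b_def add.commute add.left_commute)
    moreover have "1 / M - 2 / (M + 2) + 1 / (M + 4) = 8 / (M * (M + 2) * (M + 4))"
      "4 * b * (1 / (M + 2) - 1 / (M + 4)) = 8 * b / ((M + 2) * (M + 4))"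
      using \<open>0 < M\<close> by (simp_all add: divide_simps) (simp_all add: algebra_simps)
    ultimately show ?thesis using \<open>0 < M\<close> by (simp add: divide_simps split: if_splits)
  next
    case False
    then have "A = 0" using degree by (simp add: A_def)
    moreover have "b * (1 / (D + Suc n) - 1 / (D + Suc n + 2)) = 0"
      using main \<open>A = 0\<close> by (simp add: A_def b_def)
    then have "b = 0" by (simp add: divide_simps)
    ultimately show ?thesis by simp
  qed
  then show ?thesis by (simp add: A_def b_def M_def D_def R_def)
qed

text \<open>The divergence identity for P(x) = (x \<bullet> e)^m (x \<bullet> w)^k, with the product
  rule on the left. A truncated exponent always comes with the coefficient m or k that vanishes
  there.\<close>

lemma integral_sphere_inner_powers:
  fixes e w v :: "'a::euclidean_space"
  shows "real m * (e \<bullet> v) * (\<integral>x. (x \<bullet> e) ^ (m - 1) * (x \<bullet> w) ^ k \<partial>surface_measure) +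
     real k * (w \<bullet> v) * (\<integral>x. (x \<bullet> e) ^ m * (x \<bullet> w) ^ (k - 1) \<partial>surface_measure) =
     (real (DIM('a) + m + k) - 1) * (\<integral>x. (x \<bullet> v) * ((x \<bullet> e) ^ m * (x \<bullet> w) ^ k) \<partial>surface_measure)"
proof -
  define P where "P x = (x \<bullet> e) ^ m * (x \<bullet> w) ^ k" for x
  define P' where "P' x v = real m * (e \<bullet> v) * ((x \<bullet> e) ^ (m - 1) * (x \<bullet> w) ^ k) +
    real k * (w \<bullet> v) * ((x \<bullet> e) ^ m * (x \<bullet> w) ^ (k - 1))" for x v
  have "(\<integral>x. P' x v \<partial>surface_measure) = (real (DIM('a) + (m + k)) - 1) * (\<integral>x. (x \<bullet> v) * P x \<partial>surface_measure)"
  proof (rule integral_sphere_derivative[where j = "m + k - 1"])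
    show "(P has_derivative P' x) (at x)" for x
      unfolding P_def P'_def
      by (auto intro!: derivative_eq_intros simp: fun_eq_iff algebra_simps inner_commute)
    show "continuous_on UNIV (\<lambda>x. P' x v)"
      unfolding P'_def by (intro continuous_intros)
    show "P (r *\<^sub>R x) = r ^ (m + k) * P x" if "0 < r" for r x
      by (simp add: P_def power_mult_distrib power_add)
    show "P' (r *\<^sub>R x) v = r ^ (m + k - 1) * P' x v" if "0 < r" for r x
    proof (cases m)
      case 0
      then show ?thesis
        by (simp add: P'_def power_mult_distrib power_add algebra_simps)
    next
      case (Suc m')
      have "r ^ (m' + k) = r * r ^ (m' + k - 1)" if "k \<noteq> 0"
        using that by (metis Suc_pred' add_gr_0 bot_nat_0.not_eq_extremum power_Suc)
      then show ?thesis using Suc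
        by (cases k) (simp_all add: P'_def power_mult_distrib power_add algebra_simps)
    qed
    show "Suc (m + k - 1) = m + k \<or> (\<forall>x. P' x v = 0)"
      by (cases "m + k") (auto simp: P'_def)
  qed
  moreover have "(\<integral>x. P' x v \<partial>surface_measure) =
    real m * (e \<bullet> v) * (\<integral>x. (x \<bullet> e) ^ (m - 1) * (x \<bullet> w) ^ k \<partial>surface_measure) +
     real k * (w \<bullet> v) * (\<integral>x. (x \<bullet> e) ^ m * (x \<bullet> w) ^ (k - 1) \<partial>surface_measure)"
    unfolding P'_def
    by (subst Bochner_Integration.integral_add)
      (auto intro!: integrable_surface_measure continuous_intros)
  ultimately show ?thesis by (simp add: P_def add.assoc)
qed

text \<open>Symmetry of the spherical Laplacian for two powers of linear forms. The divergence
  identity along e (\<open>A\<close>) and along w (\<open>B\<close>) contains the mixed moment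
  \<open>I (m - 1) (k - 1)\<close> with the same coefficient m k (e \<bullet> w), and subtraction
  removes it.\<close>

lemma integral_sphere_green:
  fixes e w :: "'a::euclidean_space"
  assumes "norm e = 1"
  shows "(\<integral>x. (x \<bullet> w) ^ k * (real m * (real m - 1) * (x \<bullet> e) ^ (m - 2) -
        real m * (real m + real DIM('a) - 2) * (x \<bullet> e) ^ m) \<partial>surface_measure) =
     (\<integral>x. (x \<bullet> e) ^ m * (real k * (real k - 1) * (norm w)\<^sup>2 * (x \<bullet> w) ^ (k - 2) -
        real k * (real k + real DIM('a) - 2) * (x \<bullet> w) ^ k) \<partial>surface_measure)"
proof -
  define D where "D = real DIM('a)"
  define I where "I m k = (\<integral>x. (x \<bullet> e) ^ m * (x \<bullet> w) ^ k \<partial>surface_measure)" for m k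
  have ee: "e \<bullet> e = 1" using assms by (simp add: norm_eq_1)
  have A: "real m * ((real m - 1) * I (m - 2) k + real k * (w \<bullet> e) * I (m - 1) (k - 1)) =
     real m * (D + m + k - 2) * I m k" for m k
  proof (cases m)
    case (Suc m')
    have "(\<integral>x. (x \<bullet> e) * ((x \<bullet> e) ^ m' * (x \<bullet> w) ^ k) \<partial>surface_measure) = I m k"
      unfolding I_def Suc by (rule Bochner_Integration.integral_cong) auto
    then have "real m' * I (m' - 1) k + real k * (w \<bullet> e) * I m' (k - 1) = (D + m' + k - 1) * I m k"
      using integral_sphere_inner_powers[of m' e e w k] ee by (simp add: I_def D_def)
    then show ?thesis by (simp add: Suc numeral_2_eq_2)
  qed simp
  have B: "real k * (real m * (e \<bullet> w) * I (m - 1) (k - 1) + (real k - 1) * (norm w)\<^sup>2 * I m (k - 2)) =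
     real k * (D + m + k - 2) * I m k" for m k
  proof (cases k)
    case (Suc k')
    have "(\<integral>x. (x \<bullet> w) * ((x \<bullet> e) ^ m * (x \<bullet> w) ^ k') \<partial>surface_measure) = I m k"
      unfolding I_def Suc by (rule Bochner_Integration.integral_cong) auto
    then have "real m * (e \<bullet> w) * I (m - 1) k' + real k' * (norm w)\<^sup>2 * I m (k' - 1) = (D + m + k' - 1) * I m k"
      using integral_sphere_inner_powers[of m e w w k'] by (simp add: I_def D_def power2_norm_eq_inner)
    then show ?thesis by (simp add: Suc numeral_2_eq_2)
  qed simp
  have "(\<integral>x. (x \<bullet> w) ^ k * (real m * (real m - 1) * (x \<bullet> e) ^ (m - 2) -
        real m * (real m + D - 2) * (x \<bullet> e) ^ m) \<partial>surface_measure) =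
     (\<integral>x. real m * (real m - 1) * ((x \<bullet> e) ^ (m - 2) * (x \<bullet> w) ^ k) -
        real m * (real m + D - 2) * ((x \<bullet> e) ^ m * (x \<bullet> w) ^ k) \<partial>surface_measure)"
    by (rule Bochner_Integration.integral_cong) (auto simp: algebra_simps)
  also have "\<dots> = real m * (real m - 1) * I (m - 2) k - real m * (real m + D - 2) * I m k"
    unfolding I_def by (subst Bochner_Integration.integral_diff)
      (auto intro!: integrable_surface_measure continuous_intros)
  also have "\<dots> = real k * (real k - 1) * (norm w)\<^sup>2 * I m (k - 2) - real k * (real k + D - 2) * I m k"
    using A[of m k] B[of k m] by (simp add: inner_commute algebra_simps)
  also have "\<dots> = (\<integral>x. real k * (real k - 1) * (norm w)\<^sup>2 * ((x \<bullet> e) ^ m * (x \<bullet> w) ^ (k - 2)) -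
        real k * (real k + D - 2) * ((x \<bullet> e) ^ m * (x \<bullet> w) ^ k) \<partial>surface_measure)"
    unfolding I_def by (subst Bochner_Integration.integral_diff)
      (auto intro!: integrable_surface_measure continuous_intros)
  also have "\<dots> = (\<integral>x. (x \<bullet> e) ^ m * (real k * (real k - 1) * (norm w)\<^sup>2 * (x \<bullet> w) ^ (k - 2) -
        real k * (real k + D - 2) * (x \<bullet> w) ^ k) \<partial>surface_measure)"
    by (rule Bochner_Integration.integral_cong) (auto simp: algebra_simps)
  finally show ?thesis by (simp add: D_def)
qed

section \<open>Zonal polynomials\<close>

text \<open>The zonal harmonics normalised by the value 1 at the pole, through the three-term recurrence
  \<open>(n + d - 1) Z\<^sub>n\<^sub>+\<^sub>1 = (2 n + d - 1) X Z\<^sub>n - n Z\<^sub>n\<^sub>-\<^sub>1\<close> of the Gegenbauer polynomials.\<close>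
fun zonal_poly :: "nat \<Rightarrow> nat \<Rightarrow> real poly" where
  "zonal_poly d 0 = 1"
| "zonal_poly d (Suc 0) = [:0, 1:]"
| "zonal_poly d (Suc (Suc n)) = smult (1 / real (n + d))
     (of_nat (2 * n + d + 1) * ([:0, 1:] * zonal_poly d (Suc n)) - of_nat (n + 1) * zonal_poly d n)"

lemma of_nat_mult_smult_inverse:
  "0 < m \<Longrightarrow> of_nat m * smult (1 / real m) p = (p :: real poly)"
  by (simp add: of_nat_poly)

lemma zonal_poly_rec:
  assumes "0 < d"
  shows "of_nat (n + d) * zonal_poly d (Suc (Suc n)) =
     of_nat (2 * n + d + 1) * ([:0, 1:] * zonal_poly d (Suc n)) - of_nat (n + 1) * zonal_poly d n"
  unfolding zonal_poly.simps using assms by (intro of_nat_mult_smult_inverse) simp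

lemma poly_zonal_poly_1: "0 < d \<Longrightarrow> poly (zonal_poly d n) 1 = 1"
proof (induction d n rule: zonal_poly.induct)
  case (3 d n)
  then show ?case by (simp add: field_simps)
qed auto

text \<open>Differentiating the recurrence expresses the new derivative through the two preceding
  ones, which the induction hypotheses replace. Numbers are treated as constant polynomials, so that
  everything is an identity in one integral domain, where the leading factor cancels.\<close>

lemma pderiv_zonal_poly:
  assumes "0 < d"
  shows "(1 - [:0, 1:]\<^sup>2) * pderiv (zonal_poly d (Suc n)) =
    of_nat (Suc n) * (zonal_poly d n - [:0, 1:] * zonal_poly d (Suc n))"
  using assms
proof (induction d n rule: zonal_poly.induct)
  case (1 d)
  then show ?case by (simp add: pderiv_pCons power2_eq_square)
next
  case (2 d)
  define X :: "real poly" where "X = [:0, 1:]"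
  define Z where "Z = zonal_poly d (Suc (Suc 0))"
  define D :: "real poly" where "D = of_nat d"
  have rec: "D * Z = (D + 1) * X\<^sup>2 - 1"
    using zonal_poly_rec[OF 2, of 0] by (simp add: Z_def X_def D_def power2_eq_square)
  have "pderiv D = 0" "pderiv (D + 1) = 0" "pderiv X = 1"
    by (simp_all add: D_def X_def of_nat_poly pderiv_pCons pderiv_add)
  then have der: "D * pderiv Z = (D + 1) * (2 * X)"
    using arg_cong[OF rec, of pderiv] by (simp add: pderiv_mult pderiv_diff power2_eq_square)
  have "D * ((1 - X\<^sup>2) * pderiv Z) = D * (2 * (X - X * Z))"
    using rec der by algebra
  moreover have "D \<noteq> 0" using 2 by (simp add: D_def of_nat_poly)
  ultimately have "(1 - X\<^sup>2) * pderiv Z = 2 * (X - X * Z)"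
    by simp
  then show ?case by (simp add: Z_def X_def del: zonal_poly.simps(3))
next
  case (3 d n)
  define X :: "real poly" where "X = [:0, 1:]"
  define Z where "Z = zonal_poly d"
  define N D :: "real poly" where "N = of_nat n" and "D = of_nat d"
  have X': "pderiv X = 1" by (simp add: X_def pderiv_pCons)
  have rec1: "(N + D) * Z (Suc (Suc n)) = (2 * N + D + 1) * (X * Z (Suc n)) - (N + 1) * Z n"
    using zonal_poly_rec[OF \<open>0 < d\<close>, of n] by (simp add: Z_def X_def N_def D_def algebra_simps del: zonal_poly.simps)
  have rec2: "(N + 1 + D) * Z (Suc (Suc (Suc n))) = (2 * N + D + 3) * (X * Z (Suc (Suc n))) - (N + 2) * Z (Suc n)"
    using zonal_poly_rec[OF \<open>0 < d\<close>, of "Suc n"]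
    by (simp add: Z_def X_def N_def D_def algebra_simps del: zonal_poly.simps)
  have ih1: "(1 - X\<^sup>2) * pderiv (Z (Suc (Suc n))) = (N + 2) * (Z (Suc n) - X * Z (Suc (Suc n)))"
    using 3 by (simp add: Z_def X_def N_def D_def add.commute del: zonal_poly.simps)
  have ih2: "(1 - X\<^sup>2) * pderiv (Z (Suc n)) = (N + 1) * (Z n - X * Z (Suc n))"
    using 3 by (simp add: Z_def X_def N_def D_def add.commute del: zonal_poly.simps)
  have "pderiv ((N + 1 + D) * Z (Suc (Suc (Suc n)))) = (N + 1 + D) * pderiv (Z (Suc (Suc (Suc n))))"
    by (simp add: pderiv_mult N_def D_def of_nat_poly pderiv_pCons pderiv_add)
  moreover have "pderiv ((2 * N + D + 3) * (X * Z (Suc (Suc n))) - (N + 2) * Z (Suc n)) =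
     (2 * N + D + 3) * (Z (Suc (Suc n)) + X * pderiv (Z (Suc (Suc n)))) - (N + 2) * pderiv (Z (Suc n))"
  proof -
    have c: "pderiv (2 * N + D + 3) = 0" "pderiv (N + 2) = 0"
      by (simp_all add: N_def D_def of_nat_poly numeral_poly pderiv_pCons pderiv_add pderiv_mult)
    show ?thesis
      unfolding pderiv_diff pderiv_mult[of "2 * N + D + 3"] pderiv_mult[of "N + 2"] c
      by (simp add: pderiv_mult X')
  qed
  ultimately have der: "(N + 1 + D) * pderiv (Z (Suc (Suc (Suc n)))) =
     (2 * N + D + 3) * (Z (Suc (Suc n)) + X * pderiv (Z (Suc (Suc n)))) - (N + 2) * pderiv (Z (Suc n))"
    using rec2 by simp
  have "(N + 1 + D) * ((1 - X\<^sup>2) * pderiv (Z (Suc (Suc (Suc n))))) =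
     (N + 1 + D) * ((N + 3) * (Z (Suc (Suc n)) - X * Z (Suc (Suc (Suc n)))))"
    using rec1 rec2 ih1 ih2 der by algebra
  moreover have "N + 1 + D \<noteq> 0"
    by (simp add: N_def D_def of_nat_poly one_pCons)
  ultimately have "(1 - X\<^sup>2) * pderiv (Z (Suc (Suc (Suc n)))) = (N + 3) * (Z (Suc (Suc n)) - X * Z (Suc (Suc (Suc n))))"
    by simp
  then show ?case by (simp add: Z_def X_def N_def D_def add.commute del: zonal_poly.simps)
qed

section \<open>The Gegenbauer operator: the Laplacian of the d-sphere on functions of x \<bullet>
  e\<close>

definition gegenbauer_op :: "nat \<Rightarrow> real poly \<Rightarrow> real poly" where
  "gegenbauer_op d Q = (1 - [:0, 1:]\<^sup>2) * pderiv (pderiv Q) - of_nat d * [:0, 1:] * pderiv Q"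

lemma gegenbauer_op_add: "gegenbauer_op d (p + q) = gegenbauer_op d p + gegenbauer_op d q"
  by (simp add: gegenbauer_op_def pderiv_add algebra_simps)

lemma gegenbauer_op_smult: "gegenbauer_op d (smult c p) = smult c (gegenbauer_op d p)"
  by (simp add: gegenbauer_op_def pderiv_smult algebra_simps smult_diff_right smult_add_right)

lemma gegenbauer_op_0: "gegenbauer_op d 0 = 0"
  by (simp add: gegenbauer_op_def)

lemma gegenbauer_op_sum: "gegenbauer_op d (sum f A) = (\<Sum>i\<in>A. gegenbauer_op d (f i))"
  by (induction A rule: infinite_finite_induct) (auto simp: gegenbauer_op_add gegenbauer_op_0)

text \<open>\<open>der1\<close> and \<open>der2\<close> are first-order relations coupling Z_n with
  Z_m, m = n - 1. Cancelling the nonzero polynomial 1 - X^2 gives \<open>lower\<close>; inserting it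
  into the derivative of \<open>der1\<close> leaves a second-order equation for Z_n alone.\<close>

lemma gegenbauer_op_zonal_poly:
  assumes "0 < d"
  shows "gegenbauer_op d (zonal_poly d n) = - (of_nat (n * (n + d - 1)) * zonal_poly d n)"
proof (cases n)
  case 0
  then show ?thesis by (simp add: gegenbauer_op_def pderiv_1)
next
  case (Suc m)
  define X :: "real poly" where "X = [:0, 1:]"
  define Z where "Z = zonal_poly d"
  define M D :: "real poly" where "M = of_nat m" and "D = of_nat d"
  have X': "pderiv X = 1" by (simp add: X_def pderiv_pCons)
  have ne: "1 - X\<^sup>2 \<noteq> 0" by (simp add: X_def power2_eq_square one_pCons)
  have der1: "(1 - X\<^sup>2) * pderiv (Z n) = (M + 1) * (Z m - X * Z n)"
    using pderiv_zonal_poly[OF assms, of m] by (simp add: Suc Z_def X_def M_def add.commute)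
  have der2: "(1 - X\<^sup>2) * pderiv (Z m) = (M + D - 1) * (X * Z m - Z n)"
  proof (cases m)
    case 0
    then show ?thesis by (simp add: Suc Z_def X_def pderiv_1)
  next
    case (Suc k)
    have "(1 - X\<^sup>2) * pderiv (Z m) = M * (Z k - X * Z m)"
      using pderiv_zonal_poly[OF assms, of k] by (simp add: Suc Z_def X_def M_def add.commute)
    moreover have "(M + D - 1) * Z n = (2 * M + D - 1) * (X * Z m) - M * Z k"
      using zonal_poly_rec[OF assms, of k] \<open>n = Suc m\<close> Suc
      by (simp add: Z_def X_def M_def D_def algebra_simps del: zonal_poly.simps)
    ultimately show ?thesis by algebra
  qed
  have "(1 - X\<^sup>2) * ((M + 1) * pderiv (Z m)) = (1 - X\<^sup>2) * ((M + D - 1) * (X * pderiv (Z n) - (M + 1) * Z n))"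
    using der1 der2 by algebra
  then have lower: "(M + 1) * pderiv (Z m) = (M + D - 1) * (X * pderiv (Z n) - (M + 1) * Z n)"
    using ne by simp
  have "pderiv (1 - X\<^sup>2) = - (2 * X)"
    by (simp add: X_def pderiv_diff pderiv_1 power2_eq_square pderiv_mult pderiv_pCons numeral_poly)
  moreover have "pderiv (M + 1) = 0"
    by (simp add: M_def of_nat_poly pderiv_pCons pderiv_add)
  ultimately have "pderiv ((1 - X\<^sup>2) * pderiv (Z n)) = (1 - X\<^sup>2) * pderiv (pderiv (Z n)) + pderiv (Z n) * (- (2 * X))"
    "pderiv ((M + 1) * (Z m - X * Z n)) = (M + 1) * (pderiv (Z m) - (X * pderiv (Z n) + Z n))"
    by (simp_all only: pderiv_mult[of "1 - X\<^sup>2"] pderiv_mult[of "M + 1"] pderiv_diff[of "Z m"] pderiv_mult[of X] X')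
      simp_all
  then have "(1 - X\<^sup>2) * pderiv (pderiv (Z n)) - 2 * X * pderiv (Z n) =
     (M + 1) * (pderiv (Z m) - (Z n + X * pderiv (Z n)))"
    using arg_cong[OF der1, of pderiv] by algebra
  then have "(1 - X\<^sup>2) * pderiv (pderiv (Z n)) - D * X * pderiv (Z n) = - ((M + 1) * (M + D) * Z n)"
    using lower by algebra
  then show ?thesis by (simp add: gegenbauer_op_def Z_def X_def M_def D_def Suc algebra_simps)
qed

text \<open>Comparison of the leading terms at the singular point 1 of the differential equation.\<close>
lemma gegenbauer_op_eigen_unique:
  assumes "0 < d" and eigen: "gegenbauer_op d W = - (l * W)" and "poly W 1 = 0"
  shows "W = 0"
proof (rule ccontr)
  assume "W \<noteq> 0"
  define q :: "real poly" where "q = [:- 1, 1:]"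
  have q': "pderiv q = 1" by (simp add: q_def pderiv_pCons)
  obtain V where V: "W = q ^ order 1 W * V" "\<not> q dvd V"
    using order_decomp[OF \<open>W \<noteq> 0\<close>, of 1] by (auto simp: q_def)
  have "order 1 W \<noteq> 0"
    using \<open>W \<noteq> 0\<close> \<open>poly W 1 = 0\<close> order_root by blast
  then obtain m where W: "W = q ^ Suc m * V"
    using V(1) by (metis not0_implies_Suc)
  have V1: "poly V 1 \<noteq> 0"
    using V(2) by (simp add: q_def poly_eq_0_iff_dvd)
  define U where "U = of_nat (Suc m) * V + q * pderiv V"
  have pd: "pderiv (q ^ k) = of_nat k * q ^ (k - 1)" for k
    by (cases k) (simp_all add: pderiv_power_Suc q' pderiv_1 of_nat_poly del: power_Suc)
  have W1: "pderiv W = q ^ m * U"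
    unfolding W pderiv_mult pd U_def by (simp add: algebra_simps del: of_nat_Suc)
  have W2: "q * pderiv (pderiv W) = q ^ m * (of_nat m * U + q * pderiv U)"
    unfolding W1 pderiv_mult pd by (cases m) (simp_all add: algebra_simps del: of_nat_Suc)
  have X: "1 - [:0, 1:]\<^sup>2 = - (q * [:1, 1:])"
    by (simp add: q_def power2_eq_square one_pCons)
  have "- ([:1, 1:] * (q * pderiv (pderiv W))) - of_nat d * [:0, 1:] * pderiv W + l * W = 0"
    using eigen unfolding gegenbauer_op_def X by (simp add: algebra_simps)
  then have "q ^ m * (- ([:1, 1:] * (of_nat m * U + q * pderiv U)) - of_nat d * [:0, 1:] * U + l * (q * V)) = 0"
    unfolding W2 unfolding W1 unfolding W by (simp add: algebra_simps)
  then have "- ([:1, 1:] * (of_nat m * U + q * pderiv U)) - of_nat d * [:0, 1:] * U + l * (q * V) = 0"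
    by (simp add: q_def)
  \<comment> \<open>At 1 the factor \<open>q\<close> vanishes and \<open>[:1, 1:]\<close> equals 2,
    so only the leading coefficient (2m + d) U(1) remains, while U(1) = (m + 1) V(1).\<close>
  from arg_cong[OF this, of "\<lambda>p. poly p 1"]
  have "(2 * real m + real d) * poly U 1 = 0"
    by (simp add: q_def algebra_simps)
  then have "poly U 1 = 0" using \<open>0 < d\<close> by simp
  then show False using V1 by (simp add: U_def q_def)
qed

section \<open>Jacobi polynomials with equal parameters as eigenpolynomials\<close>

definition jacobi_poly :: "real \<Rightarrow> nat \<Rightarrow> real poly" where
  "jacobi_poly \<alpha> n = (\<Sum>s\<le>n. smult (((real n + \<alpha>) gchoose (n - s)) * ((real n + \<alpha>) gchoose s))
     ([:-1/2, 1/2:] ^ s * [:1/2, 1/2:] ^ (n - s)))"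

lemma poly_jacobi_poly: "poly (jacobi_poly \<alpha> n) x = jacobi \<alpha> \<alpha> n x"
  by (simp add: jacobi_poly_def jacobi_def poly_sum algebra_simps diff_divide_distrib add_divide_distrib)

text \<open>With \<open>A = (x - 1)/2\<close> and \<open>B = A + 1\<close> the right-hand side only involves the neighbouring products of
  degree \<open>i + j - 1\<close>, which makes the sum over \<open>i + j = n\<close> telescope.\<close>
lemma gegenbauer_op_jacobi_term:
  fixes \<alpha> :: real and d i j :: nat
  assumes d: "real d = 2 * \<alpha> + 2"
  defines "T \<equiv> \<lambda>i j. [:-1/2, 1/2:] ^ i * [:1/2, 1/2:] ^ j :: real poly"
  shows "gegenbauer_op d (T i j) + smult (real (i + j) * (real (i + j) + real d - 1)) (T i j) =
     smult (real j * (real j + \<alpha>)) (T i (j - 1)) - smult (real i * (real i + \<alpha>)) (T (i - 1) j)"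
proof -
  define A B h :: "real poly" where "A = [:-1/2, 1/2:]" and "B = [:1/2, 1/2:]" and "h = [:1/2:]"
  define I J al D :: "real poly" where "I = [:real i:]" and "J = [:real j:]" and "al = [:\<alpha>:]" and "D = [:real d:]"
  \<comment> \<open>Each product with a truncated exponent carries the factor that vanishes where
    truncation occurs. The relations \<open>AU\<close>, \<open>BV\<close>, \<open>AU2\<close> and
    \<open>BV2\<close> therefore hold for all i and j, and the claim becomes a ring
    identity.\<close>
  define U V where "U = I * T (i - 1) j" and "V = J * T i (j - 1)"
  define U2 V2 W where "U2 = I * (I - 1) * T (i - 1 - 1) j" and "V2 = J * (J - 1) * T i (j - 1 - 1)"
    and "W = I * J * T (i - 1) (j - 1)"
  have T: "T i j = A ^ i * B ^ j" for i j by (simp add: T_def A_def B_def)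
  have pA: "pderiv (A ^ k) = h * (of_nat k * A ^ (k - 1))" and pB: "pderiv (B ^ k) = h * (of_nat k * B ^ (k - 1))" for k
    by (cases k; simp add: pderiv_power_Suc A_def B_def h_def pderiv_pCons of_nat_poly pderiv_1 del: power_Suc; fail)+
  have pT: "pderiv (T i j) = h * (of_nat i * T (i - 1) j + of_nat j * T i (j - 1))" for i j
    by (simp add: T pderiv_mult pA pB algebra_simps)
  have IJ: "of_nat i = I" "of_nat j = J"
    by (simp_all add: I_def J_def of_nat_poly)
  have pc: "pderiv (I * p) = I * pderiv p" "pderiv (J * p) = J * pderiv p" "pderiv (h * p) = h * pderiv p" for p
    by (simp_all add: I_def J_def h_def pderiv_smult)
  have I1: "I * of_nat (i - 1) = I * (I - 1)" "J * of_nat (j - 1) = J * (J - 1)"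
    by (cases i; cases j; simp add: I_def J_def of_nat_poly one_pCons; fail)+
  have p1: "pderiv (T i j) = h * (U + V)"
    by (simp add: pT IJ U_def V_def)
  have pU: "pderiv U = h * (U2 + W)"
    unfolding U_def pc pT U2_def W_def IJ I1(1)[symmetric] by (simp add: algebra_simps)
  have pV: "pderiv V = h * (W + V2)"
    unfolding V_def pc pT V2_def W_def IJ I1(2)[symmetric] by (simp add: algebra_simps)
  have p2: "pderiv (pderiv (T i j)) = h * (h * (U2 + 2 * W + V2))"
    unfolding p1 pc pderiv_add pU pV by (simp add: algebra_simps)
  have AU: "A * U = I * T i j" "A * W = I * V"
    by (cases i; simp add: U_def V_def W_def T I_def algebra_simps; fail)+
  have BV: "B * V = J * T i j"
    by (cases j) (simp_all add: V_def T J_def algebra_simps)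
  have AU2: "A * U2 = (I - 1) * U"
  proof (cases i)
    case (Suc k)
    then show ?thesis by (cases k) (simp_all add: U2_def U_def T I_def one_pCons algebra_simps)
  qed (simp add: U2_def U_def I_def)
  have BV2: "B * V2 = (J - 1) * V"
  proof (cases j)
    case (Suc k)
    then show ?thesis by (cases k) (simp_all add: V2_def V_def T J_def one_pCons algebra_simps)
  qed (simp add: V2_def V_def J_def)
  have c: "B = A + 1" "[:0, 1:] = A + B" "2 * h = 1" "D = 2 * al + 2"
    by (simp_all add: A_def B_def h_def one_pCons numeral_poly D_def al_def d)
  have "(1 - (A + B)\<^sup>2) * (h * (h * (U2 + 2 * W + V2))) - D * (A + B) * (h * (U + V))
     + (I + J) * (I + J + D - 1) * T i j = (J + al) * V - (I + al) * U"
    using AU AU2 BV BV2 c(1,3,4) by algebra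
  then have "gegenbauer_op d (T i j) + (I + J) * (I + J + D - 1) * T i j = (J + al) * V - (I + al) * U"
    unfolding gegenbauer_op_def p2 unfolding p1 by (simp add: c(2)[symmetric] D_def of_nat_poly)
  then show ?thesis
    by (simp add: I_def J_def D_def al_def U_def V_def one_pCons algebra_simps)
qed

lemma gbinomial_Suc_mult: "real (Suc k) * (a gchoose Suc k) = (a - real k) * (a gchoose k)"
  using gbinomial_mult_1[of a k] by (simp add: algebra_simps)

lemma smult_sum_right: "smult c (sum f A) = (\<Sum>i\<in>A. smult c (f i))"
  by (induction A rule: infinite_finite_induct) (auto simp: smult_add_right)

text \<open>Each term of the sum contributes two neighbouring products. The ratio identity
  \<open>w\<close> of the binomial weights says precisely that the first contribution of s cancels
  the second one of s + 1.\<close>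

lemma gegenbauer_op_jacobi_poly:
  assumes d: "real d = 2 * \<alpha> + 2"
  shows "gegenbauer_op d (jacobi_poly \<alpha> n) = - smult (real n * (real n + real d - 1)) (jacobi_poly \<alpha> n)"
proof -
  define T where "T i j = ([:-1/2, 1/2:] ^ i * [:1/2, 1/2:] ^ j :: real poly)" for i j
  define w where "w s = ((real n + \<alpha>) gchoose (n - s)) * ((real n + \<alpha>) gchoose s)" for s
  have w: "w (Suc s) * (real (Suc s) * (real (Suc s) + \<alpha>)) = w s * (real (n - s) * (real (n - s) + \<alpha>))"
    if "s < n" for s
  proof -
    define m where "m = n - Suc s"
    have m: "n - s = Suc m" and "n - Suc s = m" and "n = s + m + 1"
      using that by (auto simp: m_def)
    then have "real n = real s + real m + 1" by simp
    define x y where "x = real (Suc m)" and "y = real (Suc s)"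
    have "x * ((real n + \<alpha>) gchoose Suc m) = (y + \<alpha>) * ((real n + \<alpha>) gchoose m)"
      "y * ((real n + \<alpha>) gchoose Suc s) = (x + \<alpha>) * ((real n + \<alpha>) gchoose s)"
      unfolding x_def y_def gbinomial_Suc_mult using \<open>real n = real s + real m + 1\<close> by simp_all
    then have "((real n + \<alpha>) gchoose m) * ((real n + \<alpha>) gchoose Suc s) * (y * (y + \<alpha>)) =
      ((real n + \<alpha>) gchoose Suc m) * ((real n + \<alpha>) gchoose s) * (x * (x + \<alpha>))"
      by algebra
    then show ?thesis
      unfolding w_def m \<open>n - Suc s = m\<close> x_def y_def .
  qed
  have J: "jacobi_poly \<alpha> n = (\<Sum>s\<le>n. smult (w s) (T s (n - s)))"
    by (simp add: jacobi_poly_def w_def T_def)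
  have single: "gegenbauer_op d (T s (n - s)) + smult (real n * (real n + real d - 1)) (T s (n - s)) =
      smult (real (n - s) * (real (n - s) + \<alpha>)) (T s (n - s - 1)) - smult (real s * (real s + \<alpha>)) (T (s - 1) (n - s))"
    if "s \<le> n" for s
    using gegenbauer_op_jacobi_term[OF d, of s "n - s"] that by (simp add: T_def)
  have "gegenbauer_op d (jacobi_poly \<alpha> n) + smult (real n * (real n + real d - 1)) (jacobi_poly \<alpha> n) =
     (\<Sum>s\<le>n. smult (w s) (gegenbauer_op d (T s (n - s)) + smult (real n * (real n + real d - 1)) (T s (n - s))))"
    by (simp add: J gegenbauer_op_sum gegenbauer_op_smult smult_add_right smult_sum_right sum.distrib mult.commute)
  also have "\<dots> = (\<Sum>s\<le>n. smult (w s * (real (n - s) * (real (n - s) + \<alpha>))) (T s (n - s - 1)))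
     - (\<Sum>s\<le>n. smult (w s * (real s * (real s + \<alpha>))) (T (s - 1) (n - s)))"
    unfolding sum_subtractf[symmetric]
    by (rule sum.cong) (simp_all add: single smult_diff_right)
  also have "(\<Sum>s\<le>n. smult (w s * (real (n - s) * (real (n - s) + \<alpha>))) (T s (n - s - 1))) =
      (\<Sum>s<n. smult (w s * (real (n - s) * (real (n - s) + \<alpha>))) (T s (n - s - 1)))"
    by (rule sum.mono_neutral_right) auto
  also have "\<dots> = (\<Sum>s<n. smult (w (Suc s) * (real (Suc s) * (real (Suc s) + \<alpha>))) (T s (n - Suc s)))"
    by (rule sum.cong) (simp_all add: w del: of_nat_Suc)
  also have "(\<Sum>s\<le>n. smult (w s * (real s * (real s + \<alpha>))) (T (s - 1) (n - s))) =
      (\<Sum>s<n. smult (w (Suc s) * (real (Suc s) * (real (Suc s) + \<alpha>))) (T s (n - Suc s)))"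
    by (subst sum.atMost_shift) simp
  finally show ?thesis by (simp add: eq_neg_iff_add_eq_0)
qed

text \<open>The difference \<open>W\<close> of the two sides is an eigenpolynomial for -n(n+d-1)
  that vanishes at 1, hence zero. The relation d = 2\<alpha> + 2 is \<alpha> = (d-2)/2.\<close>

lemma jacobi_eq_zonal_poly:
  assumes "0 < d" and d: "real d = 2 * \<alpha> + 2"
  shows "jacobi \<alpha> \<alpha> n x = jacobi \<alpha> \<alpha> n 1 * poly (zonal_poly d n) x"
proof -
  define W where "W = jacobi_poly \<alpha> n - smult (jacobi \<alpha> \<alpha> n 1) (zonal_poly d n)"
  have c: "of_nat (n * (n + d - 1)) * p = smult (real n * (real n + real d - 1)) p" for p
  proof -
    have "real (n * (n + d - 1)) = real n * (real n + real d - 1)"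
      using \<open>0 < d\<close> by (simp add: of_nat_diff)
    then show ?thesis by (simp only: of_nat_poly) simp
  qed
  have "gegenbauer_op d W = gegenbauer_op d (jacobi_poly \<alpha> n) +
      smult (- jacobi \<alpha> \<alpha> n 1) (gegenbauer_op d (zonal_poly d n))"
    unfolding W_def diff_conv_add_uminus smult_minus_left[symmetric] gegenbauer_op_add gegenbauer_op_smult ..
  also have "\<dots> = - ([:real n * (real n + real d - 1):] * W)"
    unfolding gegenbauer_op_jacobi_poly[OF d] gegenbauer_op_zonal_poly[OF \<open>0 < d\<close>] c W_def
    by (simp add: smult_diff_right mult.commute)
  finally have "W = 0"
    by (rule gegenbauer_op_eigen_unique[OF \<open>0 < d\<close>])
      (simp add: W_def poly_jacobi_poly poly_zonal_poly_1[OF \<open>0 < d\<close>])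
  then show ?thesis
    by (metis W_def eq_iff_diff_eq_0 poly_jacobi_poly poly_smult)
qed

text \<open>At 1 only the summand s = 0 survives, and its factors n + \<alpha> - i with i < n are
  positive. Positivity allows this value to be divided out of the normalisation of the zonal
  harmonic.\<close>

lemma jacobi_one_pos:
  assumes "0 \<le> \<alpha>"
  shows "0 < jacobi \<alpha> \<alpha> n 1"
proof -
  have "jacobi \<alpha> \<alpha> n 1 = (\<Sum>s\<in>{0}. ((real n + \<alpha>) gchoose (n - s)) * ((real n + \<alpha>) gchoose s))"
    unfolding jacobi_def by (rule sum.mono_neutral_cong_right) auto
  also have "\<dots> = (\<Prod>i = 0..<n. real n + \<alpha> - real i) / fact n"
    by (simp add: gbinomial_prod_rev)
  also have "\<dots> > 0"
    using assms by (intro divide_pos_pos prod_pos) auto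
  finally show ?thesis .
qed

section \<open>Weyl sums for almost every time\<close>

text \<open>Off-diagonal pairs are grouped by their difference h, and the two signs of the
  difference are conjugate. Letting h run up to a fixed \<open>L\<close> only adds empty inner sums
  and makes the later bound uniform in \<open>K\<close>.\<close>

lemma norm_sum_squared:
  fixes c :: "nat \<Rightarrow> complex"
  assumes "K \<le> L"
  shows "(norm (\<Sum>n<K. c n))\<^sup>2 =
    (\<Sum>n<K. (norm (c n))\<^sup>2) + 2 * Re (\<Sum>h = 1..<L. \<Sum>m<K - h. c (m + h) * cnj (c m))"
  using assms
proof (induction K)
  case (Suc K)
  have "(\<Sum>h = 1..<L. \<Sum>m<Suc K - h. c (m + h) * cnj (c m)) =
     (\<Sum>h = 1..<L. (\<Sum>m<K - h. c (m + h) * cnj (c m)) + (if h \<le> K then c K * cnj (c (K - h)) else 0))"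
  proof (rule sum.cong)
    fix h
    show "(\<Sum>m<Suc K - h. c (m + h) * cnj (c m)) =
      (\<Sum>m<K - h. c (m + h) * cnj (c m)) + (if h \<le> K then c K * cnj (c (K - h)) else 0)"
      by (cases "h \<le> K") (simp_all add: Suc_diff_le)
  qed simp
  also have "\<dots> = (\<Sum>h = 1..<L. \<Sum>m<K - h. c (m + h) * cnj (c m)) +
     (\<Sum>h = 1..<L. if h \<le> K then c K * cnj (c (K - h)) else 0)"
    by (rule sum.distrib)
  also have "(\<Sum>h = 1..<L. if h \<le> K then c K * cnj (c (K - h)) else 0) = (\<Sum>h = 1..K. c K * cnj (c (K - h)))"
    using Suc.prems by (intro sum.mono_neutral_cong_right) auto
  also have "\<dots> = (\<Sum>j<K. c K * cnj (c j))"
    by (rule sum.reindex_bij_witness[of _ "\<lambda>j. K - j" "\<lambda>h. K - h"]) auto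
  also have "\<dots> = c K * cnj (\<Sum>j<K. c j)"
    by (simp add: sum_distrib_left)
  finally have *: "(\<Sum>h = 1..<L. \<Sum>m<Suc K - h. c (m + h) * cnj (c m)) =
     (\<Sum>h = 1..<L. \<Sum>m<K - h. c (m + h) * cnj (c m)) + c K * cnj (\<Sum>j<K. c j)" .
  have **: "(norm ((\<Sum>n<K. c n) + c K))\<^sup>2 = (norm (\<Sum>n<K. c n))\<^sup>2 + (norm (c K))\<^sup>2 + 2 * Re (c K * cnj (\<Sum>n<K. c n))"
    by (simp only: cmod_power2 complex_mult_cnj plus_complex.sel times_complex.sel cnj.sel)
      (simp add: power2_eq_square algebra_simps)
  show ?case
    unfolding * sum.lessThan_Suc plus_complex.sel ** Suc.IH[OF Suc_leD[OF Suc.prems]]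
    by (simp only: ring_distribs add_ac)
qed simp

text \<open>A continuous substitute for min(L, 1/|sin x|): for L > 0 it lies between this minimum
  and twice the minimum, and it needs no exception where the sine vanishes.\<close>

definition weyl_weight :: "nat \<Rightarrow> real \<Rightarrow> real" where
  "weyl_weight L x = 2 * real L / (1 + real L * \<bar>sin x\<bar>)"

lemma weyl_weight_nonneg: "0 \<le> weyl_weight L x"
  by (simp add: weyl_weight_def)

text \<open>The trivial bound S \<le> L and the geometric bound |sin x| S \<le> 1, which comes from
  |1 - w| = 2 |sin x|, add up to S (1 + L |sin x|) \<le> 2 L.\<close>

lemma norm_geometric_sum_le_weyl_weight:
  assumes "K \<le> L"
  shows "norm (\<Sum>m<K. cis (- 2 * x) ^ m) \<le> weyl_weight L x"
proof -
  define w where "w = cis (- 2 * x)"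
  define S where "S = norm (\<Sum>m<K. w ^ m)"
  have "S \<le> (\<Sum>m<K. norm (w ^ m))"
    unfolding S_def by (rule norm_sum)
  also have "\<dots> = real K"
    by (simp add: w_def norm_power)
  finally have "S \<le> real L" using assms by linarith
  have "(norm (1 - w))\<^sup>2 = (2 * \<bar>sin x\<bar>)\<^sup>2"
  proof -
    have "(norm (1 - w))\<^sup>2 = (1 - cos (2 * x))\<^sup>2 + (sin (2 * x))\<^sup>2"
      by (simp add: w_def cmod_power2)
    also have "\<dots> = 2 - 2 * cos (2 * x)"
      using sin_cos_squared_add[of "2 * x"] by (simp add: power2_eq_square algebra_simps)
    also have "\<dots> = (2 * \<bar>sin x\<bar>)\<^sup>2"
      using cos_double_sin[of x] by (simp add: power_mult_distrib)
    finally show ?thesis .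
  qed
  then have "norm (1 - w) = 2 * \<bar>sin x\<bar>"
    by (rule power2_eq_imp_eq) auto
  moreover have "norm (1 - w) * S = norm (1 - w ^ K)"
    unfolding S_def norm_mult[symmetric] by (simp add: one_diff_power_eq)
  moreover have "norm (1 - w ^ K) \<le> 2"
    using norm_triangle_ineq4[of 1 "w ^ K"] by (simp add: w_def norm_power)
  ultimately have "\<bar>sin x\<bar> * S \<le> 1" by simp
  then have "real L * (\<bar>sin x\<bar> * S) \<le> real L"
    by (simp add: mult_left_le)
  then have "S * (1 + real L * \<bar>sin x\<bar>) \<le> 2 * real L"
    using \<open>S \<le> real L\<close> by (simp add: algebra_simps)
  moreover have "0 < 1 + real L * \<bar>sin x\<bar>"
    by (simp add: add_pos_nonneg)
  ultimately show ?thesis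
    by (simp add: S_def w_def weyl_weight_def pos_le_divide_eq)
qed

text \<open>Since (m+h)^2 - m^2 is linear in m, every product \<open>c (m + h) * cnj (c m)\<close>
  is geometric in m with ratio \<open>cis (- 2 * (t * real h))\<close>. The point z enters only
  through a factor of modulus 1, which is why the bound is uniform on the circle.\<close>

lemma weyl_differencing:
  assumes z: "norm z = 1" and "N - M \<le> L"
  shows "(norm (\<Sum>n = M..<N. cis (- t * (real n)\<^sup>2) * z ^ n))\<^sup>2 \<le>
     real L + 2 * (\<Sum>h = 1..<L. weyl_weight L (t * real h))"
proof -
  define c where "c m = cis (- t * (real (M + m))\<^sup>2) * z ^ (M + m)" for m
  have "(\<Sum>n = M..<N. cis (- t * (real n)\<^sup>2) * z ^ n) = (\<Sum>m<N - M. c m)"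
    unfolding c_def
    by (rule sum.reindex_bij_witness[of _ "\<lambda>m. M + m" "\<lambda>n. n - M"]) auto
  then have "(norm (\<Sum>n = M..<N. cis (- t * (real n)\<^sup>2) * z ^ n))\<^sup>2 =
      (\<Sum>n<N - M. (norm (c n))\<^sup>2) + 2 * Re (\<Sum>h = 1..<L. \<Sum>m<N - M - h. c (m + h) * cnj (c m))"
    using norm_sum_squared[OF assms(2), of c] by simp
  also have "(\<Sum>n<N - M. (norm (c n))\<^sup>2) = real (N - M)"
    by (simp add: c_def norm_mult norm_power z)
  also have "Re (\<Sum>h = 1..<L. \<Sum>m<N - M - h. c (m + h) * cnj (c m)) \<le>
      (\<Sum>h = 1..<L. norm (\<Sum>m<N - M - h. c (m + h) * cnj (c m)))"
    by (rule order_trans[OF complex_Re_le_cmod norm_sum])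
  also have "\<dots> \<le> (\<Sum>h = 1..<L. weyl_weight L (t * real h))"
  proof (rule sum_mono)
    fix h
    have zz: "z * cnj z = 1"
      using z by (simp add: complex_norm_square[symmetric])
    have "c (m + h) * cnj (c m) =
        (cis (- t * (2 * real h * real M + (real h)\<^sup>2)) * z ^ h) * cis (- 2 * (t * real h)) ^ m" for m
    proof -
      have "c (m + h) * cnj (c m) = (cis (- t * (real (M + m + h))\<^sup>2) * cis (t * (real (M + m))\<^sup>2))
         * z ^ h * (z * cnj z) ^ (M + m)"
        by (simp add: c_def cis_cnj power_add power_mult_distrib algebra_simps)
      also have "cis (- t * (real (M + m + h))\<^sup>2) * cis (t * (real (M + m))\<^sup>2) =
         cis (- t * (2 * real h * real M + (real h)\<^sup>2)) * cis (- 2 * (t * real h)) ^ m"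
      proof -
        have "cis (- 2 * (t * real h)) ^ m = cis (real m * (- 2 * (t * real h)))"
          by (rule Complex.DeMoivre)
        then show ?thesis
          by (simp only: cis_mult) (simp add: power2_eq_square algebra_simps)
      qed
      finally show ?thesis by (simp add: zz)
    qed
    then have "norm (\<Sum>m<N - M - h. c (m + h) * cnj (c m)) =
       norm (\<Sum>m<N - M - h. cis (- 2 * (t * real h)) ^ m)"
      by (simp add: sum_distrib_left[symmetric] norm_mult norm_power z del: mult_minus_left)
    also have "\<dots> \<le> weyl_weight L (t * real h)"
      using assms(2) by (intro norm_geometric_sum_le_weyl_weight) simp
    finally show "norm (\<Sum>m<N - M - h. c (m + h) * cnj (c m)) \<le> weyl_weight L (t * real h)" .
  qed
  finally show ?thesis using assms(2) by simp
qed

section \<open>The mean of the Weyl weight in t\<close>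

lemma continuous_on_weyl_weight: "continuous_on A (weyl_weight L)"
proof -
  have "1 + real L * \<bar>sin x\<bar> \<noteq> 0" for x :: real
    by (simp add: add_nonneg_eq_0_iff)
  then show ?thesis
    unfolding weyl_weight_def[abs_def] by (intro continuous_intros) auto
qed

lemma weyl_weight_periodic: "weyl_weight L (x + real_of_int k * pi) = weyl_weight L x"
proof -
  have s0: "sin (real_of_int k * pi) = 0"
    by (auto simp: sin_zero_iff_int2)
  then have "\<bar>cos (real_of_int k * pi)\<bar> = 1"
    by (simp add: abs_square_eq_1[symmetric] cos_squared_eq s0)
  then have "\<bar>sin (x + real_of_int k * pi)\<bar> = \<bar>sin x\<bar>"
    by (simp add: sin_add s0 abs_mult)
  then show ?thesis by (simp add: weyl_weight_def)
qed

text \<open>Jordan's inequality: the concave sine lies above its chord from 0 to \<pi>/2.\<close>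

lemma sin_ge_chord:
  assumes "0 \<le> x" "x \<le> pi / 2"
  shows "2 / pi * x \<le> sin x"
proof -
  have "concave_on {0..pi} sin"
    by (rule f''_le0_imp_concave[where f' = cos and f'' = "\<lambda>x. - sin x"])
      (auto intro!: derivative_eq_intros sin_ge_zero)
  then have "convex_on {0..pi} (\<lambda>x. - sin x)"
    by (simp add: concave_on_def)
  from convex_onD[OF this, of "2 / pi * x" 0 "pi / 2"]
  show ?thesis using assms by (simp add: field_simps)
qed

text \<open>On [0, \<pi>/2] Jordan's inequality gives a majorant with primitive \<pi> ln(1 +
  2Lx/\<pi>); the reflection x -> \<pi> - x accounts for the other half.\<close>

lemma integral_weyl_weight:
  "integral {0..pi} (weyl_weight L) \<le> 2 * pi * ln (1 + real L)"
proof (cases "L = 0")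
  case False
  then have L: "0 < real L" by simp
  define g where "g x = 2 * real L / (1 + real L * (2 / pi * x))" for x
  have le: "weyl_weight L x \<le> g x" if "x \<in> {0..pi / 2}" for x
    unfolding weyl_weight_def g_def
    using that sin_ge_chord[of x]
    by (intro divide_left_mono add_left_mono mult_left_mono) (auto intro!: mult_pos_pos add_pos_nonneg)
  have gI: "(g has_integral (pi * ln (1 + real L))) {0..pi / 2}"
  proof -
    have "(g has_integral (pi * ln (1 + real L * (2 / pi * (pi / 2))) - pi * ln (1 + real L * (2 / pi * 0)))) {0..pi / 2}"
    proof (rule fundamental_theorem_of_calculus)
      fix x assume "x \<in> {0..pi / 2}"
      then have "0 < 1 + real L * (2 / pi * x)"
        by (auto intro!: add_pos_nonneg)
      then show "((\<lambda>x. pi * ln (1 + real L * (2 / pi * x))) has_vector_derivative g x) (at x within {0..pi / 2})"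
        unfolding has_real_derivative_iff_has_vector_derivative[symmetric] g_def
        by (auto intro!: derivative_eq_intros simp: field_simps)
    qed simp
    then show ?thesis by simp
  qed
  have int: "weyl_weight L integrable_on {a..b}" for a b
    by (intro integrable_continuous_real continuous_on_weyl_weight)
  have half: "integral {0..pi / 2} (weyl_weight L) \<le> pi * ln (1 + real L)"
    using integral_le[OF int has_integral_integrable[OF gI] le] gI by (simp add: integral_unique)
  have "((\<lambda>x. weyl_weight L (-1 * x + pi)) has_integral (1 *\<^sub>R integral {0..pi/2} (weyl_weight L))) ((\<lambda>x. (1 / (-1)) *\<^sub>R x + - ((1 / (-1)) *\<^sub>R pi)) ` cbox 0 (pi / 2))"
    using has_integral_affinity[of "weyl_weight L" "integral {0..pi/2} (weyl_weight L)" 0 "pi / 2" "-1" pi]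
      integrable_integral[OF int] by simp
  moreover have "(\<lambda>x. (1 / (-1)) *\<^sub>R x + - ((1 / (-1)) *\<^sub>R pi)) ` cbox 0 (pi / 2) = {pi / 2..pi}"
    by (auto simp: image_iff intro!: bexI[of _ "pi - _"])
  moreover have "weyl_weight L (-1 * x + pi) = weyl_weight L x" for x
    by (simp add: weyl_weight_def sin_diff)
  ultimately have "integral {pi / 2..pi} (weyl_weight L) = integral {0..pi / 2} (weyl_weight L)"
    by (simp add: integral_unique)
  moreover have "integral {0..pi / 2} (weyl_weight L) + integral {pi / 2..pi} (weyl_weight L) = integral {0..pi} (weyl_weight L)"
    by (rule Henstock_Kurzweil_Integration.integral_combine) (auto intro: int)
  ultimately show ?thesis using half by simp
qed (simp add: weyl_weight_def[abs_def])

lemma has_integral_weyl_weight_periods: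
  "(weyl_weight L has_integral (real n * integral {0..pi} (weyl_weight L))) {- (real m * pi)..- (real m * pi) + real n * pi}"
proof (induction n)
  case (Suc n)
  define c where "c = - (real m * pi) + real n * pi"
  have c: "c = real_of_int (int n - int m) * pi"
    by (simp add: c_def algebra_simps)
  have int: "weyl_weight L integrable_on {a..b}" for a b
    by (intro integrable_continuous_real continuous_on_weyl_weight)
  have "((\<lambda>x. weyl_weight L (1 * x + (- c))) has_integral (1 *\<^sub>R integral {0..pi} (weyl_weight L))) ((\<lambda>x. (1 / 1) *\<^sub>R x + - ((1 / 1) *\<^sub>R (- c))) ` cbox 0 pi)"
    using has_integral_affinity[of "weyl_weight L" "integral {0..pi} (weyl_weight L)" 0 pi 1 "- c"]
      integrable_integral[OF int] by simp
  moreover have "weyl_weight L (1 * x + (- c)) = weyl_weight L x" for x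
    using weyl_weight_periodic[of L x "int m - int n"] by (simp add: c algebra_simps)
  moreover have "(\<lambda>x. (1 / 1) *\<^sub>R x + - ((1 / 1) *\<^sub>R (- c))) ` cbox 0 pi = {c..c + pi}"
    by (auto simp: image_iff intro!: bexI[of _ "_ - c"])
  ultimately have "(weyl_weight L has_integral integral {0..pi} (weyl_weight L)) {c..c + pi}"
    by (simp add: add.commute)
  from has_integral_combine[OF _ _ Suc[folded c_def] this]
  show ?case by (simp add: c_def algebra_simps)
qed (simp add: has_integral_refl)

text \<open>The substitution x = t h turns 2R periods into 2Rh periods and divides by h, so the mean
  does not depend on h. Endpoints that are multiples of \<pi> ensure whole periods.\<close>

lemma has_integral_weyl_weight_scaled:
  assumes "0 < h"
  shows "((\<lambda>t. weyl_weight L (t * real h)) has_integral (2 * real R * integral {0..pi} (weyl_weight L)))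
     {- (real R * pi)..real R * pi}"
proof -
  have "(weyl_weight L has_integral (real (2 * R * h) * integral {0..pi} (weyl_weight L)))
     (cbox (- (real (R * h) * pi)) (real (R * h) * pi))"
    using has_integral_weyl_weight_periods[of L "2 * R * h" "R * h"] by (simp add: algebra_simps)
  from has_integral_affinity[OF this, of "real h" 0]
  have "((\<lambda>x. weyl_weight L (real h * x)) has_integral (1 / real h) * (real (2 * R * h) * integral {0..pi} (weyl_weight L)))
     ((\<lambda>x. x / real h) ` cbox (- (real (R * h) * pi)) (real (R * h) * pi))"
    using assms by simp
  moreover have "(\<lambda>x. x / real h) ` cbox (- (real (R * h) * pi)) (real (R * h) * pi) = {- (real R * pi)..real R * pi}"
    using assms by (auto simp: image_iff field_simps intro!: bexI[of _ "_ * real h"])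
  moreover have "(1 / real h) * (real (2 * R * h) * integral {0..pi} (weyl_weight L)) = 2 * real R * integral {0..pi} (weyl_weight L)"
    using assms by (simp add: field_simps)
  ultimately show ?thesis by (simp add: mult.commute)
qed

lemma nn_integral_weyl_weight_sum:
  "(\<integral>\<^sup>+t. ennreal (indicator {- (real R * pi)..real R * pi} t * (\<Sum>h = 1..<2 ^ k. weyl_weight (2 ^ k) (t * real h))) \<partial>lborel)
     \<le> ennreal (4 * pi * real R * (real k + 1) * 2 ^ k)"
proof -
  define J where "J = integral {0..pi} (weyl_weight (2 ^ k))"
  define I where "I = {- (real R * pi)..real R * pi}"
  have "((\<lambda>t. \<Sum>h = 1..<2 ^ k. weyl_weight (2 ^ k) (t * real h)) has_integral (\<Sum>h = 1..<(2::nat) ^ k. 2 * real R * J)) I"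
    unfolding J_def I_def by (intro has_integral_sum has_integral_weyl_weight_scaled) auto
  then have eq: "(\<integral>\<^sup>+t. ennreal (indicator I t * (\<Sum>h = 1..<2 ^ k. weyl_weight (2 ^ k) (t * real h))) \<partial>lborel) =
     ennreal (\<Sum>h = 1..<(2::nat) ^ k. 2 * real R * J)"
    by (intro nn_integral_has_integral_lebesgue) (auto intro!: sum_nonneg weyl_weight_nonneg)
  have "J \<le> 2 * pi * ln (1 + 2 ^ k)"
    unfolding J_def using integral_weyl_weight[of "2 ^ k"] by simp
  also have "ln (1 + 2 ^ k) \<le> ln (2 ^ (k + 1) :: real)"
    by (subst ln_le_cancel_iff) (auto intro: add_pos_pos)
  also have "\<dots> = (real k + 1) * ln 2"
    by (simp add: ln_realpow ln_mult algebra_simps)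
  also have "\<dots> \<le> (real k + 1) * 1"
    using ln_le_minus_one[of "2::real"] by (intro mult_left_mono) auto
  finally have J: "J \<le> 2 * pi * (real k + 1)" by simp
  have "(\<Sum>h = 1..<(2::nat) ^ k. 2 * real R * J) = (2 ^ k - 1) * (2 * real R * J)"
    by (simp add: of_nat_diff)
  also have "\<dots> \<le> (2 ^ k - 1) * (2 * real R * (2 * pi * (real k + 1)))"
    using J by (intro mult_left_mono) auto
  also have "\<dots> \<le> 2 ^ k * (2 * real R * (2 * pi * (real k + 1)))"
    by (intro mult_right_mono) auto
  finally show ?thesis
    unfolding I_def[symmetric] eq by (intro ennreal_leI) (simp add: algebra_simps)
qed

section \<open>From means in t to bounds for almost every t\<close>

lemma summable_linear_times_power:
  fixes r :: real
  assumes "0 \<le> r" "r < 1"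
  shows "summable (\<lambda>k. (real k + 1) * r ^ k)"
proof -
  have "summable (\<lambda>k. real (Suc k) * 1 * r ^ k)"
    by (rule termdiff_converges[where K = 1 and c = "\<lambda>_. 1", unfolded diffs_def])
      (use assms in \<open>auto intro: summable_geometric\<close>)
  then show ?thesis by (simp add: add.commute)
qed

text \<open>A Borel-Cantelli argument: a series of nonnegative functions with finite total integral
  is finite almost everywhere, and its value \<open>K\<close> at t bounds every single term at
  t.\<close>

lemma AE_weyl_weight_sum_bound:
  assumes "0 < \<epsilon>"
  shows "AE t in lborel. \<exists>K\<ge>0. \<forall>k. (\<Sum>h = 1..<2 ^ k. weyl_weight (2 ^ k) (t * real h)) \<le> K * 2 powr (real k * (1 + \<epsilon>))"
proof -
  define T where "T k t = (\<Sum>h = 1..<2 ^ k. weyl_weight (2 ^ k) (t * real h))" for k t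
  have Tm [measurable]: "T k \<in> borel_measurable borel" for k
    unfolding T_def[abs_def]
    by (intro borel_measurable_sum measurable_compose[OF _ borel_measurable_continuous_onI[OF continuous_on_weyl_weight]]) simp
  have T0: "0 \<le> T k t" for k t
    unfolding T_def by (intro sum_nonneg weyl_weight_nonneg)
  \<comment> \<open>The weights are periodic in t, so integrals are taken over bounded intervals;
    countably many of these exhaust the line.\<close>
  have local: "AE t in lborel. t \<in> {- (real R * pi)..real R * pi} \<longrightarrow> (\<exists>K\<ge>0. \<forall>k. T k t \<le> K * 2 powr (real k * (1 + \<epsilon>)))" for R
  proof -
    define I where "I = {- (real R * pi)..real R * pi}"
    \<comment> \<open>The mean at level k is O((k + 1) 2^k). After the factor 2^(-k(1+\<epsilon>))
      it becomes (k + 1) r^k with r = 2^(-\<epsilon>) < 1, which is summable.\<close>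
    define F where "F k t = ennreal (indicator I t * T k t) * ennreal (2 powr (- (real k * (1 + \<epsilon>))))" for k t
    have [measurable]: "F k \<in> borel_measurable lborel" for k
      unfolding F_def[abs_def] I_def by measurable
    define r where "r = 2 powr (- \<epsilon>)"
    have r: "0 \<le> r" "r < 1"
      using assms powr_less_mono[of "- \<epsilon>" 0 2] by (auto simp: r_def)
    have "(\<integral>\<^sup>+t. (\<Sum>k. F k t) \<partial>lborel) = (\<Sum>k. \<integral>\<^sup>+t. F k t \<partial>lborel)"
      by (rule nn_integral_suminf) measurable
    also have "\<dots> \<le> (\<Sum>k. ennreal (4 * pi * real R * ((real k + 1) * r ^ k)))"
    proof (rule suminf_le)
      fix k
      have "(\<integral>\<^sup>+t. F k t \<partial>lborel) = (\<integral>\<^sup>+t. ennreal (indicator I t * T k t) \<partial>lborel) * ennreal (2 powr (- (real k * (1 + \<epsilon>))))"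
        unfolding F_def I_def by (rule nn_integral_multc) measurable
      also have "\<dots> \<le> ennreal (4 * pi * real R * (real k + 1) * 2 ^ k) * ennreal (2 powr (- (real k * (1 + \<epsilon>))))"
        unfolding I_def T_def by (intro mult_right_mono nn_integral_weyl_weight_sum) simp
      also have "\<dots> = ennreal (4 * pi * real R * (real k + 1) * (2 ^ k * 2 powr (- (real k * (1 + \<epsilon>)))))"
        by (simp add: ennreal_mult' mult.assoc)
      also have "2 ^ k * 2 powr (- (real k * (1 + \<epsilon>))) = r ^ k"
      proof -
        have "2 ^ k * 2 powr (- (real k * (1 + \<epsilon>))) = 2 powr (real k + (- (real k * (1 + \<epsilon>))))"
          by (simp only: powr_add powr_realpow[of 2 k, symmetric])
        also have "\<dots> = r ^ k"
          unfolding r_def by (simp add: powr_realpow[symmetric] powr_powr algebra_simps)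
        finally show ?thesis .
      qed
      finally show "(\<integral>\<^sup>+t. F k t \<partial>lborel) \<le> ennreal (4 * pi * real R * ((real k + 1) * r ^ k))"
        by (simp add: mult.assoc)
    qed auto
    also have "\<dots> = ennreal (\<Sum>k. 4 * pi * real R * ((real k + 1) * r ^ k))"
      using r by (intro suminf_ennreal2 summable_mult summable_linear_times_power) auto
    also have "\<dots> < \<infinity>" by simp
    finally have "AE t in lborel. (\<Sum>k. F k t) \<noteq> \<infinity>"
      by (intro nn_integral_noteq_infinite) auto
    then show ?thesis
    proof eventually_elim
      case (elim t)
      show ?case
      proof (intro impI)
        assume "t \<in> {- (real R * pi)..real R * pi}"
        then have t: "t \<in> I" by (simp add: I_def)
        define K where "K = enn2real (\<Sum>k. F k t)"
        have K: "(\<Sum>k. F k t) = ennreal K"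
          using elim by (simp add: K_def less_top)
        have "T k t \<le> K * 2 powr (real k * (1 + \<epsilon>))" for k
        proof -
          have "F k t \<le> (\<Sum>k. F k t)"
            using sum_le_suminf[of "\<lambda>k. F k t" "{k}"] by simp
          then have "ennreal (T k t * 2 powr (- (real k * (1 + \<epsilon>)))) \<le> ennreal K"
            unfolding K using t T0 by (simp add: F_def ennreal_mult)
          then have "T k t * 2 powr (- (real k * (1 + \<epsilon>))) \<le> K"
            by (simp add: K_def ennreal_le_iff)
          then show ?thesis by (simp only: powr_minus) (simp add: pos_divide_le_eq flip: divide_inverse)
        qed
        moreover have "0 \<le> K" by (simp add: K_def)
        ultimately show "\<exists>K\<ge>0. \<forall>k. T k t \<le> K * 2 powr (real k * (1 + \<epsilon>))" by blast
      qed
    qed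
  qed
  have "AE t in lborel. \<forall>R. t \<in> {- (real R * pi)..real R * pi} \<longrightarrow> (\<exists>K\<ge>0. \<forall>k. T k t \<le> K * 2 powr (real k * (1 + \<epsilon>)))"
    by (subst AE_all_countable) (use local in blast)
  then show ?thesis
  proof eventually_elim
    case (elim t)
    obtain R where R: "\<bar>t\<bar> / pi \<le> real R" using real_arch_simple by blast
    then have "t \<in> {- (real R * pi)..real R * pi}"
      using pi_gt_zero by (auto simp: pos_divide_le_eq abs_le_iff)
    then show ?case using elim by (auto simp: T_def)
  qed
qed

text \<open>The lower end \<open>M\<close> is free so that every sub-block is covered, as summation
  by parts demands; the free z leaves room for a linear phase.\<close>

definition weyl_bounded :: "real \<Rightarrow> bool" where
  "weyl_bounded t \<longleftrightarrow> (\<forall>\<epsilon>>0. \<exists>K\<ge>0. \<forall>k M N z. norm z = 1 \<longrightarrow> N \<le> 2 ^ k \<longrightarrow>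
     norm (\<Sum>n = M..<N. cis (- t * (real n)\<^sup>2) * z ^ n) \<le> K * 2 powr (real k * (1 / 2 + \<epsilon>)))"

text \<open>To keep the union of exceptional sets null, the exponent loss runs through the countable
  sequence 1/(j+1). Square roots of the differencing bound give the constant sqrt(1 + 2K) and halve
  the exponent.\<close>

lemma AE_weyl_bounded: "AE t in lborel. weyl_bounded t"
proof -
  have "AE t in lborel. \<forall>j. \<exists>K\<ge>0. \<forall>k. (\<Sum>h = 1..<2 ^ k. weyl_weight (2 ^ k) (t * real h)) \<le>
      K * 2 powr (real k * (1 + inverse (real (Suc j))))"
    unfolding AE_all_countable by (intro allI AE_weyl_weight_sum_bound) simp
  then show ?thesis
  proof eventually_elim
    case (elim t)
    show ?case unfolding weyl_bounded_def
    proof (intro allI impI)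
      fix \<epsilon> :: real assume "0 < \<epsilon>"
      then obtain j where j: "inverse (real (Suc j)) < \<epsilon>"
        using reals_Archimedean by blast
      obtain K where K: "0 \<le> K" "\<And>k. (\<Sum>h = 1..<2 ^ k. weyl_weight (2 ^ k) (t * real h)) \<le>
          K * 2 powr (real k * (1 + inverse (real (Suc j))))"
        using elim by metis
      have "norm (\<Sum>n = M..<N. cis (- t * (real n)\<^sup>2) * z ^ n) \<le> sqrt (1 + 2 * K) * 2 powr (real k * (1 / 2 + \<epsilon>))"
        if z: "norm z = 1" and N: "N \<le> 2 ^ k" for k M N z
      proof (rule power2_le_imp_le)
        have "(norm (\<Sum>n = M..<N. cis (- t * (real n)\<^sup>2) * z ^ n))\<^sup>2 \<le>
           real (2 ^ k) + 2 * (\<Sum>h = 1..<2 ^ k. weyl_weight (2 ^ k) (t * real h))"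
          using N by (intro weyl_differencing z) simp
        also have "\<dots> \<le> 2 powr (real k * (1 + 2 * \<epsilon>)) + 2 * (K * 2 powr (real k * (1 + 2 * \<epsilon>)))"
        proof (intro add_mono mult_left_mono order_trans[OF K(2)])
          have "2 powr real k \<le> 2 powr (real k * (1 + 2 * \<epsilon>))"
            using \<open>0 < \<epsilon>\<close> by (intro powr_mono) (auto simp: algebra_simps)
          then show "real (2 ^ k) \<le> 2 powr (real k * (1 + 2 * \<epsilon>))"
            by (simp add: powr_realpow)
          show "2 powr (real k * (1 + inverse (real (Suc j)))) \<le> 2 powr (real k * (1 + 2 * \<epsilon>))"
            using j \<open>0 < \<epsilon>\<close> by (intro powr_mono mult_left_mono) auto
        qed (use K in auto)
        also have "\<dots> = (1 + 2 * K) * 2 powr (2 * (real k * (1 / 2 + \<epsilon>)))"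
          by (simp add: algebra_simps)
        also have "\<dots> = (sqrt (1 + 2 * K) * 2 powr (real k * (1 / 2 + \<epsilon>)))\<^sup>2"
          using K(1) by (simp add: power_mult_distrib powr_power mult.commute)
        finally show "(norm (\<Sum>n = M..<N. cis (- t * (real n)\<^sup>2) * z ^ n))\<^sup>2 \<le>
           (sqrt (1 + 2 * K) * 2 powr (real k * (1 / 2 + \<epsilon>)))\<^sup>2" .
      qed (use K in auto)
      moreover have "0 \<le> sqrt (1 + 2 * K)" using K by simp
      ultimately show "\<exists>K\<ge>0. \<forall>k M N z. norm z = 1 \<longrightarrow> N \<le> 2 ^ k \<longrightarrow>
         norm (\<Sum>n = M..<N. cis (- t * (real n)\<^sup>2) * z ^ n) \<le> K * 2 powr (real k * (1 / 2 + \<epsilon>))"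
        by blast
    qed
  qed
qed

section \<open>Dyadic blocks in the unit disc\<close>

text \<open>The bound concerns all contiguous sub-blocks because summation by parts consumes such a
  family and produces one again, so that several weights can be applied in succession.\<close>

definition blocks_bounded :: "nat \<Rightarrow> nat \<Rightarrow> (nat \<Rightarrow> complex) \<Rightarrow> real \<Rightarrow> bool" where
  "blocks_bounded M N x A \<longleftrightarrow> (\<forall>m n. M \<le> m \<and> m \<le> n \<and> n \<le> N \<longrightarrow> norm (\<Sum>i = m..<n. x i) \<le> A)"

lemma abel_summation:
  fixes c x :: "nat \<Rightarrow> complex"
  assumes "m < n"
  shows "(\<Sum>i = m..<n. c i * x i) =
    c m * (\<Sum>i = m..<n. x i) + (\<Sum>i = Suc m..<n. (c i - c (i - 1)) * (\<Sum>j = i..<n. x j))"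
  using assms
proof (induction "n - m" arbitrary: m rule: less_induct)
  case less
  show ?case
  proof (cases "Suc m = n")
    case False
    then have "Suc m < n" using less.prems by simp
    define T where "T i = (\<Sum>j = i..<n. x j)" for i
    have "(\<Sum>i = m..<n. c i * x i) = c m * x m + (\<Sum>i = Suc m..<n. c i * x i)"
      using less.prems by (simp add: sum.atLeast_Suc_lessThan)
    also have "(\<Sum>i = Suc m..<n. c i * x i) = c (Suc m) * T (Suc m) + (\<Sum>i = Suc (Suc m)..<n. (c i - c (i - 1)) * T i)"
      unfolding T_def using \<open>Suc m < n\<close> by (intro less.hyps) auto
    also have "x m = T m - T (Suc m)"
      using less.prems by (simp add: T_def sum.atLeast_Suc_lessThan)
    also have "c m * (T m - T (Suc m)) + (c (Suc m) * T (Suc m) + (\<Sum>i = Suc (Suc m)..<n. (c i - c (i - 1)) * T i))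
       = c m * T m + (\<Sum>i = Suc m..<n. (c i - c (i - 1)) * T i)"
      using \<open>Suc m < n\<close> by (simp add: sum.atLeast_Suc_lessThan algebra_simps)
    finally show ?thesis by (simp add: T_def)
  qed auto
qed

text \<open>In \<open>abel_summation\<close> the partial sums are tails of the block and thus again
  sub-blocks bounded by \<open>A\<close>; the weight costs its supremum plus its total
  variation.\<close>

lemma blocks_bounded_mult:
  fixes c x :: "nat \<Rightarrow> complex"
  assumes x: "blocks_bounded M N x A" and B: "\<And>i. M \<le> i \<Longrightarrow> i < N \<Longrightarrow> norm (c i) \<le> B"
    and V: "(\<Sum>i = Suc M..<N. norm (c i - c (i - 1))) \<le> V"
    and "0 \<le> A" "0 \<le> B" "0 \<le> V"
  shows "blocks_bounded M N (\<lambda>i. c i * x i) (A * (B + V))"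
  unfolding blocks_bounded_def
proof (intro allI impI, elim conjE)
  fix m n assume mn: "M \<le> m" "m \<le> n" "n \<le> N"
  show "norm (\<Sum>i = m..<n. c i * x i) \<le> A * (B + V)"
  proof (cases "m < n")
    case True
    have T: "norm (\<Sum>j = i..<n. x j) \<le> A" if "m \<le> i" "i \<le> n" for i
      using x mn that unfolding blocks_bounded_def by auto
    have "norm (\<Sum>i = m..<n. c i * x i) \<le> norm (c m * (\<Sum>i = m..<n. x i)) +
        norm (\<Sum>i = Suc m..<n. (c i - c (i - 1)) * (\<Sum>j = i..<n. x j))"
      unfolding abel_summation[OF True] by (rule norm_triangle_ineq)
    also have "norm (c m * (\<Sum>i = m..<n. x i)) \<le> B * A"
      unfolding norm_mult using True mn \<open>0 \<le> B\<close> by (intro mult_mono B T) auto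
    also have "norm (\<Sum>i = Suc m..<n. (c i - c (i - 1)) * (\<Sum>j = i..<n. x j)) \<le>
        (\<Sum>i = Suc m..<n. norm (c i - c (i - 1)) * A)"
      using True by (intro sum_norm_le) (auto simp: norm_mult intro!: mult_left_mono T)
    also have "\<dots> \<le> (\<Sum>i = Suc M..<N. norm (c i - c (i - 1)) * A)"
      using mn \<open>0 \<le> A\<close> by (intro sum_mono2) auto
    also have "\<dots> = (\<Sum>i = Suc M..<N. norm (c i - c (i - 1))) * A"
      by (simp add: sum_distrib_right)
    also have "\<dots> \<le> V * A"
      using V \<open>0 \<le> A\<close> by (rule mult_right_mono)
    finally show ?thesis by (simp add: algebra_simps)
  next
    case False
    then show ?thesis using mn \<open>0 \<le> A\<close> \<open>0 \<le> B\<close> \<open>0 \<le> V\<close> by simp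
  qed
qed

text \<open>The variation of a monotone weight telescopes to the difference of its end values, hence
  is at most \<open>B\<close>.\<close>

lemma blocks_bounded_mono_weight:
  fixes r :: "nat \<Rightarrow> real"
  assumes x: "blocks_bounded M N x A" and "mono r \<or> antimono r"
    and r: "\<And>i. M \<le> i \<Longrightarrow> i < N \<Longrightarrow> 0 \<le> r i \<and> r i \<le> B" and "0 \<le> A" "0 \<le> B"
  shows "blocks_bounded M N (\<lambda>i. of_real (r i) * x i) (A * (B + B))"
proof (rule blocks_bounded_mult[OF x])
  show "(\<Sum>i = Suc M..<N. norm (of_real (r i) - of_real (r (i - 1)) :: complex)) \<le> B"
  proof (cases "M < N")
    case True
    then obtain k where k: "N = Suc (M + k)" by (metis less_imp_Suc_add)
    have "(\<Sum>i = Suc M..<N. norm (of_real (r i) - of_real (r (i - 1)) :: complex)) = (\<Sum>i = Suc M..<N. \<bar>r i - r (i - 1)\<bar>)"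
      by (simp flip: of_real_diff)
    also have "\<dots> = \<bar>r (M + k) - r M\<bar>"
      unfolding k
    proof (induction k)
      case (Suc k)
      have "\<bar>r (M + k) - r M\<bar> + \<bar>r (Suc (M + k)) - r (M + k)\<bar> = \<bar>r (Suc (M + k)) - r M\<bar>"
        using assms(2) monoD[of r M "M + k"] monoD[of r "M + k" "Suc (M + k)"]
          antimonoD[of r M "M + k"] antimonoD[of r "M + k" "Suc (M + k)"] by auto
      then show ?case using Suc by simp
    qed simp
    also have "\<dots> \<le> B"
      using r[of M] r[of "M + k"] by (auto simp: k)
    finally show ?thesis .
  qed (use \<open>0 \<le> B\<close> in auto)
qed (use r assms in auto)

lemma powr_le_at_dyadic:
  fixes s :: real
  assumes "s \<le> 0" "2 ^ k \<le> n"
  shows "real n powr s \<le> 2 powr (real k * s)"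
proof -
  have "real (2 ^ k) \<le> real n" using assms(2) by (rule of_nat_mono)
  then have "real n powr s \<le> real (2 ^ k) powr s"
    using assms(1) by (intro powr_mono2') auto
  also have "\<dots> = 2 powr (real k * s)"
    by (simp add: powr_realpow[symmetric] powr_powr)
  finally show ?thesis .
qed

text \<open>On the k-th block \<open>b\<close> is bounded by C 2^(-k(\<gamma>+1/2)), and so is its
  variation, being a sum of at most 2^k increments of size C 2^(-k(\<gamma>+3/2)). The slack
  \<epsilon> = \<gamma> - g absorbs the loss in the Weyl bound.\<close>

lemma weyl_block_bound:
  fixes b :: "nat \<Rightarrow> complex" and d :: nat
  assumes t: "weyl_bounded t" and "0 < \<gamma>" "g < \<gamma>"
    and b: "\<And>n. 1 \<le> n \<Longrightarrow> norm (b n) \<le> C * real n powr (- \<gamma> - 1 / 2)"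
    and db: "\<And>n. 2 \<le> n \<Longrightarrow> norm (b n - b (n - 1)) \<le> C * real n powr (- \<gamma> - 3 / 2)"
  shows "\<exists>A\<ge>0. \<forall>k u. norm u = 1 \<longrightarrow>
    blocks_bounded (2 ^ k) (2 ^ Suc k) (\<lambda>n. b n * (cis (- t * (real n * (real n + real d - 1))) * u ^ n))
      (A * 2 powr (- (real k * g)))"
proof -
  define \<epsilon> where "\<epsilon> = \<gamma> - g"
  have "0 < \<epsilon>" using assms by (simp add: \<epsilon>_def)
  with t have "\<exists>K\<ge>0. \<forall>k M N z. norm z = 1 \<longrightarrow> N \<le> 2 ^ k \<longrightarrow>
     norm (\<Sum>n = M..<N. cis (- t * (real n)\<^sup>2) * z ^ n) \<le> K * 2 powr (real k * (1 / 2 + \<epsilon>))"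
    unfolding weyl_bounded_def by simp
  then obtain K where K: "0 \<le> K" "\<And>k M N z. norm z = 1 \<Longrightarrow> N \<le> 2 ^ k \<Longrightarrow>
     norm (\<Sum>n = M..<N. cis (- t * (real n)\<^sup>2) * z ^ n) \<le> K * 2 powr (real k * (1 / 2 + \<epsilon>))"
    by auto
  have C: "0 \<le> C" using b[of 1] norm_ge_zero[of "b 1"] by (simp del: norm_ge_zero)
  define A where "A = 2 * C * K * 2 powr (1 / 2 + \<epsilon>)"
  have "blocks_bounded (2 ^ k) (2 ^ Suc k) (\<lambda>n. b n * (cis (- t * (real n * (real n + real d - 1))) * u ^ n))
      (A * 2 powr (- (real k * g)))" if u: "norm u = 1" for k and u :: complex
  proof -
    \<comment> \<open>The block ends at 2^(k+1), so the Weyl bound is taken at level k + 1; the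
      extra factor 2^(1/2+\<epsilon>) is part of \<open>A\<close>.\<close>
    define A0 where "A0 = K * 2 powr (real (Suc k) * (1 / 2 + \<epsilon>))"
    define B0 where "B0 = C * 2 powr (real k * (- \<gamma> - 1 / 2))"
    \<comment> \<open>As n(n+d-1) = n^2 + n(d-1), the linear phase rotates \<open>u\<close> to
      another point of the circle.\<close>
    define z where "z = cis (- t * (real d - 1)) * u"
    have "cis (- t * (real n * (real n + real d - 1))) * u ^ n = cis (- t * (real n)\<^sup>2) * z ^ n" for n
    proof -
      have "- t * (real n * (real n + real d - 1)) = - t * (real n)\<^sup>2 + real n * (- t * (real d - 1))"
        by (simp add: algebra_simps power2_eq_square)
      then have "cis (- t * (real n * (real n + real d - 1))) = cis (- t * (real n)\<^sup>2) * cis (- t * (real d - 1)) ^ n"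
        by (simp only: cis_mult Complex.DeMoivre)
      then show ?thesis by (simp only: z_def power_mult_distrib mult.assoc)
    qed
    moreover have "norm z = 1" by (simp add: z_def norm_mult u)
    ultimately have x: "blocks_bounded (2 ^ k) (2 ^ Suc k) (\<lambda>n. cis (- t * (real n * (real n + real d - 1))) * u ^ n) A0"
      unfolding blocks_bounded_def A0_def using K(2)[of z] by presburger
    have "blocks_bounded (2 ^ k) (2 ^ Suc k) (\<lambda>n. b n * (cis (- t * (real n * (real n + real d - 1))) * u ^ n)) (A0 * (B0 + B0))"
    proof (rule blocks_bounded_mult[OF x])
      show "norm (b i) \<le> B0" if "2 ^ k \<le> i" "i < 2 ^ Suc k" for i
      proof -
        have "1 \<le> i" using that(1) by (meson one_le_numeral one_le_power order_trans)
        then have "norm (b i) \<le> C * real i powr (- \<gamma> - 1 / 2)" by (rule b)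
        also have "\<dots> \<le> B0" unfolding B0_def
          using C \<open>0 < \<gamma>\<close> that by (intro mult_left_mono powr_le_at_dyadic) auto
        finally show ?thesis .
      qed
      have "(\<Sum>i = Suc (2 ^ k)..<2 ^ Suc k. norm (b i - b (i - 1))) \<le> (\<Sum>i = Suc (2 ^ k)..<2 ^ Suc k. C * 2 powr (real k * (- \<gamma> - 3 / 2)))"
      proof (rule sum_mono)
        fix i :: nat assume i: "i \<in> {Suc (2 ^ k)..<2 ^ Suc k}"
        have "1 \<le> (2::nat) ^ k" by simp
        then have "2 \<le> i" "2 ^ k \<le> i" using i by auto
        have "norm (b i - b (i - 1)) \<le> C * real i powr (- \<gamma> - 3 / 2)" using \<open>2 \<le> i\<close> by (rule db)
        also have "\<dots> \<le> C * 2 powr (real k * (- \<gamma> - 3 / 2))"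
          using C \<open>0 < \<gamma>\<close> \<open>2 ^ k \<le> i\<close> by (intro mult_left_mono powr_le_at_dyadic) auto
        finally show "norm (b i - b (i - 1)) \<le> C * 2 powr (real k * (- \<gamma> - 3 / 2))" .
      qed
      also have "\<dots> = real (2 ^ Suc k - Suc (2 ^ k)) * (C * 2 powr (real k * (- \<gamma> - 3 / 2)))"
        by simp
      also have "\<dots> \<le> 2 powr real k * (C * 2 powr (real k * (- \<gamma> - 3 / 2)))"
        using C by (intro mult_right_mono) (auto simp: powr_realpow of_nat_diff)
      also have "\<dots> = C * 2 powr (real k + real k * (- \<gamma> - 3 / 2))"
        by (simp add: powr_add)
      also have "\<dots> = B0" by (simp add: B0_def algebra_simps)
      finally show "(\<Sum>i = Suc (2 ^ k)..<2 ^ Suc k. norm (b i - b (i - 1))) \<le> B0" .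
    qed (use K C in \<open>auto simp: A0_def B0_def\<close>)
    moreover have "A0 * (B0 + B0) = A * 2 powr (- (real k * g))"
    proof -
      have "A0 * (B0 + B0) = 2 * C * K * 2 powr (real (Suc k) * (1 / 2 + \<epsilon>) + real k * (- \<gamma> - 1 / 2))"
        by (simp add: A0_def B0_def powr_add)
      also have "real (Suc k) * (1 / 2 + \<epsilon>) + real k * (- \<gamma> - 1 / 2) = (1 / 2 + \<epsilon>) + - (real k * g)"
        by (simp add: \<epsilon>_def algebra_simps)
      finally show ?thesis by (simp only: powr_add A_def mult.assoc)
    qed
    ultimately show ?thesis by simp
  qed
  moreover have "0 \<le> A" using K C by (simp add: A_def)
  ultimately show ?thesis by blast
qed

definition dyadic_block :: "(nat \<Rightarrow> complex) \<Rightarrow> nat \<Rightarrow> complex \<Rightarrow> complex" where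
  "dyadic_block c k z = (\<Sum>n = 2 ^ k..<2 ^ Suc k. c n * z ^ n)"

lemma antimono_power_nat:
  fixes r :: real
  assumes "0 \<le> r" "r \<le> 1"
  shows "antimono (\<lambda>n. r ^ n)" "antimono (\<lambda>n. r ^ (n - 1))"
  using assms by (auto intro!: antimonoI power_decreasing)

text \<open>For z = r u with |u| = 1 the decreasing weight r^n transfers the circle bound to z. The
  derivative uses the increasing weight n and then r^(n-1), at the price of 2^k; convexity of the
  disc turns it into a Lipschitz bound.\<close>

lemma dyadic_block_bound:
  fixes b :: "nat \<Rightarrow> complex" and d :: nat
  assumes t: "weyl_bounded t" and \<gamma>: "0 < \<gamma>" "g < \<gamma>"
    and b: "\<And>n. 1 \<le> n \<Longrightarrow> norm (b n) \<le> C * real n powr (- \<gamma> - 1 / 2)"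
    and db: "\<And>n. 2 \<le> n \<Longrightarrow> norm (b n - b (n - 1)) \<le> C * real n powr (- \<gamma> - 3 / 2)"
  defines "P \<equiv> dyadic_block (\<lambda>n. b n * cis (- t * (real n * (real n + real d - 1))))"
  shows "\<exists>A\<ge>0. \<forall>k z w. norm z \<le> 1 \<longrightarrow> norm w \<le> 1 \<longrightarrow> norm (P k z) \<le> A * 2 powr (- (real k * g)) \<and>
     norm (P k z - P k w) \<le> A * 2 powr (real k * (1 - g)) * norm (z - w)"
proof -
  obtain A where A: "0 \<le> A" "\<And>k u. norm u = 1 \<Longrightarrow>
    blocks_bounded (2 ^ k) (2 ^ Suc k) (\<lambda>n. b n * (cis (- t * (real n * (real n + real d - 1))) * u ^ n))
      (A * 2 powr (- (real k * g)))"
    using weyl_block_bound[OF t \<gamma> b db, of d] by blast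
  define c where "c n = b n * cis (- t * (real n * (real n + real d - 1)))" for n
  define P' where "P' k z = (\<Sum>n = 2 ^ k..<2 ^ Suc k. c n * (of_nat n * z ^ (n - 1)))" for k z
  have der: "(P k has_field_derivative P' k z) (at z within S)" for k z S
    unfolding P_def P'_def c_def[symmetric] dyadic_block_def
    by (auto intro!: derivative_eq_intros sum.cong)
  define X where "X k = A * 2 powr (- (real k * g))" for k
  have X0: "0 \<le> X k" for k using A by (simp add: X_def)
  have polar: "\<exists>r u. z = of_real r * u \<and> norm u = 1 \<and> 0 \<le> r \<and> r \<le> 1" if "norm z \<le> 1" for z :: complex
  proof (cases "z = 0")
    case False
    then show ?thesis
      using that by (intro exI[of _ "norm z"] exI[of _ "sgn z"]) (auto simp: norm_sgn sgn_div_norm scaleR_conv_of_real norm_mult norm_inverse)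
  qed (auto intro!: exI[of _ "0::real"] exI[of _ "1::complex"])
  have sup: "norm (P k z) \<le> 2 * X k" if z: "norm z \<le> 1" for k z
  proof -
    obtain r u where ru: "z = of_real r * u" "norm u = 1" "0 \<le> r" "r \<le> 1" using polar[OF z] by blast
    have x: "blocks_bounded (2 ^ k) (2 ^ Suc k) (\<lambda>n. c n * u ^ n) (X k)"
      using A(2)[OF ru(2), of k] by (simp add: c_def X_def mult.assoc)
    have "blocks_bounded (2 ^ k) (2 ^ Suc k) (\<lambda>n. of_real (r ^ n) * (c n * u ^ n)) (X k * (1 + 1))"
      using ru X0 by (intro blocks_bounded_mono_weight[OF x] disjI2 antimono_power_nat) (auto intro: power_le_one)
    then have "norm (\<Sum>n = 2 ^ k..<2 ^ Suc k. of_real (r ^ n) * (c n * u ^ n)) \<le> X k * (1 + 1)"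
      unfolding blocks_bounded_def by (auto simp del: power_Suc)
    also have "(\<Sum>n = 2 ^ k..<2 ^ Suc k. of_real (r ^ n) * (c n * u ^ n)) = P k z"
      unfolding P_def c_def[symmetric] dyadic_block_def ru(1) by (rule sum.cong) (simp_all add: power_mult_distrib)
    finally show ?thesis by simp
  qed
  \<comment> \<open>8 = 4 * 2: the weight n, bounded by 2^(k+1), contributes 4 * 2^k and the weight
    r^(n-1) contributes 2.\<close>
  have sup': "norm (P' k z) \<le> 8 * 2 ^ k * X k" if z: "norm z \<le> 1" for k z
  proof -
    obtain r u where ru: "z = of_real r * u" "norm u = 1" "0 \<le> r" "r \<le> 1" using polar[OF z] by blast
    have x: "blocks_bounded (2 ^ k) (2 ^ Suc k) (\<lambda>n. c n * u ^ n) (X k)"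
      using A(2)[OF ru(2), of k] by (simp add: c_def X_def mult.assoc)
    have y: "blocks_bounded (2 ^ k) (2 ^ Suc k) (\<lambda>n. of_real (real n) * (c n * u ^ n)) (X k * (2 ^ Suc k + 2 ^ Suc k))"
    proof (rule blocks_bounded_mono_weight[OF x])
      fix i :: nat assume "i < 2 ^ Suc k"
      then have "real i < real (2 ^ Suc k)" by (rule of_nat_less_iff[THEN iffD2])
      then show "0 \<le> real i \<and> real i \<le> 2 ^ Suc k" by simp
    qed (auto simp: X0 mono_def)
    have "blocks_bounded (2 ^ k) (2 ^ Suc k) (\<lambda>n. of_real (r ^ (n - 1)) * (of_real (real n) * (c n * u ^ n)))
       (X k * (2 ^ Suc k + 2 ^ Suc k) * (1 + 1))"
      using ru X0 by (intro blocks_bounded_mono_weight[OF y] disjI2 antimono_power_nat) (auto intro: power_le_one)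
    then have "norm (\<Sum>n = 2 ^ k..<2 ^ Suc k. of_real (r ^ (n - 1)) * (of_real (real n) * (c n * u ^ n))) \<le> 8 * 2 ^ k * X k"
      unfolding blocks_bounded_def by (auto dest!: spec[of _ "2 ^ k"] spec[of _ "2 ^ Suc k"] simp: algebra_simps)
    \<comment> \<open>The factor u of modulus 1 restores the exponent n, so that the circle bound
      for u^n applies to a derivative with exponent n - 1.\<close>
    also have "(\<Sum>n = 2 ^ k..<2 ^ Suc k. of_real (r ^ (n - 1)) * (of_real (real n) * (c n * u ^ n))) = u * P' k z"
      unfolding P'_def ru(1) sum_distrib_left
    proof (rule sum.cong)
      fix n :: nat assume "n \<in> {2 ^ k..<2 ^ Suc k}"
      then have "n \<noteq> 0" by (auto intro: gr0I)
      then obtain m where "n = Suc m" by (metis not0_implies_Suc)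
      then show "of_real (r ^ (n - 1)) * (of_real (real n) * (c n * u ^ n)) = u * (c n * (of_nat n * (of_real r * u) ^ (n - 1)))"
        by (simp add: power_mult_distrib)
    qed simp
    finally show ?thesis by (simp add: norm_mult ru(2))
  qed
  have lip: "norm (P k z - P k w) \<le> 8 * 2 ^ k * X k * norm (z - w)" if "norm z \<le> 1" "norm w \<le> 1" for k z w
    by (rule field_differentiable_bound[where S = "cball 0 1"]) (use der sup' that in auto)
  have e: "8 * 2 ^ k * X k = 8 * A * 2 powr (real k * (1 - g))" for k
  proof -
    have "2 powr (real k * (1 - g)) = 2 powr (real k + - (real k * g))" by (simp add: algebra_simps)
    then show ?thesis by (simp only: powr_add X_def powr_realpow[of 2 k, simplified]) simp
  qed
  have "norm (P k z) \<le> 8 * A * 2 powr (- (real k * g)) \<and>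
     norm (P k z - P k w) \<le> 8 * A * 2 powr (real k * (1 - g)) * norm (z - w)"
    if "norm z \<le> 1" "norm w \<le> 1" for k z w
    using sup[OF that(1), of k] lip[OF that, of k] X0[of k] unfolding e by (simp add: X_def)
  moreover have "0 \<le> 8 * A" using A by simp
  ultimately show ?thesis by blast
qed

section \<open>Zonal harmonics\<close>

text \<open>At unit vectors this is the spherical Laplacian of (x \<bullet> w)^k, as
  \<open>sphere_laplacian_inner_power\<close> shows; the explicit form keeps the integral identities
  free of derivatives.\<close>

definition power_laplacian :: "'a::euclidean_space \<Rightarrow> nat \<Rightarrow> 'a \<Rightarrow> real" where
  "power_laplacian w k x = real k * (real k - 1) * (norm w)\<^sup>2 * (x \<bullet> w) ^ (k - 2) -
     real k * (real k + real (DIM('a) - 1) - 1) * (x \<bullet> w) ^ k"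

lemma poly_gegenbauer_op_monom:
  "poly (gegenbauer_op d (monom c m)) s =
     c * (real m * (real m - 1) * s ^ (m - 2) - real m * (real m + real d - 1) * s ^ m)"
proof (cases m)
  case (Suc k)
  then show ?thesis
    by (cases k) (simp_all add: gegenbauer_op_def pderiv_monom poly_monom algebra_simps power2_eq_square)
qed (simp add: gegenbauer_op_def pderiv_monom poly_monom)

lemma poly_induct_monom:
  fixes P :: "'b::comm_monoid_add poly \<Rightarrow> bool"
  assumes "\<And>c m. P (monom c m)" and "\<And>p q. P p \<Longrightarrow> P q \<Longrightarrow> P (p + q)"
  shows "P Q"
proof -
  have "P (\<Sum>i\<in>A. monom (coeff Q i) i)" if "finite A" for A
    using that
  proof (induction A rule: finite_induct)
    case empty
    then show ?case using assms(1)[of 0 0] by simp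
  qed (auto intro: assms)
  from this[of "{..degree Q}"] show ?thesis by (simp add: poly_as_sum_of_monoms)
qed

lemma continuous_on_poly_inner [continuous_intros]:
  "continuous_on A (\<lambda>x::'a::real_inner. poly p (x \<bullet> e))" for p :: "real poly"
  by (intro continuous_intros)

lemma continuous_on_power_laplacian [continuous_intros]: "continuous_on A (power_laplacian w k)"
  unfolding power_laplacian_def[abs_def] by (intro continuous_intros)

context
  fixes e :: "'a::euclidean_space"
  assumes e: "norm e = 1"
begin

text \<open>\<open>integral_sphere_green\<close> for monomials in x \<bullet> e, extended by
  linearity: the Laplacian moves from a zonal polynomial to a power of an arbitrary linear
  form.\<close>

lemma integral_gegenbauer_op_power:
  "(\<integral>x. poly (gegenbauer_op (DIM('a) - 1) Q) (x \<bullet> e) * (x \<bullet> w) ^ k \<partial>surface_measure) =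
   (\<integral>x. poly Q (x \<bullet> e) * power_laplacian w k x \<partial>surface_measure)"
proof (induction Q rule: poly_induct_monom)
  case (1 c m)
  have "(\<integral>x. poly (gegenbauer_op (DIM('a) - 1) (monom c m)) (x \<bullet> e) * (x \<bullet> w) ^ k \<partial>surface_measure) =
    (\<integral>x. c * ((x \<bullet> w) ^ k * (real m * (real m - 1) * (x \<bullet> e) ^ (m - 2) -
        real m * (real m + real DIM('a) - 2) * (x \<bullet> e) ^ m)) \<partial>surface_measure)"
    using DIM_positive[where 'a = 'a] unfolding poly_gegenbauer_op_monom
    by (intro Bochner_Integration.integral_cong) (auto simp: of_nat_diff algebra_simps)
  also have "\<dots> = (\<integral>x. c * ((x \<bullet> e) ^ m * (real k * (real k - 1) * (norm w)\<^sup>2 * (x \<bullet> w) ^ (k - 2) -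
        real k * (real k + real DIM('a) - 2) * (x \<bullet> w) ^ k)) \<partial>surface_measure)"
    unfolding integral_mult_right_zero integral_sphere_green[OF e] ..
  also have "\<dots> = (\<integral>x. poly (monom c m) (x \<bullet> e) * power_laplacian w k x \<partial>surface_measure)"
    using DIM_positive[where 'a = 'a] unfolding poly_monom power_laplacian_def
    by (intro Bochner_Integration.integral_cong) (auto simp: of_nat_diff algebra_simps)
  finally show ?case .
next
  case (2 p q)
  then show ?case
    by (simp add: gegenbauer_op_add distrib_right integrable_surface_measure continuous_intros)
qed

definition zonal_integral :: "real poly \<Rightarrow> real" where
  "zonal_integral Q = (\<integral>x. poly Q (x \<bullet> e) \<partial>surface_measure)"

lemma zonal_integral_add: "zonal_integral (p + q) = zonal_integral p + zonal_integral q"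
  and zonal_integral_diff: "zonal_integral (p - q) = zonal_integral p - zonal_integral q"
  and zonal_integral_of_nat: "zonal_integral (of_nat n * p) = real n * zonal_integral p"
  by (simp_all add: zonal_integral_def integrable_surface_measure continuous_intros)

text \<open>The case w = e of the previous lemma, where both factors are zonal because
  \<open>norm e = 1\<close> turns \<open>power_laplacian e k\<close> into the Gegenbauer operator on
  a monomial.\<close>

lemma zonal_integral_gegenbauer_op:
  "zonal_integral (gegenbauer_op (DIM('a) - 1) Q * R) = zonal_integral (Q * gegenbauer_op (DIM('a) - 1) R)"
proof (induction R rule: poly_induct_monom)
  case (1 c k)
  have "zonal_integral (gegenbauer_op (DIM('a) - 1) Q * monom c k) =
     (\<integral>x. c * (poly (gegenbauer_op (DIM('a) - 1) Q) (x \<bullet> e) * (x \<bullet> e) ^ k) \<partial>surface_measure)"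
    unfolding zonal_integral_def
    by (intro Bochner_Integration.integral_cong) (auto simp: poly_monom)
  also have "\<dots> = (\<integral>x. c * (poly Q (x \<bullet> e) * power_laplacian e k x) \<partial>surface_measure)"
    unfolding integral_mult_right_zero integral_gegenbauer_op_power ..
  also have "\<dots> = zonal_integral (Q * gegenbauer_op (DIM('a) - 1) (monom c k))"
    unfolding zonal_integral_def
    by (intro Bochner_Integration.integral_cong)
      (auto simp: poly_gegenbauer_op_monom power_laplacian_def e)
  finally show ?case .
next
  case (2 p q)
  then show ?case by (simp add: gegenbauer_op_add distrib_left zonal_integral_add)
qed

context
  fixes d :: nat
  assumes d: "2 \<le> d" and DIM: "DIM('a) = d + 1"
begin

text \<open>A symmetric operator has orthogonal eigenvectors for different eigenvalues, and n(n+d-1)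
  is strictly increasing in n.\<close>

lemma zonal_poly_orthogonal:
  assumes "m \<noteq> n"
  shows "zonal_integral (zonal_poly d m * zonal_poly d n) = 0"
proof -
  have d0: "0 < d" using d by simp
  have lt: "i * (i + d - 1) < j * (j + d - 1)" if "i < j" for i j
    using that d by (intro mult_strict_mono') auto
  have ne: "m * (m + d - 1) \<noteq> n * (n + d - 1)"
    using assms lt[of m n] lt[of n m] by (cases "m < n") auto
  have "zonal_integral (gegenbauer_op d (zonal_poly d m) * zonal_poly d n) =
      zonal_integral (zonal_poly d m * gegenbauer_op d (zonal_poly d n))"
    using zonal_integral_gegenbauer_op DIM by simp
  then have "zonal_integral (of_nat (m * (m + d - 1)) * (zonal_poly d m * zonal_poly d n)) =
      zonal_integral (of_nat (n * (n + d - 1)) * (zonal_poly d m * zonal_poly d n))"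
    unfolding gegenbauer_op_zonal_poly[OF d0]
    using zonal_integral_diff[of 0 "of_nat (m * (m + d - 1)) * (zonal_poly d m * zonal_poly d n)"]
      zonal_integral_diff[of 0 "of_nat (n * (n + d - 1)) * (zonal_poly d m * zonal_poly d n)"]
    by (simp only: mult_minus_left mult_minus_right mult.assoc mult.left_commute[of "zonal_poly d m"]) simp
  then have "(real (m * (m + d - 1)) - real (n * (n + d - 1))) * zonal_integral (zonal_poly d m * zonal_poly d n) = 0"
    unfolding zonal_integral_of_nat by (simp add: left_diff_distrib)
  then show ?thesis using ne by (simp only: mult_eq_0_iff right_minus_eq of_nat_eq_iff) blast
qed

text \<open>Pairing the three-term recurrence with its lowest member and with its highest member
  kills one term each by orthogonality. Both results contain the integral \<open>c n\<close> of X
  Z_n Z_(n+1), which is eliminated.\<close>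

lemma zonal_poly_norm_rec:
  "real ((n + d - 1) * (2 * n + d + 1)) * zonal_integral (zonal_poly d (Suc n) * zonal_poly d (Suc n)) =
   real ((n + 1) * (2 * n + d - 1)) * zonal_integral (zonal_poly d n * zonal_poly d n)"
proof -
  define Z where "Z = zonal_poly d"
  define h where "h n = zonal_integral (Z n * Z n)" for n
  define c where "c n = zonal_integral ([:0, 1:] * (Z n * Z (Suc n)))" for n
  have d0: "0 < d" using d by simp
  have orth: "zonal_integral (Z m * Z n) = 0" if "m \<noteq> n" for m n
    using zonal_poly_orthogonal[OF that] by (simp add: Z_def)
  have rec: "of_nat (n + d) * (Z (Suc (Suc n)) * p) =
     of_nat (2 * n + d + 1) * ([:0, 1:] * (Z (Suc n) * p)) - of_nat (n + 1) * (Z n * p)" for p n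
    using arg_cong[OF zonal_poly_rec[OF d0, of n], of "\<lambda>q. q * p"]
    by (simp only: Z_def left_diff_distrib mult.assoc)
  have 1: "real (2 * n + d + 1) * c n = real (n + 1) * h n" for n
    using arg_cong[OF rec[of n "Z n"], of zonal_integral] orth[of "Suc (Suc n)" n]
    unfolding zonal_integral_diff zonal_integral_of_nat
    by (simp add: c_def h_def mult.commute[of "Z n" "Z (Suc n)"])
  have 2: "real (n + d - 1) * h (Suc n) = real (2 * n + d - 1) * c n" for n
  proof (cases n)
    case 0
    then show ?thesis by (simp add: h_def c_def Z_def)
  next
    case (Suc k)
    have "real (k + d) * h (Suc (Suc k)) = real (2 * k + d + 1) * c (Suc k)"
      using arg_cong[OF rec[of k "Z (Suc (Suc k))"], of zonal_integral] orth[of k "Suc (Suc k)"]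
      unfolding zonal_integral_diff zonal_integral_of_nat
      by (simp add: c_def h_def)
    then show ?thesis by (simp add: Suc)
  qed
  have "real ((n + d - 1) * (2 * n + d + 1)) * h (Suc n) = real (2 * n + d + 1) * (real (2 * n + d - 1) * c n)"
    unfolding 2[symmetric] by (simp only: of_nat_mult mult_ac)
  also have "\<dots> = real ((n + 1) * (2 * n + d - 1)) * h n"
    using arg_cong[OF 1[of n], of "\<lambda>x. real (2 * n + d - 1) * x"] by (simp only: of_nat_mult mult_ac)
  finally show ?thesis by (simp add: h_def Z_def)
qed

section \<open>Size and variation of the normalising factors \<kappa>_n\<close>

definition zonal_coeff :: "nat \<Rightarrow> real" where
  "zonal_coeff n = 1 / sqrt (zonal_integral (zonal_poly d n * zonal_poly d n) / measure surface_measure (sphere (0::'a) 1))"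

lemma zonal_norm_pos: "0 < zonal_integral (zonal_poly d n * zonal_poly d n)"
proof (induction n)
  case 0
  show ?case using measure_surface_pos[where 'a = 'a] by (simp add: zonal_integral_def)
next
  case (Suc n)
  have "0 < (n + 1) * (2 * n + d - 1)"
    using d by simp
  then have "0 < real ((n + 1) * (2 * n + d - 1)) * zonal_integral (zonal_poly d n * zonal_poly d n)"
    using Suc by (intro mult_pos_pos) (simp_all only: of_nat_0_less_iff)
  then have "0 < real ((n + d - 1) * (2 * n + d + 1)) * zonal_integral (zonal_poly d (Suc n) * zonal_poly d (Suc n))"
    unfolding zonal_poly_norm_rec .
  moreover have "0 < real ((n + d - 1) * (2 * n + d + 1))"
    using d by (simp only: of_nat_0_less_iff nat_0_less_mult_iff) simp
  ultimately show ?case by (rule zero_less_mult_pos)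
qed

lemma zonal_coeff_pos: "0 < zonal_coeff n"
  using zonal_norm_pos[of n] measure_surface_pos[where 'a = 'a] by (simp add: zonal_coeff_def)

text \<open>The value \<open>J\<close> of the Jacobi polynomial at the pole is a common factor of
  the numerator and of the L2 norm; being positive, it cancels.\<close>

lemma zonal_eq: "zonal e n x = zonal_coeff n * poly (zonal_poly d n) (x \<bullet> e)"
proof -
  define \<alpha> where "\<alpha> = (real (DIM('a) - 1) - 2) / 2"
  have \<alpha>: "real d = 2 * \<alpha> + 2" "0 \<le> \<alpha>"
    using d DIM by (auto simp: \<alpha>_def field_simps)
  define J where "J = jacobi \<alpha> \<alpha> n 1"
  have J: "0 < J" unfolding J_def by (rule jacobi_one_pos[OF \<alpha>(2)])
  have jac: "jacobi \<alpha> \<alpha> n s = J * poly (zonal_poly d n) s" for s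
    unfolding J_def using d by (intro jacobi_eq_zonal_poly \<alpha>) simp
  define h \<omega> where "h = zonal_integral (zonal_poly d n * zonal_poly d n)" and "\<omega> = measure surface_measure (sphere (0::'a) 1)"
  have "(\<integral>y. (jacobi \<alpha> \<alpha> n (y \<bullet> e))\<^sup>2 \<partial>surface_measure) = (\<integral>y. J\<^sup>2 * poly (zonal_poly d n * zonal_poly d n) (y \<bullet> e) \<partial>surface_measure)"
    by (rule Bochner_Integration.integral_cong) (auto simp: jac power2_eq_square)
  also have "\<dots> = J\<^sup>2 * h"
    unfolding integral_mult_right_zero h_def zonal_integral_def ..
  finally have "zonal e n x = J * poly (zonal_poly d n) (x \<bullet> e) / sqrt ((1 / \<omega>) * (J\<^sup>2 * h))"
    unfolding zonal_def Let_def \<alpha>_def[symmetric] \<omega>_def[symmetric] by (simp add: jac)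
  also have "sqrt ((1 / \<omega>) * (J\<^sup>2 * h)) = J * sqrt (h / \<omega>)"
    using J by (simp add: real_sqrt_mult real_sqrt_divide mult_ac)
  finally show ?thesis
    using J by (simp add: zonal_coeff_def h_def \<omega>_def)
qed

text \<open>The squared factors are inverse to the norms, so their ratio is rational in n. Isolating
  the 1 exhibits the relative increment, which is of order 1/n and controls both growth and
  differences.\<close>

lemma zonal_coeff_rec:
  "(zonal_coeff (Suc n))\<^sup>2 = (zonal_coeff n)\<^sup>2 *
     (1 + real (d - 1) * (2 * real n + real d) / ((2 * real n + real d - 1) * (real n + 1)))"
proof -
  define h \<omega> where "h = (\<lambda>n. zonal_integral (zonal_poly d n * zonal_poly d n))" and "\<omega> = measure surface_measure (sphere (0::'a) 1)"
  have h: "0 < h n" for n using zonal_norm_pos by (simp add: h_def)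
  have \<omega>: "0 < \<omega>" using measure_surface_pos by (simp add: \<omega>_def)
  have z: "(zonal_coeff n)\<^sup>2 = \<omega> / h n" for n
    using h[of n] \<omega> by (simp add: zonal_coeff_def h_def \<omega>_def power_divide)
  define N D where "N = real n" and "D = real d"
  have D2: "2 \<le> D" and N0: "0 \<le> N" using d by (auto simp: N_def D_def)
  have "((N + D - 1) * (2 * N + D + 1)) * h (Suc n) = ((N + 1) * (2 * N + D - 1)) * h n"
  proof -
    have "real ((n + d - 1) * (2 * n + d + 1)) = (N + D - 1) * (2 * N + D + 1)"
      "real ((n + 1) * (2 * n + d - 1)) = (N + 1) * (2 * N + D - 1)"
      using d unfolding of_nat_mult by (simp_all add: N_def D_def of_nat_diff)
    then show ?thesis using zonal_poly_norm_rec[of n] unfolding h_def by simp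
  qed
  moreover have "0 < (N + 1) * (2 * N + D - 1)"
    using D2 N0 by (intro mult_pos_pos) auto
  moreover have "1 / y = p / q / x" if "p * y = q * x" "0 < q" "0 < x" "0 < y" for p q x y :: real
    using that by (simp add: field_simps)
  ultimately have hS: "1 / h (Suc n) = ((N + D - 1) * (2 * N + D + 1)) / ((N + 1) * (2 * N + D - 1)) / h n"
    using h by blast
  have "((N + D - 1) * (2 * N + D + 1)) / ((N + 1) * (2 * N + D - 1)) = 1 + (D - 1) * (2 * N + D) / ((2 * N + D - 1) * (N + 1))"
    using D2 N0 by (simp add: divide_simps) (simp add: algebra_simps)
  then have "\<omega> / h (Suc n) = \<omega> / h n * (1 + (D - 1) * (2 * N + D) / ((2 * N + D - 1) * (N + 1)))"
    using hS by (simp add: divide_inverse)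
  then show ?thesis
    using d by (simp add: z N_def D_def of_nat_diff)
qed

text \<open>The right-hand side is the linear term in Bernoulli's inequality for
  ((2n+3)/(2n+1))^(d-1). After cross-multiplication the two sides of the core inequality differ by d
  - 2.\<close>

lemma zonal_coeff_increment_bound:
  "real (d - 1) * (2 * real n + real d) / ((2 * real n + real d - 1) * (real n + 1)) \<le> 2 * real (d - 1) / (2 * real n + 1)"
proof -
  define N D where "N = real n" and "D = real d"
  have D2: "2 \<le> D" and N0: "0 \<le> N" using d by (auto simp: N_def D_def)
  have "(2 * N + D) * (2 * N + 1) \<le> 2 * ((2 * N + D - 1) * (N + 1))"
    using D2 by (simp add: algebra_simps)
  then have "(2 * N + D) / ((2 * N + D - 1) * (N + 1)) \<le> 2 / (2 * N + 1)"
    using D2 N0 by (simp add: divide_simps)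
  from mult_left_mono[OF this, of "real (d - 1)"] show ?thesis
    by (simp add: N_def D_def mult.commute)
qed

text \<open>The induction starts from \<kappa>_0 = 1. By Bernoulli's inequality each step costs at
  most the factor ((2n+3)/(2n+1))^(d-1), and these factors telescope.\<close>

lemma zonal_coeff_upper: "(zonal_coeff n)\<^sup>2 \<le> real (2 * n + 1) ^ (d - 1)"
proof (induction n)
  case 0
  show ?case
    using measure_surface_pos[where 'a = 'a] by (simp add: zonal_coeff_def zonal_integral_def)
next
  case (Suc n)
  have "(zonal_coeff (Suc n))\<^sup>2 \<le> (zonal_coeff n)\<^sup>2 * (1 + 2 * real (d - 1) / (2 * real n + 1))"
    unfolding zonal_coeff_rec using zonal_coeff_increment_bound[of n]
    by (intro mult_left_mono) auto
  also have "\<dots> \<le> real (2 * n + 1) ^ (d - 1) * (1 + 2 / (2 * real n + 1)) ^ (d - 1)"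
    using Suc Bernoulli_inequality[of "2 / (2 * real n + 1)" "d - 1"]
    by (intro mult_mono) (auto simp: field_simps)
  also have "\<dots> = real (2 * Suc n + 1) ^ (d - 1)"
    unfolding power_mult_distrib[symmetric] by (rule arg_cong[where f = "\<lambda>x. x ^ (d - 1)"]) (simp add: field_simps)
  finally show ?case .
qed

text \<open>\<kappa>_(n+1) = \<kappa>_n sqrt(1 + \<delta>) and sqrt(1 + \<delta>) \<le> 1 +
  \<delta>/2. This supplies the additional factor 1/n for the increments of a_n \<kappa>_n.\<close>

lemma zonal_coeff_diff:
  "\<bar>zonal_coeff (Suc n) - zonal_coeff n\<bar> \<le> zonal_coeff n * (real (d - 1) / (2 * real n + 1))"
proof -
  define \<delta> where "\<delta> = real (d - 1) * (2 * real n + real d) / ((2 * real n + real d - 1) * (real n + 1))"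
  have \<delta>: "0 \<le> \<delta>" "\<delta> \<le> 2 * (real (d - 1) / (2 * real n + 1))"
  proof -
    show "0 \<le> \<delta>"
      unfolding \<delta>_def using d by (intro divide_nonneg_nonneg mult_nonneg_nonneg) auto
    show "\<delta> \<le> 2 * (real (d - 1) / (2 * real n + 1))"
      using zonal_coeff_increment_bound[of n] by (simp only: \<delta>_def times_divide_eq_right)
  qed
  have "(zonal_coeff (Suc n))\<^sup>2 = (zonal_coeff n)\<^sup>2 * (1 + \<delta>)"
    using zonal_coeff_rec[of n] by (simp only: \<delta>_def)
  also have "\<dots> = (zonal_coeff n * sqrt (1 + \<delta>))\<^sup>2"
    using \<delta>(1) by (simp add: power_mult_distrib)
  finally have eq: "zonal_coeff (Suc n) = zonal_coeff n * sqrt (1 + \<delta>)"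
    by (rule power2_eq_imp_eq) (use zonal_coeff_pos[THEN less_imp_le] \<delta>(1) in auto)
  have "1 \<le> sqrt (1 + \<delta>)" using \<delta> by simp
  have "sqrt (1 + \<delta>) \<le> sqrt ((1 + \<delta> / 2)\<^sup>2)"
    using \<delta> by (intro real_sqrt_le_mono) (simp add: power2_eq_square algebra_simps)
  then have "sqrt (1 + \<delta>) - 1 \<le> real (d - 1) / (2 * real n + 1)"
    using \<delta> by simp
  then have "zonal_coeff n * (sqrt (1 + \<delta>) - 1) \<le> zonal_coeff n * (real (d - 1) / (2 * real n + 1))"
    using zonal_coeff_pos[of n] by (intro mult_left_mono) auto
  moreover have "0 \<le> zonal_coeff n * (sqrt (1 + \<delta>) - 1)"
    using zonal_coeff_pos[of n] \<open>1 \<le> sqrt (1 + \<delta>)\<close> by simp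
  ultimately show ?thesis by (simp add: eq algebra_simps)
qed

end

end

text \<open>sqrt(1 - (x \<bullet> e)^2) is the norm of the component of x orthogonal to e, and
  orthogonal projection is a contraction. The second estimate is needed in its own right because sin
  \<theta> is not a Lipschitz function of cos \<theta> at the poles.\<close>

lemma polar_coordinates_lipschitz:
  fixes e x y :: "'a::real_inner"
  assumes e: "norm e = 1" and "norm x = 1" "norm y = 1"
  shows "\<bar>x \<bullet> e - y \<bullet> e\<bar> \<le> norm (x - y)"
    and "\<bar>sqrt (1 - (x \<bullet> e)\<^sup>2) - sqrt (1 - (y \<bullet> e)\<^sup>2)\<bar> \<le> norm (x - y)"
proof -
  show "\<bar>x \<bullet> e - y \<bullet> e\<bar> \<le> norm (x - y)"
    using Cauchy_Schwarz_ineq2[of "x - y" e] e by (simp add: inner_diff_left)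
  have sq: "(norm (v - (v \<bullet> e) *\<^sub>R e))\<^sup>2 = (norm v)\<^sup>2 - (v \<bullet> e)\<^sup>2" for v
    using e unfolding power2_norm_eq_inner
    by (simp add: norm_eq_1 inner_diff_left inner_diff_right inner_commute power2_eq_square algebra_simps)
  have r: "sqrt (1 - (v \<bullet> e)\<^sup>2) = norm (v - (v \<bullet> e) *\<^sub>R e)" if "norm v = 1" for v
    using sq[of v] that by (intro real_sqrt_unique) auto
  have "\<bar>norm (x - (x \<bullet> e) *\<^sub>R e) - norm (y - (y \<bullet> e) *\<^sub>R e)\<bar> \<le> norm ((x - (x \<bullet> e) *\<^sub>R e) - (y - (y \<bullet> e) *\<^sub>R e))"
    by (rule norm_triangle_ineq3)
  also have "(x - (x \<bullet> e) *\<^sub>R e) - (y - (y \<bullet> e) *\<^sub>R e) = (x - y) - ((x - y) \<bullet> e) *\<^sub>R e"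
    by (simp add: inner_diff_left algebra_simps)
  also have "norm \<dots> \<le> norm (x - y)"
    by (rule power2_le_imp_le) (simp_all only: sq norm_ge_zero, simp)
  finally show "\<bar>sqrt (1 - (x \<bullet> e)\<^sup>2) - sqrt (1 - (y \<bullet> e)\<^sup>2)\<bar> \<le> norm (x - y)"
    using r assms by simp
qed

section \<open>Laplace's integral for zonal polynomials and the transfer of disc estimates\<close>

definition laplace_point :: "real \<Rightarrow> real \<Rightarrow> complex" where
  "laplace_point s \<phi> = of_real s + \<i> * of_real (sqrt (1 - s\<^sup>2) * cos \<phi>)"

lemma norm_laplace_point_le_1:
  assumes "\<bar>s\<bar> \<le> 1"
  shows "norm (laplace_point s \<phi>) \<le> 1"
proof -
  have "s\<^sup>2 \<le> 1" using assms by (rule abs_square_le_1[THEN iffD2])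
  have "(cos \<phi>)\<^sup>2 \<le> 1" by (rule abs_square_le_1[THEN iffD2]) (rule abs_cos_le_one)
  have "(norm (laplace_point s \<phi>))\<^sup>2 = s\<^sup>2 + (1 - s\<^sup>2) * (cos \<phi>)\<^sup>2"
    using \<open>s\<^sup>2 \<le> 1\<close> by (simp add: laplace_point_def cmod_power2 power_mult_distrib)
  also have "\<dots> \<le> s\<^sup>2 + (1 - s\<^sup>2) * 1"
    using \<open>s\<^sup>2 \<le> 1\<close> \<open>(cos \<phi>)\<^sup>2 \<le> 1\<close> by (intro add_left_mono mult_left_mono) auto
  finally have "(norm (laplace_point s \<phi>))\<^sup>2 \<le> 1\<^sup>2" by simp
  then show ?thesis by (rule power2_le_imp_le) simp
qed

lemma continuous_on_laplace_point [continuous_intros]: "continuous_on A (laplace_point s)"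
  unfolding laplace_point_def[abs_def] by (intro continuous_intros)

text \<open>The integrand is the derivative of \<open>i \<surd>(1 - s\<^sup>2) \<zeta>\<^sup>n sin\<^bsup>m+1\<^esup> \<phi>\<close>, which vanishes at both ends.\<close>
lemma laplace_integral_rec:
  assumes "\<bar>s\<bar> \<le> 1"
  defines "\<zeta> \<equiv> laplace_point s"
  shows "((\<lambda>\<phi>. of_real (sin \<phi> ^ m) * (of_nat (n + m + 1) * \<zeta> \<phi> ^ Suc n - of_real (real (2 * n + m + 1) * s) * \<zeta> \<phi> ^ n
     + of_nat n * \<zeta> \<phi> ^ (n - 1))) has_integral 0) {0..pi}"
proof -
  define r where "r = sqrt (1 - s\<^sup>2)"
  have r: "r\<^sup>2 = 1 - s\<^sup>2" unfolding r_def
    using abs_square_le_1[THEN iffD2, OF assms(1)] by (intro real_sqrt_pow2) linarith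
  define F where "F \<phi> = \<i> * of_real r * (\<zeta> \<phi> ^ n * of_real (sin \<phi> ^ Suc m))" for \<phi>
  define F' where "F' \<phi> = of_real (sin \<phi> ^ m) * (of_nat (n + m + 1) * \<zeta> \<phi> ^ Suc n - of_real (real (2 * n + m + 1) * s) * \<zeta> \<phi> ^ n
     + of_nat n * \<zeta> \<phi> ^ (n - 1))" for \<phi>
  have "(F has_vector_derivative F' \<phi>) (at \<phi> within {0..pi})" for \<phi>
  proof -
    define S c z where "S = complex_of_real (sin \<phi>)" and "c = complex_of_real (cos \<phi>)" and "z = \<zeta> \<phi>"
    have Sc: "S\<^sup>2 + c\<^sup>2 = 1"
      unfolding S_def c_def by (simp flip: of_real_power of_real_add)
    have z: "z = of_real s + \<i> * of_real r * c"
      by (simp add: z_def \<zeta>_def laplace_point_def r_def c_def)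
    have zs: "(z - of_real s)\<^sup>2 = - (1 - (of_real s)\<^sup>2) * c\<^sup>2"
      using r by (simp add: z power_mult_distrib flip: of_real_power) 
    have \<zeta>': "(\<zeta> has_vector_derivative - (\<i> * of_real r * S)) (at \<phi> within {0..pi})"
    proof -
      have "((\<lambda>x. of_real s + \<i> * of_real (r * cos x)) has_vector_derivative (0 + \<i> * of_real (r * (- sin \<phi>)))) (at \<phi> within {0..pi})"
        by (intro has_vector_derivative_add has_vector_derivative_const has_vector_derivative_mult_right
          has_vector_derivative_of_real[unfolded has_real_derivative_iff_has_vector_derivative] DERIV_cmult[THEN iffD1[OF has_real_derivative_iff_has_vector_derivative]])
          (auto intro!: derivative_eq_intros)
      then show ?thesis by (simp add: \<zeta>_def laplace_point_def[abs_def] r_def S_def mult.assoc)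
    qed
    have zn: "((\<lambda>x. \<zeta> x ^ n) has_vector_derivative (of_nat n * z ^ (n - 1) * (- (\<i> * of_real r * S)))) (at \<phi> within {0..pi})"
    proof -
      have "((\<lambda>z. z ^ n) has_field_derivative (of_nat n * z ^ (n - 1))) (at (\<zeta> \<phi>) within \<zeta> ` {0..pi})"
        using DERIV_power[OF DERIV_ident, where n = n] by (simp add: z_def)
      from field_vector_diff_chain_within[OF \<zeta>' this]
      show ?thesis by (simp add: o_def mult.commute)
    qed
    have sn: "((\<lambda>x. of_real (sin x ^ Suc m)) has_vector_derivative (of_nat (Suc m) * S ^ m * c)) (at \<phi> within {0..pi})"
    proof -
      have "((\<lambda>x. sin x ^ Suc m) has_real_derivative (real (Suc m) * sin \<phi> ^ m * cos \<phi>)) (at \<phi> within {0..pi})"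
        by (rule has_field_derivative_at_within, rule DERIV_cong[OF DERIV_power[OF DERIV_sin, where n = "Suc m"]])
          (simp add: mult_ac)
      from has_vector_derivative_of_real[OF this]
      show ?thesis by (simp add: S_def c_def)
    qed
    have "(F has_vector_derivative \<i> * of_real r * (z ^ n * (of_nat (Suc m) * S ^ m * c) +
        (of_nat n * z ^ (n - 1) * (- (\<i> * of_real r * S))) * S ^ Suc m)) (at \<phi> within {0..pi})"
      unfolding F_def
      using has_vector_derivative_mult_right[OF has_vector_derivative_mult[OF zn sn], of "\<i> * of_real r"]
      by (simp add: z_def S_def)
    moreover have "\<i> * of_real r * (z ^ n * (of_nat (Suc m) * S ^ m * c) +
        (of_nat n * z ^ (n - 1) * (- (\<i> * of_real r * S))) * S ^ Suc m) = F' \<phi>"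
    proof -
      \<comment> \<open>\<open>irc\<close> and \<open>rS\<close> eliminate the angle: i r cos \<phi>
        and (r sin \<phi>)^2 become polynomials in z and s, so the comparison with \<open>F'\<close>
        is a ring identity.\<close>
      have irc: "\<i> * of_real r * c = z - of_real s" by (simp add: z)
      have rr: "(of_real r)\<^sup>2 = 1 - (of_real s :: complex)\<^sup>2" using arg_cong[OF r, of complex_of_real] by simp
      have "(of_real r)\<^sup>2 * S\<^sup>2 = (1 - (of_real s)\<^sup>2) * (1 - c\<^sup>2)"
        unfolding rr using Sc by (simp add: eq_diff_eq)
      also have "\<dots> = (1 - (of_real s)\<^sup>2) + (z - of_real s)\<^sup>2"
        unfolding zs by (simp add: algebra_simps)
      finally have rS: "(of_real r)\<^sup>2 * S\<^sup>2 = 1 - 2 * of_real s * z + z\<^sup>2"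
        by (simp add: power2_diff)
      have "\<i> * of_real r * (z ^ n * (of_nat (Suc m) * S ^ m * c) +
        (of_nat n * z ^ (n - 1) * (- (\<i> * of_real r * S))) * S ^ Suc m) =
        S ^ m * (of_nat (Suc m) * z ^ n * (\<i> * of_real r * c) + of_nat n * z ^ (n - 1) * ((of_real r)\<^sup>2 * S\<^sup>2))"
      proof -
        have "R * (Zn * (M * Sm * c) + (N * Z' * (- (R * S))) * (S * Sm)) =
          Sm * (M * Zn * (R * c) + N * Z' * (- (R * R) * S\<^sup>2))" for R Zn M Sm N Z' :: complex
          by algebra
        moreover have "- ((\<i> * of_real r) * (\<i> * of_real r)) = (of_real r :: complex)\<^sup>2"
          using i_squared by algebra
        ultimately show ?thesis by (simp only: power_Suc)
      qed
      also have "\<dots> = F' \<phi>"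
      proof (cases n)
        case (Suc k)
        have "Sm * ((M + 1) * (z * zk) * (z - s) + (K + 1) * zk * (1 - 2 * s * z + z\<^sup>2)) =
          Sm * ((K + M + 2) * (z * (z * zk)) - (2 * K + M + 3) * s * (z * zk) + (K + 1) * zk)" for Sm M K zk s :: complex
          by algebra
        note * = this[of "S ^ m" "of_nat m" "z ^ k" "of_real s" "of_nat k"]
        have "complex_of_nat (Suc m) = of_nat m + 1" "complex_of_nat (Suc k) = of_nat k + 1"
          "complex_of_nat (Suc k + m + 1) = of_nat k + of_nat m + 2"
          "complex_of_real (real (2 * Suc k + m + 1) * s) = (2 * of_nat k + of_nat m + 3) * of_real s"
          "complex_of_real (sin \<phi> ^ m) = S ^ m"
          by (simp_all add: S_def)
        then show ?thesis
          unfolding irc rS F'_def z_def[symmetric] Suc using * by (simp only: power_Suc diff_Suc_1)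
      next
        case 0
        show ?thesis
          unfolding irc rS F'_def z_def[symmetric] 0 by (simp add: S_def algebra_simps)
      qed
      finally show ?thesis .
    qed
    ultimately show ?thesis by (rule has_vector_derivative_eq_rhs)
  qed
  then have "(F' has_integral (F pi - F 0)) {0..pi}"
    by (intro fundamental_theorem_of_calculus) auto
  then show ?thesis by (simp add: F_def F'_def[abs_def])
qed

text \<open>With m = d - 2 the integrals satisfy the recurrence that defines
  \<open>zonal_poly\<close>. Its instance n = 0, whose lower term has coefficient 0, gives the
  second starting value I(1) = s I(0).\<close>

lemma laplace_integral_zonal_poly:
  assumes "2 \<le> d" and s: "\<bar>s\<bar> \<le> 1"
  shows "((\<lambda>\<phi>. of_real (sin \<phi> ^ (d - 2)) * laplace_point s \<phi> ^ n) has_integral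
    of_real (integral {0..pi} (\<lambda>\<phi>. sin \<phi> ^ (d - 2)) * poly (zonal_poly d n) s)) {0..pi}"
proof -
  obtain m where m: "d = m + 2" using assms(1) by (metis add.commute le_iff_add)
  define I where "I n = integral {0..pi} (\<lambda>\<phi>. of_real (sin \<phi> ^ m) * laplace_point s \<phi> ^ n)" for n
  have hI: "((\<lambda>\<phi>. of_real (sin \<phi> ^ m) * laplace_point s \<phi> ^ n) has_integral I n) {0..pi}" for n
    unfolding I_def by (intro integrable_integral integrable_continuous_real continuous_intros)
  have rec: "of_nat (n + m + 1) * I (Suc n) = of_real (real (2 * n + m + 1) * s) * I n - of_nat n * I (n - 1)" for n
  proof -
    have "((\<lambda>\<phi>. of_nat (n + m + 1) * (of_real (sin \<phi> ^ m) * laplace_point s \<phi> ^ Suc n)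
       - of_real (real (2 * n + m + 1) * s) * (of_real (sin \<phi> ^ m) * laplace_point s \<phi> ^ n)
       + of_nat n * (of_real (sin \<phi> ^ m) * laplace_point s \<phi> ^ (n - 1))) has_integral
       (of_nat (n + m + 1) * I (Suc n) - of_real (real (2 * n + m + 1) * s) * I n + of_nat n * I (n - 1))) {0..pi}"
      by (intro has_integral_add has_integral_diff has_integral_mult_right hI)
    moreover have "((\<lambda>\<phi>. of_nat (n + m + 1) * (of_real (sin \<phi> ^ m) * laplace_point s \<phi> ^ Suc n)
       - of_real (real (2 * n + m + 1) * s) * (of_real (sin \<phi> ^ m) * laplace_point s \<phi> ^ n)
       + of_nat n * (of_real (sin \<phi> ^ m) * laplace_point s \<phi> ^ (n - 1))) has_integral 0) {0..pi}"
      by (rule has_integral_eq[OF _ laplace_integral_rec[OF s, of m n]]) (simp add: algebra_simps)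
    ultimately have "of_nat (n + m + 1) * I (Suc n) - of_real (real (2 * n + m + 1) * s) * I n + of_nat n * I (n - 1) = 0"
      by (rule has_integral_unique)
    then show ?thesis by (simp add: algebra_simps add_eq_0_iff2)
  qed
  define c where "c = integral {0..pi} (\<lambda>\<phi>. sin \<phi> ^ m)"
  have I0: "I 0 = of_real c"
  proof -
    have "((\<lambda>\<phi>. sin \<phi> ^ m) has_integral c) {0..pi}"
      unfolding c_def by (intro integrable_integral integrable_continuous_real continuous_intros)
    from has_integral_of_real[OF this] have "((\<lambda>\<phi>. complex_of_real (sin \<phi> ^ m)) has_integral of_real c) {0..pi}" .
    then show ?thesis using hI[of 0] by (simp add: has_integral_unique)
  qed
  have "I n = of_real (c * poly (zonal_poly d n) s) \<and> I (Suc n) = of_real (c * poly (zonal_poly d (Suc n)) s)"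
  proof (induction n)
    case 0
    have "of_nat (m + 1) * I (Suc 0) = of_nat (m + 1) * (of_real s * I 0)"
      using rec[of 0] by simp
    then have "I (Suc 0) = of_real s * I 0"
      by (simp only: mult_cancel_left of_nat_eq_0_iff) simp
    then show ?case by (simp add: I0)
  next
    case (Suc n)
    have "of_nat (n + m + 2) * I (Suc (Suc n)) =
        of_real (real (2 * n + m + 3) * s) * I (Suc n) - of_nat (n + 1) * I n"
      using rec[of "Suc n"] by (simp add: algebra_simps)
    also have "\<dots> = of_real (c * (real (2 * n + m + 3) * (s * poly (zonal_poly d (Suc n)) s) - real (n + 1) * poly (zonal_poly d n) s))"
      using Suc by (simp add: algebra_simps)
    also have "real (2 * n + m + 3) * (s * poly (zonal_poly d (Suc n)) s) - real (n + 1) * poly (zonal_poly d n) s =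
        real (n + m + 2) * poly (zonal_poly d (Suc (Suc n))) s"
    proof -
      have "poly (of_nat (n + d) * zonal_poly d (Suc (Suc n))) s =
          poly (of_nat (2 * n + d + 1) * ([:0, 1:] * zonal_poly d (Suc n)) - of_nat (n + 1) * zonal_poly d n) s"
        using assms(1) by (subst zonal_poly_rec) auto
      then show ?thesis by (simp add: m of_nat_poly del: zonal_poly.simps)
    qed
    finally have "of_nat (n + m + 2) * I (Suc (Suc n)) =
        of_nat (n + m + 2) * of_real (c * poly (zonal_poly d (Suc (Suc n))) s)"
      by (simp only: of_real_mult of_real_of_nat_eq mult_ac)
    then have "I (Suc (Suc n)) = of_real (c * poly (zonal_poly d (Suc (Suc n))) s)"
      by (simp only: mult_cancel_left of_nat_eq_0_iff) simp
    then show ?case using Suc by simp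
  qed
  then show ?thesis using hI[of n] by (simp add: m c_def)
qed

lemma integral_sin_power_pos: "0 < integral {0..pi} (\<lambda>\<phi>. sin \<phi> ^ m)"
proof -
  have "0 \<le> integral {0..pi} (\<lambda>\<phi>. sin \<phi> ^ m)"
    by (intro integral_nonneg integrable_continuous_real continuous_intros) (auto intro: sin_ge_zero zero_le_power)
  moreover have "integral {0..pi} (\<lambda>\<phi>. sin \<phi> ^ m) \<noteq> 0"
  proof
    assume "integral {0..pi} (\<lambda>\<phi>. sin \<phi> ^ m) = 0"
    then have "\<forall>\<phi>\<in>{0..pi}. sin \<phi> ^ m = 0"
      by (subst (asm) integral_eq_0_iff) (auto intro!: continuous_intros sin_ge_zero zero_le_power)
    then show False by (auto dest!: bspec[of _ _ "pi / 2"])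
  qed
  ultimately show ?thesis by linarith
qed

text \<open>The weight sin^(d-2) is nonnegative on [0, \<pi>] and has total mass \<open>v\<close> >
  0, so Laplace's integral is an average over points of the disc and cannot exceed a bound valid
  there.\<close>

lemma zonal_sum_bound:
  fixes c :: "nat \<Rightarrow> complex"
  assumes "2 \<le> d" and s: "\<bar>s\<bar> \<le> 1" and B: "\<And>z. norm z \<le> 1 \<Longrightarrow> norm (\<Sum>n\<in>A. c n * z ^ n) \<le> B"
  shows "norm (\<Sum>n\<in>A. c n * of_real (poly (zonal_poly d n) s)) \<le> B"
proof -
  define v where "v = integral {0..pi} (\<lambda>\<phi>. sin \<phi> ^ (d - 2))"
  have v: "0 < v" unfolding v_def by (rule integral_sin_power_pos)
  have vi: "((\<lambda>\<phi>. sin \<phi> ^ (d - 2)) has_integral v) {0..pi}"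
    unfolding v_def by (intro integrable_integral integrable_continuous_real continuous_intros)
  have "((\<lambda>\<phi>. \<Sum>n\<in>A. c n * (of_real (sin \<phi> ^ (d - 2)) * laplace_point s \<phi> ^ n)) has_integral
     (\<Sum>n\<in>A. c n * of_real (v * poly (zonal_poly d n) s))) {0..pi}" if "finite A"
    unfolding v_def using that
    by (intro has_integral_sum has_integral_mult_right laplace_integral_zonal_poly assms)
  moreover have "(\<Sum>n\<in>A. c n * (of_real (sin \<phi> ^ (d - 2)) * laplace_point s \<phi> ^ n)) =
      of_real (sin \<phi> ^ (d - 2)) * (\<Sum>n\<in>A. c n * laplace_point s \<phi> ^ n)" for \<phi>
    by (simp add: sum_distrib_left mult_ac)
  moreover have "(\<Sum>n\<in>A. c n * of_real (v * poly (zonal_poly d n) s)) = of_real v * (\<Sum>n\<in>A. c n * of_real (poly (zonal_poly d n) s))"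
    by (simp add: sum_distrib_left mult_ac)
  ultimately have I: "((\<lambda>\<phi>. of_real (sin \<phi> ^ (d - 2)) * (\<Sum>n\<in>A. c n * laplace_point s \<phi> ^ n)) has_integral
     of_real v * (\<Sum>n\<in>A. c n * of_real (poly (zonal_poly d n) s))) {0..pi}" if "finite A"
    using that by simp
  show ?thesis
  proof (cases "finite A")
    case True
    have "norm (of_real v * (\<Sum>n\<in>A. c n * of_real (poly (zonal_poly d n) s))) \<le> integral {0..pi} (\<lambda>\<phi>. sin \<phi> ^ (d - 2) * B)"
      unfolding integral_unique[OF I[OF True], symmetric]
    proof (rule integral_norm_bound_integral)
      show "(\<lambda>\<phi>. of_real (sin \<phi> ^ (d - 2)) * (\<Sum>n\<in>A. c n * laplace_point s \<phi> ^ n)) integrable_on {0..pi}"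
        using I[OF True] by (rule has_integral_integrable)
      show "(\<lambda>\<phi>. sin \<phi> ^ (d - 2) * B) integrable_on {0..pi}"
        by (intro integrable_continuous_real continuous_intros)
      fix \<phi> assume "\<phi> \<in> {0..pi}"
      then have "0 \<le> sin \<phi>" by (auto intro: sin_ge_zero)
      then show "norm (of_real (sin \<phi> ^ (d - 2)) * (\<Sum>n\<in>A. c n * laplace_point s \<phi> ^ n)) \<le> sin \<phi> ^ (d - 2) * B"
        by (simp add: norm_mult norm_power mult_left_mono B norm_laplace_point_le_1[OF s])
    qed
    also have "\<dots> = v * B"
      using integral_unique[OF has_integral_mult_left[OF vi, of B]] by simp
    finally show ?thesis using v by (simp add: norm_mult)
  next
    case False
    \<comment> \<open>A sum over an infinite index set is 0 by convention, and the hypothesis at one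
      point of the disc gives 0 \<le> B.\<close>
    then show ?thesis using B[of 0] by simp
  qed
qed

text \<open>For the same angle \<phi> the Laplace points of s and s' are at distance at most \<eta>,
  so the Lipschitz bound in the disc survives averaging over \<phi>.\<close>

lemma zonal_sum_lipschitz:
  fixes c :: "nat \<Rightarrow> complex"
  assumes "2 \<le> d" and s: "\<bar>s\<bar> \<le> 1" "\<bar>s'\<bar> \<le> 1" and "0 \<le> B"
    and B: "\<And>z w. norm z \<le> 1 \<Longrightarrow> norm w \<le> 1 \<Longrightarrow>
      norm ((\<Sum>n\<in>A. c n * z ^ n) - (\<Sum>n\<in>A. c n * w ^ n)) \<le> B * norm (z - w)"
    and "finite A"
  shows "norm ((\<Sum>n\<in>A. c n * of_real (poly (zonal_poly d n) s)) - (\<Sum>n\<in>A. c n * of_real (poly (zonal_poly d n) s')))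
     \<le> B * (\<bar>s - s'\<bar> + \<bar>sqrt (1 - s\<^sup>2) - sqrt (1 - s'\<^sup>2)\<bar>)"
proof -
  define v where "v = integral {0..pi} (\<lambda>\<phi>. sin \<phi> ^ (d - 2))"
  define \<eta> where "\<eta> = \<bar>s - s'\<bar> + \<bar>sqrt (1 - s\<^sup>2) - sqrt (1 - s'\<^sup>2)\<bar>"
  define P where "P z = (\<Sum>n\<in>A. c n * z ^ n)" for z
  define Q where "Q s = (\<Sum>n\<in>A. c n * of_real (poly (zonal_poly d n) s))" for s
  have v: "0 < v" unfolding v_def by (rule integral_sin_power_pos)
  have vi: "((\<lambda>\<phi>. sin \<phi> ^ (d - 2)) has_integral v) {0..pi}"
    unfolding v_def by (intro integrable_integral integrable_continuous_real continuous_intros)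
  have I: "((\<lambda>\<phi>. of_real (sin \<phi> ^ (d - 2)) * P (laplace_point s \<phi>)) has_integral of_real v * Q s) {0..pi}"
    if "\<bar>s\<bar> \<le> 1" for s
  proof -
    have "((\<lambda>\<phi>. \<Sum>n\<in>A. c n * (of_real (sin \<phi> ^ (d - 2)) * laplace_point s \<phi> ^ n)) has_integral
       (\<Sum>n\<in>A. c n * of_real (v * poly (zonal_poly d n) s))) {0..pi}"
      unfolding v_def using \<open>finite A\<close>
      by (intro has_integral_sum has_integral_mult_right laplace_integral_zonal_poly assms that)
    then show ?thesis by (simp add: P_def Q_def sum_distrib_left mult_ac)
  qed
  have dist: "norm (laplace_point s \<phi> - laplace_point s' \<phi>) \<le> \<eta>" for \<phi>
  proof -
    have "laplace_point s \<phi> - laplace_point s' \<phi> =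
        of_real (s - s') + \<i> * of_real ((sqrt (1 - s\<^sup>2) - sqrt (1 - s'\<^sup>2)) * cos \<phi>)"
      by (simp add: laplace_point_def algebra_simps)
    also have "norm \<dots> \<le> \<bar>s - s'\<bar> + \<bar>sqrt (1 - s\<^sup>2) - sqrt (1 - s'\<^sup>2)\<bar> * \<bar>cos \<phi>\<bar>"
      by (rule order_trans[OF norm_triangle_ineq]) (simp only: norm_mult norm_ii norm_of_real abs_mult mult_1 order_refl)
    also have "\<dots> \<le> \<eta>"
      unfolding \<eta>_def by (intro add_left_mono mult_left_le) auto
    finally show ?thesis .
  qed
  have D: "((\<lambda>\<phi>. of_real (sin \<phi> ^ (d - 2)) * P (laplace_point s \<phi>) - of_real (sin \<phi> ^ (d - 2)) * P (laplace_point s' \<phi>))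
      has_integral of_real v * Q s - of_real v * Q s') {0..pi}"
    by (intro has_integral_diff I s)
  have "norm (of_real v * Q s - of_real v * Q s') \<le> integral {0..pi} (\<lambda>\<phi>. sin \<phi> ^ (d - 2) * (B * \<eta>))"
    unfolding integral_unique[OF D, symmetric]
  proof (rule integral_norm_bound_integral)
    show "(\<lambda>\<phi>. of_real (sin \<phi> ^ (d - 2)) * P (laplace_point s \<phi>) - of_real (sin \<phi> ^ (d - 2)) * P (laplace_point s' \<phi>)) integrable_on {0..pi}"
      using D by (rule has_integral_integrable)
    show "(\<lambda>\<phi>. sin \<phi> ^ (d - 2) * (B * \<eta>)) integrable_on {0..pi}"
      by (intro integrable_continuous_real continuous_intros)
    fix \<phi> assume "\<phi> \<in> {0..pi}"
    then have "0 \<le> sin \<phi>" by (auto intro: sin_ge_zero)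
    have "norm (P (laplace_point s \<phi>) - P (laplace_point s' \<phi>)) \<le> B * norm (laplace_point s \<phi> - laplace_point s' \<phi>)"
      unfolding P_def by (intro B norm_laplace_point_le_1 s)
    also have "\<dots> \<le> B * \<eta>" using dist \<open>0 \<le> B\<close> by (intro mult_left_mono) auto
    finally show "norm (of_real (sin \<phi> ^ (d - 2)) * P (laplace_point s \<phi>) - of_real (sin \<phi> ^ (d - 2)) * P (laplace_point s' \<phi>))
       \<le> sin \<phi> ^ (d - 2) * (B * \<eta>)"
      unfolding right_diff_distrib[symmetric] norm_mult using \<open>0 \<le> sin \<phi>\<close> by (simp add: norm_power mult_left_mono)
  qed
  also have "\<dots> = v * (B * \<eta>)"
    using integral_unique[OF has_integral_mult_left[OF vi, of "B * \<eta>"]] by simp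
  finally have "v * norm (Q s - Q s') \<le> v * (B * \<eta>)"
    using v by (simp add: norm_mult flip: right_diff_distrib)
  then show ?thesis using v by (simp add: Q_def \<eta>_def)
qed

section \<open>Functions on the sphere with vanishing moments\<close>

text \<open>Exponentials of linear forms are closed under products, whereas a product of powers of
  two different linear forms is not such a power. This gives an algebra for Stone-Weierstrass whose
  integrals still reduce to the moments by the exponential series.\<close>

inductive exponential_sum :: "('a::euclidean_space \<Rightarrow> real) \<Rightarrow> bool" where
  exp: "exponential_sum (\<lambda>x. c * exp (x \<bullet> w))"
| add: "exponential_sum f \<Longrightarrow> exponential_sum g \<Longrightarrow> exponential_sum (\<lambda>x. f x + g x)"

lemma exponential_sum_continuous: "exponential_sum f \<Longrightarrow> continuous_on A f"
  by (induction rule: exponential_sum.induct) (auto intro!: continuous_intros)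

lemma exponential_sum_mult_exp:
  "exponential_sum f \<Longrightarrow> exponential_sum (\<lambda>x. f x * (c * exp (x \<bullet> w)))"
proof (induction rule: exponential_sum.induct)
  case (exp b v)
  have "(\<lambda>x. b * exp (x \<bullet> v) * (c * exp (x \<bullet> w))) = (\<lambda>x. b * c * exp (x \<bullet> (v + w)))"
    by (auto simp: inner_add_right exp_add mult_ac)
  then show ?case by (simp only: exponential_sum.exp)
next
  case (add f g)
  then show ?case by (simp only: distrib_right exponential_sum.add)
qed

lemma exponential_sum_mult:
  assumes g: "exponential_sum g" and f: "exponential_sum f"
  shows "exponential_sum (\<lambda>x. f x * g x)"
  using g
proof (induction rule: exponential_sum.induct)
  case (exp b v)
  then show ?case using exponential_sum_mult_exp[OF f] .
next
  case (add g h)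
  then show ?case by (simp only: distrib_left exponential_sum.add)
qed

lemma integrable_times_continuous_surface:
  fixes v :: "'a::euclidean_space \<Rightarrow> complex"
  assumes v: "integrable surface_measure v" and \<phi>: "continuous_on (sphere 0 1) \<phi>"
  shows "integrable surface_measure (\<lambda>x. v x * of_real (\<phi> x))"
proof -
  have "bounded (\<phi> ` sphere 0 1)"
    using \<phi> by (intro compact_imp_bounded compact_continuous_image) auto
  then obtain B where B: "\<And>x. x \<in> sphere 0 1 \<Longrightarrow> \<bar>\<phi> x\<bar> \<le> B"
    unfolding bounded_iff by force
  have "integrable surface_measure (\<lambda>x. B * norm (v x))"
    using v by simp
  then show ?thesis
  proof (rule Bochner_Integration.integrable_bound)
    have "(\<lambda>x. complex_of_real (\<phi> x)) \<in> borel_measurable surface_measure"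
      using \<phi> by (intro borel_measurable_surface_measure continuous_intros)
    then show "(\<lambda>x. v x * of_real (\<phi> x)) \<in> borel_measurable surface_measure"
      using v by (intro borel_measurable_times) auto
    show "AE x in surface_measure. norm (v x * of_real (\<phi> x)) \<le> norm (B * norm (v x))"
    proof (rule AE_I2)
      fix x :: 'a assume "x \<in> space surface_measure"
      then have "\<bar>\<phi> x\<bar> \<le> B" by (intro B) simp
      then have "norm (v x) * \<bar>\<phi> x\<bar> \<le> norm (v x) * \<bar>B\<bar>"
        by (intro mult_left_mono) auto
      then show "norm (v x * of_real (\<phi> x)) \<le> norm (B * norm (v x))"
        by (simp add: norm_mult abs_mult mult.commute)
    qed
  qed
qed

context
  fixes v :: "'a::euclidean_space \<Rightarrow> complex"
  assumes v: "integrable surface_measure v"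
    and moments: "\<And>w k. (\<integral>x. v x * of_real ((x \<bullet> w) ^ k) \<partial>surface_measure) = 0"
begin

text \<open>On the unit sphere all partial sums of the exponential series are bounded by exp(|w|),
  so the series may be integrated term by term against \<open>v\<close>.\<close>

lemma integral_exp_zero: "(\<integral>x. v x * of_real (exp (x \<bullet> w)) \<partial>surface_measure) = 0"
proof -
  define s where "s n x = (\<Sum>k<n. (x \<bullet> w) ^ k / fact k)" for n x
  have sc: "continuous_on A (s n)" for A n
    unfolding s_def by (intro continuous_intros) auto
  have zero: "(\<integral>x. v x * of_real (s n x) \<partial>surface_measure) = 0" for n
  proof -
    have "(\<integral>x. v x * of_real (s n x) \<partial>surface_measure) =
       (\<integral>x. (\<Sum>k<n. (1 / fact k) * (v x * of_real ((x \<bullet> w) ^ k))) \<partial>surface_measure)"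
      by (rule Bochner_Integration.integral_cong) (auto simp: s_def sum_distrib_left field_simps)
    also have "\<dots> = (\<Sum>k<n. (1 / fact k) * (\<integral>x. v x * of_real ((x \<bullet> w) ^ k) \<partial>surface_measure))"
      unfolding integral_mult_right_zero[symmetric]
      by (intro Bochner_Integration.integral_sum integrable_mult_right
        integrable_times_continuous_surface[OF v] continuous_intros)
    finally show ?thesis by (simp add: moments del: of_real_power)
  qed
  have "(\<lambda>n. \<integral>x. v x * of_real (s n x) \<partial>surface_measure) \<longlonglongrightarrow> (\<integral>x. v x * of_real (exp (x \<bullet> w)) \<partial>surface_measure)"
  proof (rule integral_dominated_convergence[where w = "\<lambda>x. exp (norm w) * norm (v x)"])
    show "(\<lambda>x. v x * of_real (exp (x \<bullet> w))) \<in> borel_measurable surface_measure"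
      by (intro borel_measurable_integrable integrable_times_continuous_surface[OF v] continuous_intros)
    show "(\<lambda>x. v x * of_real (s n x)) \<in> borel_measurable surface_measure" for n
      by (intro borel_measurable_integrable integrable_times_continuous_surface[OF v] sc)
    show "integrable surface_measure (\<lambda>x. exp (norm w) * norm (v x))"
      using v by simp
    have "(\<lambda>n. s n x) \<longlonglongrightarrow> exp (x \<bullet> w)" for x
      using exp_converges[of "x \<bullet> w"] by (simp add: sums_def s_def divide_inverse mult.commute)
    then show "AE x in surface_measure. (\<lambda>n. v x * of_real (s n x)) \<longlonglongrightarrow> v x * of_real (exp (x \<bullet> w))"
      by (intro AE_I2 tendsto_intros)
    have "\<bar>s n x\<bar> \<le> exp (norm w)" if "norm x = 1" for n x
    proof -
      have xw: "\<bar>x \<bullet> w\<bar> \<le> norm w"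
        using Cauchy_Schwarz_ineq2[of x w] that by simp
      have "\<bar>s n x\<bar> \<le> (\<Sum>k<n. norm w ^ k /\<^sub>R fact k)"
        unfolding s_def
        by (rule order_trans[OF sum_abs], rule sum_mono)
          (auto simp: power_abs divide_inverse abs_mult mult.commute intro!: mult_left_mono power_mono xw)
      also have "\<dots> \<le> (\<Sum>k. norm w ^ k /\<^sub>R fact k)"
        using exp_converges[of "norm w"] by (intro sum_le_suminf) (auto simp: sums_iff)
      also have "\<dots> = exp (norm w)"
        using exp_converges[of "norm w"] by (simp add: sums_iff)
      finally show ?thesis .
    qed
    then show "AE x in surface_measure. norm (v x * of_real (s n x)) \<le> exp (norm w) * norm (v x)" for n
      by (intro AE_I2) (auto simp: norm_mult mult.commute[of "norm (v _)"] intro!: mult_right_mono)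
  qed
  then show ?thesis by (simp add: zero LIMSEQ_const_iff)
qed

lemma integral_exponential_sum_zero:
  "exponential_sum f \<Longrightarrow> (\<integral>x. v x * of_real (f x) \<partial>surface_measure) = 0"
proof (induction rule: exponential_sum.induct)
  case (exp c w)
  have "(\<integral>x. v x * of_real (c * exp (x \<bullet> w)) \<partial>surface_measure) = (\<integral>x. of_real c * (v x * of_real (exp (x \<bullet> w))) \<partial>surface_measure)"
    by (rule Bochner_Integration.integral_cong) auto
  then show ?case by (simp add: integral_exp_zero del: of_real_exp)
next
  case (add f g)
  have "(\<integral>x. v x * of_real (f x + g x) \<partial>surface_measure) =
      (\<integral>x. v x * of_real (f x) + v x * of_real (g x) \<partial>surface_measure)"
    by (rule Bochner_Integration.integral_cong) (auto simp: distrib_left)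
  then show ?case
    using add by (simp add: integrable_times_continuous_surface[OF v] exponential_sum_continuous)
qed

text \<open>Stone-Weierstrass: exponential sums contain the constants (w = 0) and separate the
  points of the sphere, so they approximate \<phi> uniformly; the error in the integral is at most e
  times the L1 norm of \<open>v\<close>.\<close>

lemma integral_continuous_zero:
  assumes \<phi>: "continuous_on (sphere 0 1) \<phi>"
  shows "(\<integral>x. v x * of_real (\<phi> x) \<partial>surface_measure) = 0"
proof -
  define V where "V = (\<integral>x. norm (v x) \<partial>surface_measure)"
  have V: "0 \<le> V" by (simp add: V_def)
  have "norm (\<integral>x. v x * of_real (\<phi> x) \<partial>surface_measure) \<le> e * V" if e: "0 < e" for e
  proof -
    have "\<exists>g. exponential_sum g \<and> (\<forall>x\<in>sphere 0 1. \<bar>\<phi> x - g x\<bar> < e)"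
    proof (rule Stone_Weierstrass_HOL[OF _ _ _ _ _ _ \<phi> e])
      show "exponential_sum (\<lambda>x::'a. c)" for c
        using exponential_sum.exp[of c 0] by simp
      fix x y :: 'a assume "x \<in> sphere 0 1 \<and> y \<in> sphere 0 1 \<and> x \<noteq> y"
      \<comment> \<open>The direction x - y separates x from y.\<close>
      then have "(x - y) \<bullet> (x - y) \<noteq> 0" by simp
      then have "x \<bullet> (x - y) \<noteq> y \<bullet> (x - y)" by (simp add: inner_diff_left)
      then show "\<exists>f. exponential_sum f \<and> f x \<noteq> f y"
        by (intro exI[of _ "\<lambda>z. 1 * exp (z \<bullet> (x - y))"] conjI exponential_sum.exp) simp
    qed (auto intro: exponential_sum.add exponential_sum_mult exponential_sum_continuous)
    then obtain g where g: "exponential_sum g" "\<And>x. x \<in> sphere 0 1 \<Longrightarrow> \<bar>\<phi> x - g x\<bar> < e" by blast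
    have gi: "integrable surface_measure (\<lambda>x. v x * of_real (g x))"
      by (intro integrable_times_continuous_surface[OF v] exponential_sum_continuous g)
    have "(\<integral>x. v x * of_real (\<phi> x) \<partial>surface_measure) = (\<integral>x. v x * of_real (\<phi> x) - v x * of_real (g x) \<partial>surface_measure)"
      by (subst Bochner_Integration.integral_diff)
        (simp_all add: gi integrable_times_continuous_surface[OF v \<phi>] integral_exponential_sum_zero[OF g(1)])
    also have "norm \<dots> \<le> (\<integral>x. norm (v x * of_real (\<phi> x) - v x * of_real (g x)) \<partial>surface_measure)"
      by (rule integral_norm_bound)
    also have "\<dots> \<le> (\<integral>x. e * norm (v x) \<partial>surface_measure)"
    proof (rule integral_mono)
      fix x :: 'a assume "x \<in> space surface_measure"
      then have "\<bar>\<phi> x - g x\<bar> \<le> e" using g(2)[of x] by simp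
      then have "norm (v x) * \<bar>\<phi> x - g x\<bar> \<le> norm (v x) * e" by (intro mult_left_mono) auto
      then show "norm (v x * of_real (\<phi> x) - v x * of_real (g x)) \<le> e * norm (v x)"
        by (simp add: norm_mult mult.commute flip: right_diff_distrib of_real_diff)
    qed (use v gi integrable_times_continuous_surface[OF v \<phi>] in auto)
    also have "\<dots> = e * V" by (simp add: V_def)
    finally show ?thesis .
  qed
  then have "norm (\<integral>x. v x * of_real (\<phi> x) \<partial>surface_measure) \<le> 0 + e" if "0 < e" for e
    using V that by (cases "V = 0") (auto dest!: spec[of _ "e / V"] meta_spec[of _ "e / V"] simp: divide_pos_pos less_le)
  then show ?thesis using field_le_epsilon[of _ 0] by (metis norm_le_zero_iff)
qed

lemma Int_sphere_in_sets_surface: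
  "B \<in> sets borel \<Longrightarrow> B \<inter> sphere 0 1 \<in> sets surface_measure"
  by (auto simp: sets_restrict_space Int_commute)

text \<open>The continuous functions max(0, 1 - n dist(x, B)) decrease to the indicator of a
  nonempty closed \<open>B\<close>, and \<open>norm (v x)\<close> dominates.\<close>

lemma integral_closed_zero:
  assumes "closed B"
  shows "(\<integral>x\<in>B \<inter> sphere 0 1. v x \<partial>surface_measure) = 0"
proof (cases "B = {}")
  case False
  define \<phi> where "\<phi> n x = max 0 (1 - real n * infdist x B)" for n x
  have \<phi>c: "continuous_on A (\<phi> n)" for A n
    unfolding \<phi>_def by (intro continuous_intros)
  have "(\<lambda>n. \<integral>x. v x * of_real (\<phi> n x) \<partial>surface_measure) \<longlonglongrightarrow> (\<integral>x\<in>B \<inter> sphere 0 1. v x \<partial>surface_measure)"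
    unfolding set_lebesgue_integral_def
  proof (rule integral_dominated_convergence[where w = "\<lambda>x. norm (v x)"])
    show "(\<lambda>x. v x * of_real (\<phi> n x)) \<in> borel_measurable surface_measure" for n
      by (intro borel_measurable_integrable integrable_times_continuous_surface[OF v] \<phi>c)
    have "B \<inter> sphere 0 1 \<in> sets surface_measure"
      using assms by (intro Int_sphere_in_sets_surface) simp
    then show "(\<lambda>x. indicator (B \<inter> sphere 0 1) x *\<^sub>R v x) \<in> borel_measurable surface_measure"
      using v by (intro borel_measurable_scaleR borel_measurable_indicator) auto
    show "AE x in surface_measure. norm (v x * of_real (\<phi> n x)) \<le> norm (v x)" for n
      by (intro AE_I2) (auto simp: norm_mult \<phi>_def infdist_nonneg intro!: mult_left_le)
    have "(\<lambda>n. \<phi> n x) \<longlonglongrightarrow> indicator B x" for x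
    proof (cases "x \<in> B")
      case True
      then show ?thesis by (simp add: \<phi>_def)
    next
      case False
      then have pos: "0 < infdist x B"
        using assms \<open>B \<noteq> {}\<close> in_closed_iff_infdist_zero[of B x] infdist_nonneg[of x B] by auto
      obtain N where N: "1 / infdist x B \<le> real N" using real_arch_simple by blast
      have "\<phi> n x = 0" if "N \<le> n" for n
      proof -
        have "1 / infdist x B \<le> real n" using N that by linarith
        then have "1 \<le> real n * infdist x B" using pos by (simp add: pos_divide_le_eq)
        then show ?thesis by (simp add: \<phi>_def)
      qed
      then have "\<forall>\<^sub>F n in sequentially. \<phi> n x = 0"
        using eventually_sequentially by blast
      then show ?thesis using False by (simp add: tendsto_eventually)
    qed
    then have "(\<lambda>n. v x * of_real (\<phi> n x)) \<longlonglongrightarrow> v x * of_real (indicator B x)" for x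
      by (intro tendsto_intros)
    then show "AE x in surface_measure. (\<lambda>n. v x * of_real (\<phi> n x)) \<longlonglongrightarrow> indicator (B \<inter> sphere 0 1) x *\<^sub>R v x"
      by (intro AE_I2) (auto simp: scaleR_conv_of_real mult.commute indicator_inter_arith)
  qed (use v in auto)
  then show ?thesis by (simp add: integral_continuous_zero \<phi>c LIMSEQ_const_iff)
qed (simp add: set_lebesgue_integral_def)

lemma set_integrable_surface:
  "B \<in> sets borel \<Longrightarrow> set_integrable surface_measure (B \<inter> sphere 0 1) v"
  unfolding set_integrable_def
  by (intro integrable_mult_indicator v Int_sphere_in_sets_surface)

text \<open>Closed sets are stable under intersection and generate the Borel sets, so the Dynkin
  argument extends the vanishing from them to all Borel sets.\<close>

lemma integral_borel_zero:
  assumes "B \<in> sets borel"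
  shows "(\<integral>x\<in>B \<inter> sphere 0 1. v x \<partial>surface_measure) = 0"
proof -
  have borel: "sigma_sets UNIV (Collect closed) = sets (borel :: 'a measure)"
    by (simp add: borel_eq_closed)
  have "Int_stable (Collect closed :: 'a set set)"
    by (auto simp: Int_stable_def)
  moreover have "Collect closed \<subseteq> Pow (UNIV :: 'a set)" by simp
  moreover have "B \<in> sigma_sets UNIV (Collect closed)"
    using assms by (simp add: borel)
  ultimately show ?thesis
  proof (induction rule: sigma_sets_induct_disjoint)
    case (basic A)
    then show ?case by (intro integral_closed_zero) simp
  next
    case (compl A)
    then have A: "A \<in> sets borel" by (simp add: borel)
    have "UNIV \<inter> sphere 0 1 = (A \<inter> sphere 0 1) \<union> ((UNIV - A) \<inter> sphere (0::'a) 1)" by auto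
    then have "(\<integral>x\<in>UNIV \<inter> sphere 0 1. v x \<partial>surface_measure) =
       (\<integral>x\<in>A \<inter> sphere 0 1. v x \<partial>surface_measure) + (\<integral>x\<in>(UNIV - A) \<inter> sphere 0 1. v x \<partial>surface_measure)"
      using A by (simp only:) (intro set_integral_Un set_integrable_surface, auto)
    moreover have "(\<integral>x\<in>UNIV \<inter> sphere 0 1. v x \<partial>surface_measure) = 0"
      by (rule integral_closed_zero) simp
    ultimately show ?case using compl by simp
  next
    case (union A)
    then have A: "A i \<in> sets borel" for i by (auto simp: borel)
    have "(\<integral>x\<in>(\<Union>i. A i \<inter> sphere 0 1). v x \<partial>surface_measure) = (\<Sum>i. \<integral>x\<in>A i \<inter> sphere 0 1. v x \<partial>surface_measure)"
    proof (rule lebesgue_integral_countable_add)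
      show "A i \<inter> sphere 0 1 \<in> sets surface_measure" for i
        using A by (rule Int_sphere_in_sets_surface)
      show "(A i \<inter> sphere 0 1) \<inter> (A j \<inter> sphere 0 1) = {}" if "i \<noteq> j" for i j
        using union(1) that by (auto simp: disjoint_family_on_def)
      have "set_integrable surface_measure ((\<Union>i. A i) \<inter> sphere 0 1) v"
        using A by (intro set_integrable_surface) auto
      moreover have "(\<Union>i. A i) \<inter> sphere 0 1 = (\<Union>i. A i \<inter> sphere 0 1)" by auto
      ultimately show "set_integrable surface_measure (\<Union>i. A i \<inter> sphere 0 1) v" by (simp only:)
    qed
    moreover have "(\<Union>i. A i) \<inter> sphere 0 1 = (\<Union>i. A i \<inter> sphere 0 1)" by auto
    ultimately show ?case by (simp only: union(3) suminf_zero)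
  qed (auto simp: set_lebesgue_integral_def)
qed

lemma AE_eq_zero_surface: "AE x in surface_measure. v x = 0"
proof (rule surface_measure.density_zero[OF v])
  fix A assume "A \<in> sets (surface_measure :: 'a measure)"
  then obtain B where "A = B \<inter> sphere 0 1" "B \<in> sets borel"
    by (auto simp: sets_restrict_space)
  then show "(\<integral>x\<in>A. v x \<partial>surface_measure) = 0"
    using integral_borel_zero by simp
qed

end

section \<open>Moments of weak solutions\<close>

text \<open>This class contains the degree-0 extensions of the test powers and is closed under
  directional derivatives away from 0, so one induction settles smoothness of every order.\<close>

inductive radially_rational :: "('a::euclidean_space \<Rightarrow> real) \<Rightarrow> bool" where
  const: "radially_rational (\<lambda>x. c)"
| inner: "radially_rational (\<lambda>x. x \<bullet> w)"
| inverse_norm: "radially_rational (\<lambda>x. inverse (norm x))"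
| add: "radially_rational F \<Longrightarrow> radially_rational G \<Longrightarrow> radially_rational (\<lambda>x. F x + G x)"
| mult: "radially_rational F \<Longrightarrow> radially_rational G \<Longrightarrow> radially_rational (\<lambda>x. F x * G x)"

lemma radially_rational_power: "radially_rational F \<Longrightarrow> radially_rational (\<lambda>x. F x ^ k)"
  by (induction k) (auto intro: radially_rational.intros)

lemma has_derivative_inverse_norm:
  fixes x :: "'a::euclidean_space"
  assumes "x \<noteq> 0"
  shows "((\<lambda>x. inverse (norm x)) has_derivative (\<lambda>v. - (x \<bullet> v) * inverse (norm x) ^ 3)) (at x)"
proof -
  have "((\<lambda>x. inverse (norm x)) has_derivative (\<lambda>v. - (inverse (norm x) * (v \<bullet> sgn x) * inverse (norm x)))) (at x)"
    using assms by (auto intro!: derivative_eq_intros has_derivative_norm)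
  then show ?thesis
    by (rule has_derivative_eq_rhs)
      (auto simp: sgn_div_norm inner_commute power3_eq_cube divide_inverse fun_eq_iff)
qed

lemma radially_rational_derivative:
  assumes "radially_rational F"
  shows "\<exists>F'. (\<forall>x. x \<noteq> 0 \<longrightarrow> (F has_derivative F' x) (at x)) \<and> (\<forall>v. radially_rational (\<lambda>x. F' x v))"
  using assms
proof induction
  case (const c)
  show ?case
    by (rule exI[of _ "\<lambda>x v. 0"]) (auto intro: radially_rational.intros)
next
  case (inner w)
  show ?case
    by (rule exI[of _ "\<lambda>x v. v \<bullet> w"]) (auto intro: radially_rational.intros intro!: derivative_eq_intros)
next
  case inverse_norm
  have "radially_rational (\<lambda>x. (- 1) * (x \<bullet> v) * inverse (norm x) ^ 3)" for v :: 'a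
    by (intro radially_rational.intros radially_rational_power)
  then show ?case
    using has_derivative_inverse_norm
    by (intro exI[of _ "\<lambda>x v. - (x \<bullet> v) * inverse (norm x) ^ 3"]) auto
next
  case (add F G)
  then obtain F' G' where "\<And>x. x \<noteq> 0 \<Longrightarrow> (F has_derivative F' x) (at x)" "\<And>v. radially_rational (\<lambda>x. F' x v)"
    "\<And>x. x \<noteq> 0 \<Longrightarrow> (G has_derivative G' x) (at x)" "\<And>v. radially_rational (\<lambda>x. G' x v)"
    by blast
  then show ?case
    by (intro exI[of _ "\<lambda>x v. F' x v + G' x v"]) (auto intro: radially_rational.intros has_derivative_add)
next
  case (mult F G)
  then obtain F' G' where "\<And>x. x \<noteq> 0 \<Longrightarrow> (F has_derivative F' x) (at x)" "\<And>v. radially_rational (\<lambda>x. F' x v)"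
    "\<And>x. x \<noteq> 0 \<Longrightarrow> (G has_derivative G' x) (at x)" "\<And>v. radially_rational (\<lambda>x. G' x v)"
    by blast
  then show ?case
    using mult.hyps
    by (intro exI[of _ "\<lambda>x v. F x * G' x v + F' x v * G x"] conjI allI impI
      has_derivative_mult radially_rational.add radially_rational.mult) auto
qed

lemma has_derivative_off_zero:
  fixes F :: "'a::euclidean_space \<Rightarrow> real"
  assumes "x \<noteq> 0" "(G has_derivative G') (at x)" "\<And>y. y \<noteq> 0 \<Longrightarrow> F y = G y"
  shows "(F has_derivative G') (at x)"
  using assms(2) by (rule has_derivative_transform_within_open[of _ _ _ _ "- {0}"]) (use assms in auto)

text \<open>Equality with a function of the class is claimed only off the origin. Since that set is
  open, it is enough to determine the next derivative.\<close>

lemma iterated_deriv_radially_rational: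
  assumes "radially_rational F"
  shows "\<exists>G. radially_rational G \<and> (\<forall>x. x \<noteq> 0 \<longrightarrow> iterated_deriv vs F x = G x)"
proof (induction vs)
  case Nil
  then show ?case using assms by auto
next
  case (Cons v vs)
  then obtain G where G: "radially_rational G" "\<And>x. x \<noteq> 0 \<Longrightarrow> iterated_deriv vs F x = G x" by blast
  obtain G' where G': "\<And>x. x \<noteq> 0 \<Longrightarrow> (G has_derivative G' x) (at x)" "\<And>v. radially_rational (\<lambda>x. G' x v)"
    using radially_rational_derivative[OF G(1)] by blast
  have "iterated_deriv (v # vs) F x = G' x v" if "x \<noteq> 0" for x
    using frechet_derivative_at[OF has_derivative_off_zero[OF that G'(1)[OF that] G(2)]] by simp
  then show ?case using G'(2)[of v] by auto
qed

lemma smooth_on_radially_rational: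
  assumes "radially_rational F"
  shows "smooth_on (- {0}) F"
  unfolding smooth_on_def differentiable_on_def
proof (intro allI ballI)
  fix vs and x :: 'a assume "x \<in> - {0}"
  then have x: "x \<noteq> 0" by simp
  obtain G where G: "radially_rational G" "\<And>x. x \<noteq> 0 \<Longrightarrow> iterated_deriv vs F x = G x"
    using iterated_deriv_radially_rational[OF assms] by blast
  obtain G' where "\<And>x. x \<noteq> 0 \<Longrightarrow> (G has_derivative G' x) (at x)"
    using radially_rational_derivative[OF G(1)] by blast
  from this[OF x] have "(iterated_deriv vs F has_derivative G' x) (at x)"
    by (rule has_derivative_off_zero[OF x]) (rule G(2))
  then show "iterated_deriv vs F differentiable at x within - {0}"
    unfolding differentiable_def using has_derivative_at_withinI by blast
qed

lemma radial_extension_inner_power: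
  "radial_extension (\<lambda>x. (x \<bullet> w) ^ k) = (\<lambda>x. (x \<bullet> w) ^ k * inverse (norm x) ^ k)"
  by (auto simp: radial_extension_def fun_eq_iff power_mult_distrib)

lemma smooth_sphere_inner_power: "smooth_sphere (\<lambda>x. (x \<bullet> w) ^ k)"
  unfolding smooth_sphere_def radial_extension_inner_power
  by (intro smooth_on_radially_rational radially_rational.intros radially_rational_power)

text \<open>\<open>G\<close> is the derivative of the extension (x \<bullet> w)^k |x|^(-k). After a
  second differentiation every power of |x| equals 1, and Parseval's identity over
  \<open>Basis\<close> evaluates the trace.\<close>

lemma sphere_laplacian_inner_power:
  fixes x w :: "'a::euclidean_space"
  assumes x: "norm x = 1"
  shows "sphere_laplacian (\<lambda>x. (x \<bullet> w) ^ k) x = power_laplacian w k x"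
proof -
  define F where "F x = (x \<bullet> w) ^ k * inverse (norm x) ^ k" for x
  define G where "G x v = real k * (v \<bullet> w) * (x \<bullet> w) ^ (k - 1) * inverse (norm x) ^ k
     - real k * (x \<bullet> w) ^ k * inverse (norm x) ^ (k + 2) * (x \<bullet> v)" for x v
  have invp: "((\<lambda>x. inverse (norm x) ^ j) has_derivative
      (\<lambda>v. - (real j * inverse (norm x) ^ (j + 2) * (x \<bullet> v)))) (at x)" if "x \<noteq> 0" for x :: 'a and j
  proof (cases j)
    case (Suc i)
    show ?thesis
      by (rule has_derivative_eq_rhs[OF has_derivative_power[OF has_derivative_inverse_norm[OF that]]])
        (auto simp: Suc fun_eq_iff power3_eq_cube algebra_simps)
  qed simp
  have innp: "((\<lambda>x. (x \<bullet> w) ^ j) has_derivative (\<lambda>v. real j * (v \<bullet> w) * (x \<bullet> w) ^ (j - 1))) (at x)" for x :: 'a and j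
    by (auto intro!: derivative_eq_intros simp: mult_ac)
  have first: "(F has_derivative G x) (at x)" if "x \<noteq> 0" for x
    unfolding F_def
    by (rule has_derivative_eq_rhs[OF has_derivative_mult[OF innp invp[OF that]]])
      (auto simp: G_def fun_eq_iff algebra_simps)
  have second: "iterated_deriv [b, b] F x =
      real k * (real k - 1) * (x \<bullet> w) ^ (k - 2) * (b \<bullet> w)\<^sup>2
      - 2 * (real k)\<^sup>2 * (x \<bullet> w) ^ (k - 1) * ((b \<bullet> w) * (x \<bullet> b))
      + real k * (real k + 2) * (x \<bullet> w) ^ k * (x \<bullet> b)\<^sup>2 - real k * (x \<bullet> w) ^ k * (b \<bullet> b)" for b
  proof -
    have x0: "x \<noteq> 0" using x by auto
    define H where "H v = real k * (b \<bullet> w) * ((x \<bullet> w) ^ (k - 1) * - (real k * inverse (norm x) ^ (k + 2) * (x \<bullet> v)) +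
          real (k - 1) * (v \<bullet> w) * (x \<bullet> w) ^ (k - 1 - 1) * inverse (norm x) ^ k)
       - real k * ((x \<bullet> w) ^ k * (inverse (norm x) ^ (k + 2) * (v \<bullet> b) +
            - (real (k + 2) * inverse (norm x) ^ (k + 2 + 2) * (x \<bullet> v)) * (x \<bullet> b))
          + real k * (v \<bullet> w) * (x \<bullet> w) ^ (k - 1) * (inverse (norm x) ^ (k + 2) * (x \<bullet> b)))" for v
    have ib: "((\<lambda>x. x \<bullet> b) has_derivative (\<lambda>v. v \<bullet> b)) (at x)"
      by (auto intro!: derivative_eq_intros)
    have "((\<lambda>x. real k * (b \<bullet> w) * ((x \<bullet> w) ^ (k - 1) * inverse (norm x) ^ k)
        - real k * ((x \<bullet> w) ^ k * (inverse (norm x) ^ (k + 2) * (x \<bullet> b)))) has_derivative H) (at x)"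
      unfolding H_def
      by (intro has_derivative_diff has_derivative_mult_right has_derivative_mult innp invp ib x0)
    then have "((\<lambda>x. G x b) has_derivative H) (at x)"
      by (simp add: G_def mult.assoc)
    then have "((\<lambda>x. frechet_derivative F (at x) b) has_derivative H) (at x)"
      by (rule has_derivative_off_zero[OF x0]) (simp add: frechet_derivative_at[OF first, symmetric])
    then have "iterated_deriv [b, b] F x = H b"
      by (simp add: frechet_derivative_at[symmetric])
    also have "real k * real (k - 1) = real k * (real k - 1)" by (cases k) auto
    then have "H b = real k * (real k - 1) * (x \<bullet> w) ^ (k - 2) * (b \<bullet> w)\<^sup>2
      - 2 * (real k)\<^sup>2 * (x \<bullet> w) ^ (k - 1) * ((b \<bullet> w) * (x \<bullet> b))
      + real k * (real k + 2) * (x \<bullet> w) ^ k * (x \<bullet> b)\<^sup>2 - real k * (x \<bullet> w) ^ k * (b \<bullet> b)"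
      by (cases k) (simp_all add: H_def x power2_eq_square numeral_2_eq_2 algebra_simps)
    finally show ?thesis .
  qed
  have s: "(x \<bullet> w) ^ (k - 1) * (x \<bullet> w) * real k = real k * (x \<bullet> w) ^ k"
    by (cases k) auto
  have sums: "(\<Sum>b\<in>Basis. (b \<bullet> w)\<^sup>2) = (norm w)\<^sup>2" "(\<Sum>b\<in>Basis. (b \<bullet> w) * (x \<bullet> b)) = x \<bullet> w"
    "(\<Sum>b\<in>Basis. (x \<bullet> b)\<^sup>2) = 1" "(\<Sum>b\<in>Basis. b \<bullet> (b :: 'a)) = real DIM('a)"
  proof -
    show "(\<Sum>b\<in>Basis. (b \<bullet> w)\<^sup>2) = (norm w)\<^sup>2"
      unfolding power2_norm_eq_inner euclidean_inner[of w w] by (simp add: inner_commute power2_eq_square)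
    show "(\<Sum>b\<in>Basis. (b \<bullet> w) * (x \<bullet> b)) = x \<bullet> w"
      unfolding euclidean_inner[of x w] by (simp add: inner_commute mult.commute)
    show "(\<Sum>b\<in>Basis. (x \<bullet> b)\<^sup>2) = 1"
      using x euclidean_inner[of x x] by (simp add: norm_eq_1 power2_eq_square)
  qed simp
  have "sphere_laplacian (\<lambda>x. (x \<bullet> w) ^ k) x = (\<Sum>b\<in>Basis. iterated_deriv [b, b] F x)"
    unfolding sphere_laplacian_def radial_extension_inner_power F_def ..
  also have "\<dots> = real k * (real k - 1) * (x \<bullet> w) ^ (k - 2) * (norm w)\<^sup>2
      - 2 * (real k)\<^sup>2 * (x \<bullet> w) ^ (k - 1) * (x \<bullet> w)
      + real k * (real k + 2) * (x \<bullet> w) ^ k * 1 - real k * (x \<bullet> w) ^ k * real DIM('a)"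
    unfolding second sum_subtractf sum.distrib sum_distrib_left[symmetric] sums ..
  also have "\<dots> = power_laplacian w k x"
    using s DIM_positive[where 'a = 'a]
    by (cases k) (simp_all add: power_laplacian_def of_nat_diff power2_eq_square algebra_simps)
  finally show ?thesis .
qed

lemma square_integrable_imp_integrable_surface:
  fixes v :: "'a::euclidean_space \<Rightarrow> complex"
  assumes "square_integrable surface_measure v"
  shows "integrable surface_measure v"
proof (rule Bochner_Integration.integrable_bound[where f = "\<lambda>x. 1 + (norm (v x))\<^sup>2"])
  show "integrable surface_measure (\<lambda>x. 1 + (norm (v x))\<^sup>2)"
    using assms by (auto simp: square_integrable_def intro!: integrable_surface_measure)
  have "norm (v x) \<le> 1 + (norm (v x))\<^sup>2" for x
    using self_le_power[of "norm (v x)" 2] by (cases "norm (v x) \<le> 1") (auto intro: order_trans)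
  then show "AE x in surface_measure. norm (v x) \<le> norm (1 + (norm (v x))\<^sup>2)"
    by (intro AE_I2) (auto intro: order_trans[OF _ abs_ge_self])
qed (use assms in \<open>auto simp: square_integrable_def\<close>)

section \<open>Stability of the triangular system for the moments\<close>

lemma norm_diff_le_vector_derivative:
  fixes f :: "real \<Rightarrow> 'b::real_normed_vector"
  assumes "convex S" "\<And>s. s \<in> S \<Longrightarrow> (f has_vector_derivative f' s) (at s within S)"
    and "\<And>s. s \<in> S \<Longrightarrow> norm (f' s) \<le> B" "x \<in> S" "y \<in> S"
  shows "norm (f x - f y) \<le> B * norm (x - y)"
proof (rule differentiable_bound[OF assms(1)])
  fix s assume s: "s \<in> S"
  show "(f has_derivative (\<lambda>h. h *\<^sub>R f' s)) (at s within S)"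
    using assms(2)[OF s] by (simp add: has_vector_derivative_def)
  show "onorm (\<lambda>h. h *\<^sub>R f' s) \<le> B"
    using assms(3)[OF s] order_trans[OF norm_ge_zero assms(3)[OF s]]
    by (intro onorm_bound) (auto simp: mult.commute[of B] intro: mult_left_mono)
qed (use assms in auto)

text \<open>An integrating factor removes the diagonal term, so level k is driven only by level k -
  2, which is bounded by induction. \<open>K\<close> is chosen before the family \<open>A\<close>,
  hence serves a whole sequence of solutions. The condition on \<open>c\<close> at 0 and 1 stops the
  recursion where k - 2 truncates.\<close>

lemma moment_hierarchy_bound:
  fixes c \<mu> :: "nat \<Rightarrow> real"
  assumes c: "c 0 = 0" "c 1 = 0" and "0 \<le> T"
  shows "\<exists>K\<ge>0. \<forall>A \<eta>. (\<forall>k t. (A k has_vector_derivative \<i> * (of_real (c k) * A (k - 2) t - of_real (\<mu> k) * A k t)) (at t))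
     \<longrightarrow> (\<forall>j\<le>k. norm (A j 0) \<le> \<eta>) \<longrightarrow> (\<forall>t. \<bar>t\<bar> \<le> T \<longrightarrow> norm (A k t :: complex) \<le> K * \<eta>)"
proof (induction k rule: less_induct)
  case (less k)
  obtain K where K: "0 \<le> K" and IH: "k \<ge> 2 \<Longrightarrow> \<forall>A \<eta>. (\<forall>k t. (A k has_vector_derivative \<i> * (of_real (c k) * A (k - 2) t - of_real (\<mu> k) * A k t)) (at t))
     \<longrightarrow> (\<forall>j\<le>k - 2. norm (A j 0) \<le> \<eta>) \<longrightarrow> (\<forall>t. \<bar>t\<bar> \<le> T \<longrightarrow> norm (A (k - 2) t :: complex) \<le> K * \<eta>)"
  proof (cases "k \<ge> 2")
    case True
    then show ?thesis using less[of "k - 2"] that by auto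
  next
    case False
    then show ?thesis using that[of 0] by auto
  qed
  show ?case
  proof (intro exI[of _ "1 + \<bar>c k\<bar> * K * T"] conjI allI impI)
    show "0 \<le> 1 + \<bar>c k\<bar> * K * T" using K \<open>0 \<le> T\<close> by simp
    fix A :: "nat \<Rightarrow> real \<Rightarrow> complex" and \<eta> t :: real
    assume A: "\<forall>k t. (A k has_vector_derivative \<i> * (of_real (c k) * A (k - 2) t - of_real (\<mu> k) * A k t)) (at t)"
      and init: "\<forall>j\<le>k. norm (A j 0) \<le> \<eta>" and t: "\<bar>t\<bar> \<le> T"
    have \<eta>: "0 \<le> \<eta>" using init norm_ge_zero order_trans by blast
    \<comment> \<open>The factor of modulus 1 leaves the norm of \<open>A k\<close> unchanged and
      cancels -i \<mu>_k A_k in the derivative.\<close>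
    define D where "D s = cis (\<mu> k * s) * A k s" for s
    have D: "(D has_vector_derivative cis (\<mu> k * s) * (\<i> * of_real (c k) * A (k - 2) s)) (at s within {-T..T})" for s
    proof -
      have "((\<lambda>s. cis (\<mu> k * s)) has_vector_derivative (\<mu> k *\<^sub>R (\<i> * cis (\<mu> k * s)))) (at s)"
        unfolding has_vector_derivative_def
        by (rule has_derivative_eq_rhs, rule has_derivative_cis, rule has_derivative_mult_right, rule has_derivative_ident)
          (auto simp: fun_eq_iff mult.commute)
      from has_vector_derivative_mult[OF this A[rule_format, of k s]]
      have "(D has_vector_derivative cis (\<mu> k * s) * (\<i> * (of_real (c k) * A (k - 2) s - of_real (\<mu> k) * A k s)) +
         \<mu> k *\<^sub>R (\<i> * cis (\<mu> k * s)) * A k s) (at s)"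
        unfolding D_def .
      also have "cis (\<mu> k * s) * (\<i> * (of_real (c k) * A (k - 2) s - of_real (\<mu> k) * A k s)) +
         \<mu> k *\<^sub>R (\<i> * cis (\<mu> k * s)) * A k s = cis (\<mu> k * s) * (\<i> * of_real (c k) * A (k - 2) s)"
        by (simp add: scaleR_conv_of_real algebra_simps)
      finally show ?thesis by (rule has_vector_derivative_at_within)
    qed
    have bound: "norm (cis (\<mu> k * s) * (\<i> * of_real (c k) * A (k - 2) s)) \<le> \<bar>c k\<bar> * (K * \<eta>)" if "s \<in> {-T..T}" for s
    proof (cases "k \<ge> 2")
      case True
      have "\<forall>j\<le>k - 2. norm (A j 0) \<le> \<eta>" using init by auto
      then have "norm (A (k - 2) s) \<le> K * \<eta>" using IH[OF True] A that by auto
      then show ?thesis by (simp add: norm_mult mult_left_mono)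
    next
      case False
      then have "k = 0 \<or> k = 1" by auto
      then have "c k = 0" using c by auto
      then show ?thesis by simp
    qed
    have "norm (D t - D 0) \<le> \<bar>c k\<bar> * (K * \<eta>) * norm (t - 0)"
      by (rule norm_diff_le_vector_derivative[where S = "{-T..T}"])
        (use D bound t \<open>0 \<le> T\<close> in auto)
    also have "\<dots> \<le> \<bar>c k\<bar> * (K * \<eta>) * T"
      using t K \<eta> by (intro mult_left_mono) auto
    finally have "norm (D t - D 0) \<le> \<bar>c k\<bar> * (K * \<eta>) * T" .
    moreover have "norm (D t) = norm (A k t)" "norm (D 0) \<le> \<eta>"
      using init by (auto simp: D_def norm_mult)
    ultimately show "norm (A k t) \<le> (1 + \<bar>c k\<bar> * K * T) * \<eta>"
      using norm_triangle_ineq2[of "D t" "D 0"] by (simp add: algebra_simps)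
  qed
qed

section \<open>Box dimension of graphs\<close>

lemma covering_number_le:
  assumes "finite A" "E \<subseteq> (\<Union>a\<in>A. cbox a (a + \<epsilon> *\<^sub>R One))"
  shows "covering_number E \<epsilon> \<le> card A"
  unfolding covering_number_def using assms by (intro cInf_lower) auto

lemma power_diff_le:
  fixes a b :: real
  assumes "0 \<le> b" "b \<le> a"
  shows "a ^ n - b ^ n \<le> real n * (a - b) * a ^ (n - 1)"
proof (induction n)
  case (Suc n)
  have "a ^ Suc n - b ^ Suc n = a * (a ^ n - b ^ n) + b ^ n * (a - b)"
    by (simp add: algebra_simps)
  also have "\<dots> \<le> a * (real n * (a - b) * a ^ (n - 1)) + a ^ n * (a - b)"
    using Suc assms by (intro add_mono mult_left_mono mult_right_mono power_mono) auto
  also have "\<dots> = real (Suc n) * (a - b) * a ^ (Suc n - 1)"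
    by (cases n) (simp_all add: algebra_simps)
  finally show ?case .
qed simp

text \<open>A packing argument: the disjoint balls of radius h = \<epsilon>/2 about the points lie
  in the shell between the radii 1 - h and 1 + h. Its volume is O(h) rather than O(1), which
  improves the exponent from D to D - 1.\<close>

lemma card_separated_sphere:
  fixes P :: "'a::euclidean_space set"
  assumes P: "finite P" "P \<subseteq> sphere 0 1" and \<epsilon>: "0 < \<epsilon>" "\<epsilon> \<le> 1"
    and sep: "\<And>x y. x \<in> P \<Longrightarrow> y \<in> P \<Longrightarrow> x \<noteq> y \<Longrightarrow> \<epsilon> \<le> dist x y"
  shows "real (card P) \<le> real DIM('a) * 4 ^ DIM('a) * (1 / \<epsilon>) ^ (DIM('a) - 1)"
proof -
  define D where "D = DIM('a)"
  have D: "0 < D" by (simp add: D_def)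
  define V where "V = measure lborel (ball (0::'a) 1)"
  have V: "0 < V" unfolding V_def by (rule content_ball_pos) simp
  define h where "h = \<epsilon> / 2"
  have h: "0 < h" "h \<le> 1" using \<epsilon> by (auto simp: h_def)
  have vol: "measure lborel (ball c r) = V * r ^ D" if "0 \<le> r" for c :: 'a and r
    using content_ball_conv_unit_ball[OF that, of c] by (simp add: V_def D_def mult.commute)
  have "real (card P) * (V * h ^ D) = (\<Sum>x\<in>P. measure lborel (ball x h))"
    using h by (simp add: vol)
  also have "\<dots> = measure lborel (\<Union>x\<in>P. ball x h)"
  proof (rule measure_finite_Union[symmetric, OF P(1)])
    show "(\<lambda>x. ball x h) ` P \<subseteq> sets lborel" by auto
    show "disjoint_family_on (\<lambda>x. ball x h) P"
      unfolding disjoint_family_on_def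
    proof (intro ballI impI)
      fix x y assume "x \<in> P" "y \<in> P" "x \<noteq> y"
      then have "\<epsilon> \<le> dist x y" by (rule sep)
      then show "ball x h \<inter> ball y h = {}"
        by (intro disjoint_ballI) (simp add: h_def)
    qed
    show "emeasure lborel (ball x h) \<noteq> \<infinity>" for x :: 'a
      using emeasure_bounded_finite[OF bounded_ball, of x h] by simp
  qed
  also have "\<dots> \<le> measure lborel (ball 0 (1 + h) - ball (0::'a) (1 - h))"
  proof (rule measure_mono_fmeasurable)
    show "(\<Union>x\<in>P. ball x h) \<subseteq> ball 0 (1 + h) - ball 0 (1 - h)"
    proof safe
      fix x y assume "x \<in> P" and y: "y \<in> ball x h"
      then have x: "norm x = 1" using P by auto
      have xy: "norm (x - y) < h" using y by (simp add: dist_norm)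
      show "y \<in> ball 0 (1 + h)"
        using xy x norm_triangle_ineq2[of y x] by (simp add: norm_minus_commute)
      show "y \<in> ball 0 (1 - h) \<Longrightarrow> False"
        using xy x norm_triangle_ineq2[of x y] by simp
    qed
    show "(\<Union>x\<in>P. ball x h) \<in> sets lborel" by (intro sets.finite_UN P) auto
    show "ball 0 (1 + h) - ball 0 (1 - h) \<in> fmeasurable lborel"
      by (intro fmeasurable.Diff fmeasurableI emeasure_bounded_finite bounded_ball) simp_all
  qed
  also have "\<dots> = V * (1 + h) ^ D - V * (1 - h) ^ D"
    using h emeasure_bounded_finite[OF bounded_ball, of "0::'a" "1 + h"]
    by (subst measure_Diff) (auto simp: vol)
  also have "\<dots> = V * ((1 + h) ^ D - (1 - h) ^ D)" by (simp add: algebra_simps)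
  also have "\<dots> \<le> V * (real D * (2 * h) * (1 + h) ^ (D - 1))"
    using power_diff_le[of "1 - h" "1 + h" D] h V by (intro mult_left_mono) auto
  also have "\<dots> \<le> V * (real D * (2 * h) * 2 ^ (D - 1))"
    using h V by (intro mult_left_mono power_mono) auto
  finally have "real (card P) * h ^ D \<le> real D * (2 * h) * 2 ^ (D - 1)"
    using V by (simp add: mult.left_commute[of _ V])
  moreover have "h ^ D = h * h ^ (D - 1)" using D by (cases D) auto
  ultimately have "real (card P) * h ^ (D - 1) * h \<le> real D * (2 * 2 ^ (D - 1)) * h"
    by (simp add: mult_ac)
  then have "real (card P) * h ^ (D - 1) \<le> real D * (2 * 2 ^ (D - 1))"
    using h by simp
  then have "real (card P) \<le> real D * (2 * 2 ^ (D - 1)) / h ^ (D - 1)"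
    using h by (simp add: pos_le_divide_eq)
  also have "\<dots> = real D * (2 * 4 ^ (D - 1)) * (1 / \<epsilon>) ^ (D - 1)"
    using \<epsilon> by (simp add: h_def power_divide power_mult_distrib[symmetric] divide_simps)
  also have "\<dots> \<le> real D * 4 ^ D * (1 / \<epsilon>) ^ (D - 1)"
    using D \<epsilon> by (intro mult_right_mono mult_left_mono) (cases D, auto)
  finally show ?thesis by (simp add: D_def)
qed

text \<open>An \<epsilon>-separated set of greatest cardinality is a net, since a point far from it
  could be added; the packing bound guarantees that a greatest one exists.\<close>

lemma sphere_net:
  assumes \<epsilon>: "0 < \<epsilon>" "\<epsilon> \<le> 1"
  obtains P :: "'a::euclidean_space set" where "finite P" "P \<subseteq> sphere 0 1"
    "real (card P) \<le> real DIM('a) * 4 ^ DIM('a) * (1 / \<epsilon>) ^ (DIM('a) - 1)"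
    "\<And>x. x \<in> sphere 0 1 \<Longrightarrow> \<exists>a\<in>P. dist x a < \<epsilon>"
proof -
  define Q where "Q P \<longleftrightarrow> finite P \<and> P \<subseteq> sphere (0::'a) 1 \<and> (\<forall>x\<in>P. \<forall>y\<in>P. x \<noteq> y \<longrightarrow> \<epsilon> \<le> dist x y)" for P
  define B where "B = real DIM('a) * 4 ^ DIM('a) * (1 / \<epsilon>) ^ (DIM('a) - 1)"
  have le: "real (card P) \<le> B" if "Q P" for P
    unfolding B_def using that \<epsilon> by (intro card_separated_sphere) (auto simp: Q_def)
  have "card P < Suc (nat \<lfloor>B\<rfloor>)" if "Q P" for P
    using le[OF that] by (simp add: less_Suc_eq_le le_nat_floor)
  moreover have "Q {}" by (simp add: Q_def)
  ultimately obtain P where P: "Q P" "\<And>P'. Q P' \<Longrightarrow> card P' \<le> card P"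
    using ex_has_greatest_nat[of Q "{}" card "Suc (nat \<lfloor>B\<rfloor>)"] by blast
  have "\<exists>a\<in>P. dist x a < \<epsilon>" if x: "x \<in> sphere 0 1" for x
  proof (rule ccontr)
    assume "\<not> (\<exists>a\<in>P. dist x a < \<epsilon>)"
    then have far: "\<epsilon> \<le> dist x a" if "a \<in> P" for a using that by force
    have "x \<notin> P" using far[of x] \<epsilon> by auto
    have "Q (insert x P)"
      using P(1) x far by (auto simp: Q_def dist_commute)
    from P(2)[OF this] show False using \<open>x \<notin> P\<close> P(1) by (simp add: Q_def)
  qed
  then show ?thesis using that[of P] P(1) le[OF P(1)] by (auto simp: Q_def B_def)
qed

lemma mem_cbox_One:
  fixes x a :: "'a::euclidean_space"
  shows "x \<in> cbox a (a + \<epsilon> *\<^sub>R One) \<longleftrightarrow> (\<forall>i\<in>Basis. a \<bullet> i \<le> x \<bullet> i \<and> x \<bullet> i \<le> a \<bullet> i + \<epsilon>)"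
  by (simp add: mem_box inner_add_left inner_sum_left_Basis)

lemma mem_cbox_One_prod:
  fixes a :: "'a::euclidean_space" and b y :: real
  shows "(x, y) \<in> cbox (a, b) ((a, b) + \<epsilon> *\<^sub>R One) \<longleftrightarrow> x \<in> cbox a (a + \<epsilon> *\<^sub>R One) \<and> b \<le> y \<and> y \<le> b + \<epsilon>"
  unfolding mem_cbox_One by (auto simp: Basis_prod_def)

text \<open>Over each box of a cover of the sphere, the graph stays in a vertical range of length
  \<open>O(\<epsilon>\<^sup>\<gamma>)\<close>, hence in \<open>O(\<epsilon>\<^sup>\<gamma>\<^sup>-\<^sup>1)\<close> boxes.\<close>
lemma covering_number_graph:
  fixes g :: "'a::euclidean_space \<Rightarrow> real"
  assumes g: "\<And>x y. x \<in> sphere 0 1 \<Longrightarrow> y \<in> sphere 0 1 \<Longrightarrow> \<bar>g x - g y\<bar> \<le> K * dist x y powr \<gamma>"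
    and K: "0 \<le> K" and \<gamma>: "0 < \<gamma>" "\<gamma> \<le> 1" and \<epsilon>: "0 < \<epsilon>" "\<epsilon> < 1"
  shows "real (covering_number (graph_on (sphere 0 1) g) \<epsilon>) \<le>
    (real DIM('a) * 8 ^ DIM('a) * (2 * K + 1)) * (1 / \<epsilon>) powr (real DIM('a) - \<gamma>)"
proof -
  define D where "D = DIM('a)"
  have D: "1 \<le> D" using DIM_positive[where 'a = 'a] unfolding D_def by linarith
  \<comment> \<open>Radius \<epsilon>/2, because the box of side \<epsilon> centred at a net point
    contains the ball of that radius.\<close>
  obtain P :: "'a set" where P: "finite P" "P \<subseteq> sphere 0 1"
    "real (card P) \<le> real D * 4 ^ D * (1 / (\<epsilon> / 2)) ^ (D - 1)"
    "\<And>x. x \<in> sphere 0 1 \<Longrightarrow> \<exists>a\<in>P. dist x a < \<epsilon> / 2"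
    using sphere_net[of "\<epsilon> / 2", where 'a = 'a] \<epsilon> unfolding D_def by auto
  define \<delta> where "\<delta> = K * \<epsilon> powr \<gamma>"
  have \<delta>: "0 \<le> \<delta>" using K by (simp add: \<delta>_def)
  \<comment> \<open>Above the box of a the graph stays within [g a - \<delta>, g a + \<delta>], of
    length 2\<delta>; the levels 0 to m of height \<epsilon> cover it, which is m + 1 boxes.
    \<open>q\<close> yields their lower corners.\<close>
  define m where "m = nat \<lfloor>2 * \<delta> / \<epsilon>\<rfloor>"
  define q where "q = (\<lambda>(a, j::nat). (a - (\<epsilon> / 2) *\<^sub>R One, g a - \<delta> + real j * \<epsilon>))"
  define A where "A = q ` (P \<times> {..m})"
  have "finite A" using P by (simp add: A_def)
  have "graph_on (sphere 0 1) g \<subseteq> (\<Union>a\<in>A. cbox a (a + \<epsilon> *\<^sub>R One))"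
  proof
    fix z assume "z \<in> graph_on (sphere 0 1) g"
    then obtain x where x: "x \<in> sphere 0 1" and z: "z = (x, g x)" by (auto simp: graph_on_def)
    obtain a where a: "a \<in> P" "dist x a < \<epsilon> / 2" using P(4)[OF x] by blast
    define j where "j = nat \<lfloor>(g x - (g a - \<delta>)) / \<epsilon>\<rfloor>"
    have "\<bar>g x - g a\<bar> \<le> K * dist x a powr \<gamma>" using g x a P(2) by auto
    also have "\<dots> \<le> \<delta>" unfolding \<delta>_def
      using a \<epsilon> \<gamma> K by (intro mult_left_mono powr_mono2) auto
    finally have ga: "\<bar>g x - g a\<bar> \<le> \<delta>" .
    then have r: "0 \<le> (g x - (g a - \<delta>)) / \<epsilon>" "(g x - (g a - \<delta>)) / \<epsilon> \<le> 2 * \<delta> / \<epsilon>"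
      using \<epsilon> by (auto intro!: divide_right_mono)
    have "j \<le> m" unfolding j_def m_def using r by (intro nat_mono floor_mono)
    have "real j \<le> (g x - (g a - \<delta>)) / \<epsilon>" "(g x - (g a - \<delta>)) / \<epsilon> \<le> real j + 1"
      using r(1) by (auto simp: j_def of_nat_nat)
    then have "real j * \<epsilon> \<le> g x - (g a - \<delta>)" "g x - (g a - \<delta>) \<le> real j * \<epsilon> + \<epsilon>"
      using \<epsilon> by (auto simp: pos_le_divide_eq pos_divide_le_eq algebra_simps)
    moreover have "x \<in> cbox (a - (\<epsilon> / 2) *\<^sub>R One) (a - (\<epsilon> / 2) *\<^sub>R One + \<epsilon> *\<^sub>R One)"
    proof -
      have "\<bar>(x - a) \<bullet> i\<bar> \<le> \<epsilon> / 2" if "i \<in> Basis" for i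
        using Basis_le_norm[OF that, of "x - a"] a(2) by (simp add: dist_norm)
      then have near: "x \<bullet> i \<le> a \<bullet> i + \<epsilon> / 2" "a \<bullet> i \<le> x \<bullet> i + \<epsilon> / 2" if "i \<in> Basis" for i
        using that unfolding inner_diff_left abs_le_iff by (fastforce simp: algebra_simps)+
      have "(a - (\<epsilon> / 2) *\<^sub>R One) \<bullet> i = a \<bullet> i - \<epsilon> / 2" if "i \<in> Basis" for i
        using that by (simp add: inner_diff_left inner_sum_left_Basis)
      then show ?thesis
        unfolding mem_cbox_One using near by (auto simp: algebra_simps)
    qed
    ultimately have "z \<in> cbox (q (a, j)) (q (a, j) + \<epsilon> *\<^sub>R One)"
      unfolding z q_def split_conv mem_cbox_One_prod by auto
    then show "z \<in> (\<Union>a\<in>A. cbox a (a + \<epsilon> *\<^sub>R One))"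
      using a \<open>j \<le> m\<close> by (auto simp: A_def)
  qed
  then have "covering_number (graph_on (sphere 0 1) g) \<epsilon> \<le> card A"
    using \<open>finite A\<close> by (rule covering_number_le[rotated])
  also have "card A \<le> card (P \<times> {..m})"
    unfolding A_def using P(1) by (intro card_image_le) simp
  also have "\<dots> = card P * Suc m" by (simp add: card_cartesian_product)
  finally have "real (covering_number (graph_on (sphere 0 1) g) \<epsilon>) \<le> real (card P) * real (Suc m)"
    unfolding of_nat_mult[symmetric] by (rule of_nat_mono)
  also have "\<dots> \<le> (real D * 4 ^ D * (1 / (\<epsilon> / 2)) ^ (D - 1)) * ((2 * K + 1) * (1 / \<epsilon>) powr (1 - \<gamma>))"
  proof (rule mult_mono[OF P(3)])
    have "real (Suc m) \<le> 2 * \<delta> / \<epsilon> + 1"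
      using \<delta> \<epsilon> by (simp add: m_def of_nat_nat)
    also have "2 * \<delta> / \<epsilon> = 2 * K * (1 / \<epsilon>) powr (1 - \<gamma>)"
      using \<epsilon> by (simp add: \<delta>_def powr_divide powr_diff)
    finally have "real (Suc m) \<le> 2 * K * (1 / \<epsilon>) powr (1 - \<gamma>) + 1" .
    moreover have "1 \<le> (1 / \<epsilon>) powr (1 - \<gamma>)"
      using \<epsilon> \<gamma> by (intro ge_one_powr_ge_zero) auto
    ultimately show "real (Suc m) \<le> (2 * K + 1) * (1 / \<epsilon>) powr (1 - \<gamma>)"
      by (simp add: algebra_simps)
  qed (use \<epsilon> in auto)
  also have "\<dots> = (real D * 4 ^ D * 2 ^ (D - 1) * (2 * K + 1)) * ((1 / \<epsilon>) ^ (D - 1) * (1 / \<epsilon>) powr (1 - \<gamma>))"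
    by (simp add: power_divide)
  also have "(1 / \<epsilon>) ^ (D - 1) * (1 / \<epsilon>) powr (1 - \<gamma>) = (1 / \<epsilon>) powr (real D - \<gamma>)"
    using \<epsilon> D by (simp add: powr_realpow[symmetric] powr_add[symmetric] of_nat_diff)
  also have "(real D * 4 ^ D * 2 ^ (D - 1) * (2 * K + 1)) \<le> real D * 8 ^ D * (2 * K + 1)"
  proof -
    have "(4::real) ^ D * 2 ^ (D - 1) \<le> 4 ^ D * 2 ^ D"
      by (intro mult_left_mono power_increasing) auto
    also have "\<dots> = 8 ^ D" by (simp flip: power_mult_distrib)
    finally show ?thesis
      using K by (simp add: mult.assoc mult_left_mono mult_right_mono)
  qed
  finally show ?thesis unfolding D_def by (simp add: mult_right_mono)
qed

text \<open>After taking logarithms the constant contributes ln C / ln(1/\<epsilon>), which tends to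
  0.\<close>

lemma fractal_dim_le:
  assumes C: "1 \<le> C" and s: "0 \<le> s"
    and cov: "\<And>\<epsilon>. 0 < \<epsilon> \<Longrightarrow> \<epsilon> < 1 \<Longrightarrow> real (covering_number E \<epsilon>) \<le> C * (1 / \<epsilon>) powr s"
  shows "fractal_dim E \<le> ereal s"
proof -
  have lim: "((\<lambda>\<epsilon>. ereal (ln C / ln (1 / \<epsilon>) + s)) \<longlongrightarrow> ereal s) (at_right (0::real))"
  proof -
    have "LIM \<epsilon> at_right (0::real). ln (1 / \<epsilon>) :> at_top"
      by (rule filterlim_compose[OF ln_at_top]) (use filterlim_inverse_at_top_right in \<open>simp add: inverse_eq_divide\<close>)
    then have "((\<lambda>\<epsilon>. ln C / ln (1 / \<epsilon>) + s) \<longlongrightarrow> 0 + s) (at_right (0::real))"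
      by (intro tendsto_add real_tendsto_divide_at_top[OF tendsto_const] tendsto_const)
    then show ?thesis by simp
  qed
  have "\<forall>\<^sub>F \<epsilon> in at_right 0. \<epsilon> < (1::real)"
    by (simp add: eventually_at_right_less eventually_at_right_field) (auto intro: exI[of _ 1])
  moreover have "\<forall>\<^sub>F \<epsilon> in at_right 0. (0::real) < \<epsilon>"
    by (rule eventually_at_right_less)
  ultimately have "\<forall>\<^sub>F \<epsilon> in at_right 0. ereal (ln (real (covering_number E \<epsilon>)) / ln (1 / \<epsilon>)) \<le> ereal (ln C / ln (1 / \<epsilon>) + s)"
  proof eventually_elim
    case (elim \<epsilon>)
    then have l: "0 < ln (1 / \<epsilon>)" by simp
    have "ln (real (covering_number E \<epsilon>)) \<le> ln C + s * ln (1 / \<epsilon>)"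
    proof (cases "covering_number E \<epsilon> = 0")
      \<comment> \<open>Here the default value \<open>ln 0 = 0\<close> enters; the right-hand side
        is nonnegative since C \<ge> 1 and \<epsilon> < 1.\<close>
      case True
      then show ?thesis using C s l by (auto intro!: add_nonneg_nonneg)
    next
      case False
      then have "ln (real (covering_number E \<epsilon>)) \<le> ln (C * (1 / \<epsilon>) powr s)"
        using cov[of \<epsilon>] elim C by (subst ln_le_cancel_iff) auto
      also have "\<dots> = ln C + s * ln (1 / \<epsilon>)"
        using elim C by (subst ln_mult) (auto simp: ln_powr)
      finally show ?thesis .
    qed
    then show ?case using l by (simp add: field_simps)
  qed
  then have "fractal_dim E \<le> Limsup (at_right 0) (\<lambda>\<epsilon>. ereal (ln C / ln (1 / \<epsilon>) + s))"
    unfolding fractal_dim_def by (rule Limsup_mono)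
  also have "\<dots> = ereal s"
    by (rule lim_imp_Limsup[OF _ lim]) simp
  finally show ?thesis .
qed

lemma fractal_dim_graph_le:
  fixes g :: "'a::euclidean_space \<Rightarrow> real"
  assumes \<gamma>: "0 < \<gamma>" "\<gamma> \<le> 1" and hoelder: "\<And>\<gamma>'. 0 < \<gamma>' \<Longrightarrow> \<gamma>' < \<gamma> \<Longrightarrow> hoelder_on \<gamma>' (sphere 0 1) g"
  shows "fractal_dim (graph_on (sphere 0 1) g) \<le> ereal (real DIM('a) - \<gamma>)"
proof (rule ereal_le_epsilon2)
  fix \<eta> :: real assume "0 < \<eta>"
  \<comment> \<open>Hoelder continuity is available only strictly below \<gamma>, so an arbitrary
    loss \<eta> is allowed; the maximum with \<gamma>/2 keeps the order positive.\<close>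
  define \<gamma>' where "\<gamma>' = max (\<gamma> / 2) (\<gamma> - \<eta>)"
  have \<gamma>': "0 < \<gamma>'" "\<gamma>' < \<gamma>" "\<gamma> - \<eta> \<le> \<gamma>'" using \<gamma> \<open>0 < \<eta>\<close> by (auto simp: \<gamma>'_def)
  obtain K where K: "\<And>x y. x \<in> sphere 0 1 \<Longrightarrow> y \<in> sphere 0 1 \<Longrightarrow> dist (g x) (g y) \<le> K * dist x y powr \<gamma>'"
    using hoelder[OF \<gamma>'(1,2)] unfolding hoelder_on_def by blast
  have D: "1 \<le> real DIM('a)" using DIM_positive[where 'a = 'a] by linarith
  have "fractal_dim (graph_on (sphere 0 1) g) \<le> ereal (real DIM('a) - \<gamma>')"
  proof (rule fractal_dim_le)
    show "real (covering_number (graph_on (sphere 0 1) g) \<epsilon>) \<le> real DIM('a) * 8 ^ DIM('a) * (2 * max 0 K + 1) * (1 / \<epsilon>) powr (real DIM('a) - \<gamma>')"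
      if "0 < \<epsilon>" "\<epsilon> < 1" for \<epsilon>
    proof (rule covering_number_graph)
      fix x y :: 'a assume "x \<in> sphere 0 1" "y \<in> sphere 0 1"
      then have "\<bar>g x - g y\<bar> \<le> K * dist x y powr \<gamma>'" using K by (simp add: dist_real_def)
      also have "\<dots> \<le> max 0 K * dist x y powr \<gamma>'" by (intro mult_right_mono) auto
      finally show "\<bar>g x - g y\<bar> \<le> max 0 K * dist x y powr \<gamma>'" .
    qed (use \<gamma> \<gamma>' that in auto)
    have "1 * 1 * 1 \<le> real DIM('a) * 8 ^ DIM('a) * (2 * max 0 K + 1)"
      using D by (intro mult_mono one_le_power) auto
    then show "1 \<le> real DIM('a) * 8 ^ DIM('a) * (2 * max 0 K + 1)" by simp
  qed (use D \<gamma> \<gamma>' in linarith)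
  also have "\<dots> \<le> ereal (real DIM('a) - \<gamma>) + ereal \<eta>" using \<gamma>'(3) by simp
  finally show "fractal_dim (graph_on (sphere 0 1) g) \<le> ereal (real DIM('a) - \<gamma>) + ereal \<eta>" .
qed

section \<open>Regularity of the solution\<close>

definition zonal_partial_sum :: "(nat \<Rightarrow> complex) \<Rightarrow> 'a::euclidean_space \<Rightarrow> nat \<Rightarrow> real \<Rightarrow> 'a \<Rightarrow> complex" where
  "zonal_partial_sum a e N t x =
    (\<Sum>n<N. a n * cis (- t * (real n * (real n + real (DIM('a) - 1) - 1))) * of_real (zonal e n x))"

lemma integral_of_real_surface:
  fixes f :: "'a::euclidean_space \<Rightarrow> real"
  shows "(\<integral>x. c * of_real (f x) \<partial>surface_measure) = c * complex_of_real (\<integral>x. f x \<partial>surface_measure)"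
  by (simp add: integral_complex_of_real)

text \<open>On a finite measure space s \<le> \<eta> + s^2/\<eta> replaces the Cauchy-Schwarz
  inequality. The choice \<eta> = r/(2\<omega>) spends r/2 on the constant and leaves r/2 for the L2
  term.\<close>

lemma L1_tendsto_zero_surface:
  fixes h :: "nat \<Rightarrow> 'a::euclidean_space \<Rightarrow> complex"
  assumes h: "\<And>n. square_integrable surface_measure (h n)"
    and lim: "(\<lambda>n. \<integral>x. (norm (h n x))\<^sup>2 \<partial>surface_measure) \<longlonglongrightarrow> 0"
  shows "(\<lambda>n. \<integral>x. norm (h n x) \<partial>surface_measure) \<longlonglongrightarrow> 0"
proof (rule LIMSEQ_I)
  fix r :: real assume r: "0 < r"
  define \<omega> where "\<omega> = measure surface_measure (sphere (0::'a) 1)"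
  have \<omega>: "0 < \<omega>" unfolding \<omega>_def by (rule measure_surface_pos)
  define \<eta> where "\<eta> = r / (2 * \<omega>)"
  have \<eta>: "0 < \<eta>" using r \<omega> by (simp add: \<eta>_def)
  have pt: "s \<le> \<eta> + s\<^sup>2 / \<eta>" if "0 \<le> s" for s
  proof (cases "s \<le> \<eta>")
    case False
    then have "s * \<eta> \<le> s * s" using that by (intro mult_left_mono) auto
    then have "s \<le> s\<^sup>2 / \<eta>" using \<eta> by (simp add: pos_le_divide_eq power2_eq_square)
    then show ?thesis using \<eta> by simp
  qed (use \<eta> in \<open>simp add: add_increasing2\<close>)
  have le: "(\<integral>x. norm (h n x) \<partial>surface_measure) \<le> r / 2 + (\<integral>x. (norm (h n x))\<^sup>2 \<partial>surface_measure) / \<eta>" for n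
  proof -
    have i: "integrable surface_measure (\<lambda>x. (norm (h n x))\<^sup>2)"
      using h by (simp add: square_integrable_def)
    have "(\<integral>x. norm (h n x) \<partial>surface_measure) \<le> (\<integral>x. \<eta> + (norm (h n x))\<^sup>2 / \<eta> \<partial>surface_measure)"
      using square_integrable_imp_integrable_surface[OF h] i
      by (intro integral_mono) (auto intro!: pt integrable_surface_measure)
    also have "\<dots> = \<eta> * \<omega> + (\<integral>x. (norm (h n x))\<^sup>2 \<partial>surface_measure) / \<eta>"
      using i by (subst Bochner_Integration.integral_add) (auto simp: \<omega>_def intro!: integrable_surface_measure)
    also have "\<eta> * \<omega> = r / 2" using \<omega> by (simp add: \<eta>_def)
    finally show ?thesis .
  qed
  have "\<forall>\<^sub>F n in sequentially. (\<integral>x. (norm (h n x))\<^sup>2 \<partial>surface_measure) < r / 2 * \<eta>"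
    using lim r \<eta> by (intro order_tendstoD(2)) auto
  then obtain N where N: "\<And>n. n \<ge> N \<Longrightarrow> (\<integral>x. (norm (h n x))\<^sup>2 \<partial>surface_measure) < r / 2 * \<eta>"
    by (auto simp: eventually_sequentially)
  have "norm ((\<integral>x. norm (h n x) \<partial>surface_measure) - 0) < r" if "n \<ge> N" for n
  proof -
    have "(\<integral>x. (norm (h n x))\<^sup>2 \<partial>surface_measure) / \<eta> < r / 2"
      using N[OF that] \<eta> by (simp add: pos_divide_less_eq)
    moreover have "0 \<le> (\<integral>x. norm (h n x) \<partial>surface_measure)" by simp
    ultimately show ?thesis
      using le[of n] by (simp only: diff_0_right real_norm_def abs_of_nonneg)
  qed
  then show "\<exists>N. \<forall>n\<ge>N. norm ((\<integral>x. norm (h n x) \<partial>surface_measure) - 0) < r" by blast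
qed

lemma square_integrable_diff_continuous_surface:
  fixes f g :: "'a::euclidean_space \<Rightarrow> complex"
  assumes f: "square_integrable surface_measure f" and g: "continuous_on (sphere 0 1) g"
  shows "square_integrable surface_measure (\<lambda>x. f x - g x)"
  unfolding square_integrable_def
proof
  have fm: "f \<in> borel_measurable surface_measure" using f by (simp add: square_integrable_def)
  have gm: "g \<in> borel_measurable surface_measure" using g by (rule borel_measurable_surface_measure)
  show m: "(\<lambda>x. f x - g x) \<in> borel_measurable surface_measure"
    by (intro borel_measurable_diff fm gm)
  have "integrable surface_measure (\<lambda>x. 2 * (norm (f x))\<^sup>2 + 2 * (norm (g x))\<^sup>2)"
  proof (rule Bochner_Integration.integrable_add)
    show "integrable surface_measure (\<lambda>x. 2 * (norm (f x))\<^sup>2)"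
      using f by (simp add: square_integrable_def)
    show "integrable surface_measure (\<lambda>x. 2 * (norm (g x))\<^sup>2)"
      using g by (intro integrable_surface_measure continuous_intros)
  qed
  then show "integrable surface_measure (\<lambda>x. (norm (f x - g x))\<^sup>2)"
  proof (rule Bochner_Integration.integrable_bound)
    show "(\<lambda>x. (norm (f x - g x))\<^sup>2) \<in> borel_measurable surface_measure"
      by (intro borel_measurable_power measurable_compose[OF m borel_measurable_norm])
    have "(norm (f x - g x))\<^sup>2 \<le> 2 * (norm (f x))\<^sup>2 + 2 * (norm (g x))\<^sup>2" for x
    proof -
      have "(norm (f x - g x))\<^sup>2 \<le> (norm (f x) + norm (g x))\<^sup>2"
        by (intro power_mono norm_triangle_ineq4) auto
      also have "\<dots> \<le> 2 * (norm (f x))\<^sup>2 + 2 * (norm (g x))\<^sup>2"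
        using zero_le_power2[of "norm (f x) - norm (g x)"] by (simp add: power2_eq_square algebra_simps)
      finally show ?thesis .
    qed
    then show "AE x in surface_measure. norm ((norm (f x - g x))\<^sup>2) \<le> norm (2 * (norm (f x))\<^sup>2 + 2 * (norm (g x))\<^sup>2)"
      by (intro AE_I2) (simp add: order_trans[OF _ abs_ge_self])
  qed
qed

lemma hoelder_on_imp_continuous_on:
  assumes "hoelder_on \<gamma> S g" "0 < \<gamma>"
  shows "continuous_on S g"
  unfolding continuous_on_def
proof
  fix x assume x: "x \<in> S"
  obtain K where K: "\<And>x y. x \<in> S \<Longrightarrow> y \<in> S \<Longrightarrow> dist (g x) (g y) \<le> K * dist x y powr \<gamma>"
    using assms(1) unfolding hoelder_on_def by blast
  have "((\<lambda>y. dist y x) \<longlongrightarrow> dist x x) (at x within S)"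
    by (intro tendsto_intros)
  then have "((\<lambda>y. dist y x) \<longlongrightarrow> 0) (at x within S)"
    by simp
  then have "((\<lambda>y. dist y x powr \<gamma>) \<longlongrightarrow> 0) (at x within S)"
    by (rule tendsto_zero_powrI[OF _ tendsto_const]) (use assms(2) in auto)
  from tendsto_mult_right_zero[OF this, of K]
  have "((\<lambda>y. K * dist y x powr \<gamma>) \<longlongrightarrow> 0) (at x within S)" .
  then have "((\<lambda>y. dist (g y) (g x)) \<longlongrightarrow> 0) (at x within S)"
  proof (rule Lim_null_comparison[rotated])
    show "\<forall>\<^sub>F y in at x within S. norm (dist (g y) (g x)) \<le> K * dist y x powr \<gamma>"
      using K x by (auto simp: eventually_at_filter intro!: always_eventually)
  qed
  then show "(g \<longlongrightarrow> g x) (at x within S)"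
    by (rule tendsto_dist_iff[THEN iffD2])
qed

context
  fixes e :: "'a::euclidean_space" and d :: nat
  assumes e: "norm e = 1" and d: "2 \<le> d" and DIM: "DIM('a) = d + 1"
begin

lemma continuous_on_zonal: "continuous_on A (zonal e n)"
  unfolding zonal_eq[OF e d DIM, abs_def] by (intro continuous_intros)

lemma continuous_on_zonal_partial_sum: "continuous_on A (zonal_partial_sum a e N t)"
  unfolding zonal_partial_sum_def[abs_def] by (intro continuous_intros continuous_on_zonal)

text \<open>By symmetry the Laplacian passes from the test power to the zonal harmonic, where it
  acts as its eigenvalue.\<close>

lemma integral_zonal_power_laplacian:
  "(\<integral>x. zonal e n x * power_laplacian w k x \<partial>surface_measure) =
   - (real n * (real n + real d - 1)) * (\<integral>x. zonal e n x * (x \<bullet> w) ^ k \<partial>surface_measure)"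
proof -
  define c where "c = zonal_coeff e d n"
  have d0: "0 < d" using d by simp
  have l: "real (n * (n + d - 1)) = real n * (real n + real d - 1)"
    using d by (simp add: of_nat_diff)
  have "(\<integral>x. zonal e n x * power_laplacian w k x \<partial>surface_measure) =
     (\<integral>x. c * (poly (zonal_poly d n) (x \<bullet> e) * power_laplacian w k x) \<partial>surface_measure)"
    by (rule Bochner_Integration.integral_cong) (auto simp: zonal_eq[OF e d DIM] c_def)
  also have "\<dots> = c * (\<integral>x. poly (gegenbauer_op d (zonal_poly d n)) (x \<bullet> e) * (x \<bullet> w) ^ k \<partial>surface_measure)"
    using integral_gegenbauer_op_power[OF e, of "zonal_poly d n" w k] DIM by simp
  also have "\<dots> = (\<integral>x. - (real n * (real n + real d - 1)) * (zonal e n x * (x \<bullet> w) ^ k) \<partial>surface_measure)"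
    unfolding integral_mult_right_zero[symmetric] gegenbauer_op_zonal_poly[OF d0] zonal_eq[OF e d DIM]
    by (rule Bochner_Integration.integral_cong) (simp_all add: of_nat_poly l[unfolded One_nat_def] c_def del: of_nat_mult)
  finally show ?thesis by simp
qed

text \<open>The moments of the weak solution (\<open>der_u\<close>) and of the partial sums
  (\<open>der_U\<close>) obey the same triangular system, so their differences \<open>A N\<close> do
  too. At time 0 these tend to 0 because L2 convergence of the zonal series implies L1
  convergence.\<close>

lemma solution_moments_tendsto:
  assumes f: "square_integrable surface_measure f"
    and conv: "(\<lambda>N. L2_dist_sq surface_measure f (\<lambda>x. \<Sum>n<N. a n * of_real (zonal e n x))) \<longlonglongrightarrow> 0"
    and sol: "schroedinger_solution f u"
  shows "(\<lambda>N. \<integral>x. (u t x - zonal_partial_sum a e N t x) * of_real ((x \<bullet> w) ^ k) \<partial>surface_measure) \<longlonglongrightarrow> 0"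
proof -
  define c \<mu> lam where "c k = real k * (real k - 1) * (norm w)\<^sup>2" and "\<mu> k = real k * (real k + real d - 1)"
    and "lam n = real n * (real n + real d - 1)" for k n
  define X where "X k x = complex_of_real ((x \<bullet> w) ^ k)" for k and x :: 'a
  define U where "U N t x = zonal_partial_sum a e N t x" for N t x
  have U: "U N t x = (\<Sum>n<N. a n * cis (- t * lam n) * of_real (zonal e n x))" for N t x
    using DIM by (simp add: U_def zonal_partial_sum_def lam_def)
  have Uc: "continuous_on S (U N t)" for S N t
    unfolding U_def by (rule continuous_on_zonal_partial_sum)
  define mu where "mu k t = (\<integral>x. u t x * X k x \<partial>surface_measure)" for k t
  define J where "J n k = (\<integral>x. zonal e n x * (x \<bullet> w) ^ k \<partial>surface_measure)" for n k
  define mU where "mU N k t = (\<Sum>n<N. a n * cis (- t * lam n) * of_real (J n k))" for N k t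
  have pl: "power_laplacian w k x = c k * (x \<bullet> w) ^ (k - 2) - \<mu> k * (x \<bullet> w) ^ k" for k x
    using DIM by (simp add: power_laplacian_def c_def \<mu>_def)
  have u_sq: "square_integrable surface_measure (u t)" for t
    using sol by (simp add: schroedinger_solution_def)
  have ui: "integrable surface_measure (u t)" for t
    by (rule square_integrable_imp_integrable_surface[OF u_sq])
  have uX: "integrable surface_measure (\<lambda>x. u t x * X k x)" for t k
    unfolding X_def by (intro integrable_times_continuous_surface ui continuous_intros)
  have UX: "integrable surface_measure (\<lambda>x. U N t x * X k x)" for N t k
    unfolding X_def by (intro integrable_surface_measure continuous_intros Uc)
  have mU: "(\<integral>x. U N t x * X k x \<partial>surface_measure) = mU N k t" for N k t
  proof -
    have "(\<integral>x. U N t x * X k x \<partial>surface_measure) =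
       (\<integral>x. (\<Sum>n<N. a n * cis (- t * lam n) * of_real (zonal e n x * (x \<bullet> w) ^ k)) \<partial>surface_measure)"
      by (rule Bochner_Integration.integral_cong) (simp_all add: U X_def sum_distrib_right mult.assoc)
    also have "\<dots> = (\<Sum>n<N. \<integral>x. a n * cis (- t * lam n) * of_real (zonal e n x * (x \<bullet> w) ^ k) \<partial>surface_measure)"
      by (intro Bochner_Integration.integral_sum integrable_surface_measure continuous_intros continuous_on_zonal)
    also have "\<dots> = mU N k t"
      unfolding mU_def J_def integral_of_real_surface ..
    finally show ?thesis .
  qed
  have der_u: "(mu k has_vector_derivative \<i> * (of_real (c k) * mu (k - 2) t - of_real (\<mu> k) * mu k t)) (at t)" for k t
  proof -
    have "(mu k has_vector_derivative \<i> * (\<integral>x. u t x * of_real (sphere_laplacian (\<lambda>x. (x \<bullet> w) ^ k) x) \<partial>surface_measure)) (at t)"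
      using sol smooth_sphere_inner_power[of w k] unfolding schroedinger_solution_def mu_def X_def by blast
    also have "(\<integral>x. u t x * of_real (sphere_laplacian (\<lambda>x. (x \<bullet> w) ^ k) x) \<partial>surface_measure) =
        (\<integral>x. of_real (c k) * (u t x * X (k - 2) x) - of_real (\<mu> k) * (u t x * X k x) \<partial>surface_measure)"
      by (rule Bochner_Integration.integral_cong)
        (simp_all add: sphere_laplacian_inner_power pl X_def right_diff_distrib mult.left_commute)
    also have "\<dots> = of_real (c k) * mu (k - 2) t - of_real (\<mu> k) * mu k t"
      by (simp add: uX mu_def)
    finally show ?thesis .
  qed
  have Jrec: "- lam n * J n k = c k * J n (k - 2) - \<mu> k * J n k" for n k
  proof -
    have "- lam n * J n k = (\<integral>x. zonal e n x * power_laplacian w k x \<partial>surface_measure)"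
      by (simp add: integral_zonal_power_laplacian lam_def J_def)
    also have "\<dots> = (\<integral>x. c k * (zonal e n x * (x \<bullet> w) ^ (k - 2)) - \<mu> k * (zonal e n x * (x \<bullet> w) ^ k) \<partial>surface_measure)"
      by (rule Bochner_Integration.integral_cong) (simp_all add: pl algebra_simps)
    also have "\<dots> = c k * J n (k - 2) - \<mu> k * J n k"
      unfolding J_def by (subst Bochner_Integration.integral_diff)
        (auto intro!: integrable_surface_measure continuous_intros continuous_on_zonal)
    finally show ?thesis .
  qed
  have der_U: "(mU N k has_vector_derivative \<i> * (of_real (c k) * mU N (k - 2) t - of_real (\<mu> k) * mU N k t)) (at t)" for N k t
  proof -
    have "((\<lambda>t. cis (- t * lam n)) has_vector_derivative (- lam n) *\<^sub>R (\<i> * cis (- t * lam n))) (at t)" for n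
      unfolding has_vector_derivative_def
      by (rule has_derivative_eq_rhs, rule has_derivative_cis, rule has_derivative_mult_left, rule has_derivative_minus, rule has_derivative_ident)
        (auto simp: fun_eq_iff)
    then have "(mU N k has_vector_derivative (\<Sum>n<N. a n * ((- lam n) *\<^sub>R (\<i> * cis (- t * lam n))) * of_real (J n k))) (at t)"
      unfolding mU_def
      by (intro has_vector_derivative_sum has_vector_derivative_mult_left has_vector_derivative_mult_right)
    also have "(\<Sum>n<N. a n * ((- lam n) *\<^sub>R (\<i> * cis (- t * lam n))) * of_real (J n k)) =
        (\<Sum>n<N. \<i> * (a n * cis (- t * lam n)) * of_real (- lam n * J n k))"
      by (rule sum.cong) (simp_all add: scaleR_conv_of_real)
    also have "\<dots> = \<i> * (of_real (c k) * mU N (k - 2) t - of_real (\<mu> k) * mU N k t)"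
      unfolding Jrec mU_def by (simp add: sum_distrib_left sum_subtractf[symmetric] algebra_simps)
    finally show ?thesis .
  qed
  define A where "A N k t = mu k t - mU N k t" for N k t
  have der: "(A N k has_vector_derivative \<i> * (of_real (c k) * A N (k - 2) t - of_real (\<mu> k) * A N k t)) (at t)" for N k t
    using has_vector_derivative_diff[OF der_u[of k t] der_U[of N k t]] by (simp add: A_def[abs_def] algebra_simps)
  have L1: "(\<lambda>N. \<integral>x. norm (f x - U N 0 x) \<partial>surface_measure) \<longlonglongrightarrow> 0"
  proof (rule L1_tendsto_zero_surface)
    show "square_integrable surface_measure (\<lambda>x. f x - U n 0 x)" for n
      by (rule square_integrable_diff_continuous_surface[OF f Uc])
    show "(\<lambda>n. \<integral>x. (norm (f x - U n 0 x))\<^sup>2 \<partial>surface_measure) \<longlonglongrightarrow> 0"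
      using conv unfolding L2_dist_sq_def U by simp
  qed
  have init: "(\<lambda>N. A N k 0) \<longlonglongrightarrow> 0" for k
  proof (rule Lim_null_comparison)
    show "(\<lambda>N. norm w ^ k * (\<integral>x. norm (f x - U N 0 x) \<partial>surface_measure)) \<longlonglongrightarrow> 0"
      using L1 by (rule tendsto_mult_right_zero)
    have "norm (A N k 0) \<le> norm w ^ k * (\<integral>x. norm (f x - U N 0 x) \<partial>surface_measure)" for N
    proof -
      have ae: "AE x in surface_measure. u 0 x = f x"
        using sol by (simp add: schroedinger_solution_def)
      have fi: "integrable surface_measure f" by (rule square_integrable_imp_integrable_surface[OF f])
      have fU: "integrable surface_measure (\<lambda>x. f x - U N 0 x)"
        using fi integrable_surface_measure[OF Uc] by simp
      have "A N k 0 = (\<integral>x. u 0 x * X k x - U N 0 x * X k x \<partial>surface_measure)"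
        by (simp add: A_def mu_def mU[symmetric] uX UX)
      also have "\<dots> = (\<integral>x. (f x - U N 0 x) * X k x \<partial>surface_measure)"
      proof (rule integral_cong_AE)
        show "(\<lambda>x. u 0 x * X k x - U N 0 x * X k x) \<in> borel_measurable surface_measure"
          by (intro borel_measurable_integrable Bochner_Integration.integrable_diff uX UX)
        show "(\<lambda>x. (f x - U N 0 x) * X k x) \<in> borel_measurable surface_measure"
          unfolding X_def
          by (intro borel_measurable_integrable integrable_times_continuous_surface fU continuous_intros)
        show "AE x in surface_measure. u 0 x * X k x - U N 0 x * X k x = (f x - U N 0 x) * X k x"
          using ae by eventually_elim (simp add: algebra_simps)
      qed
      also have "norm \<dots> \<le> (\<integral>x. norm ((f x - U N 0 x) * X k x) \<partial>surface_measure)"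
        by (rule integral_norm_bound)
      also have "\<dots> \<le> (\<integral>x. norm w ^ k * norm (f x - U N 0 x) \<partial>surface_measure)"
      proof (rule integral_mono)
        show "integrable surface_measure (\<lambda>x. norm ((f x - U N 0 x) * X k x))"
          unfolding X_def
          by (intro integrable_norm integrable_times_continuous_surface fU continuous_intros)
        fix x :: 'a assume "x \<in> space surface_measure"
        then have "\<bar>x \<bullet> w\<bar> \<le> norm w" using Cauchy_Schwarz_ineq2[of x w] by simp
        then have "norm (X k x) \<le> norm w ^ k"
          by (simp add: X_def norm_power power_mono)
        then show "norm ((f x - U N 0 x) * X k x) \<le> norm w ^ k * norm (f x - U N 0 x)"
          by (simp add: norm_mult mult.commute[of _ "norm (X k x)"] mult_right_mono)
      qed (use fU in simp)
      finally show ?thesis by simp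
    qed
    then show "\<forall>\<^sub>F N in sequentially. norm (A N k 0) \<le> norm w ^ k * (\<integral>x. norm (f x - U N 0 x) \<partial>surface_measure)"
      by simp
  qed
  have "c 0 = 0" "c 1 = 0" by (simp_all add: c_def)
  \<comment> \<open>The time bound is |t| itself. One constant \<open>K\<close> works for all N, so
    convergence of the finitely many initial moments of order at most k carries over to time
    t.\<close>
  from moment_hierarchy_bound[OF this abs_ge_zero[of t], of \<mu> k]
  obtain K where K: "0 \<le> K" "\<And>A \<eta>. (\<forall>k t. (A k has_vector_derivative \<i> * (of_real (c k) * A (k - 2) t - of_real (\<mu> k) * A k t)) (at t))
     \<Longrightarrow> (\<forall>j\<le>k. norm (A j 0) \<le> \<eta>) \<Longrightarrow> norm (A k t :: complex) \<le> K * \<eta>"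
    by auto
  have "(\<lambda>N. A N k t) \<longlonglongrightarrow> 0"
  proof (rule Lim_null_comparison)
    have "norm (A N k t) \<le> K * (\<Sum>j\<le>k. norm (A N j 0))" for N
    proof (rule K(2))
      show "\<forall>k t. (A N k has_vector_derivative \<i> * (of_real (c k) * A N (k - 2) t - of_real (\<mu> k) * A N k t)) (at t)"
        using der by blast
      show "\<forall>j\<le>k. norm (A N j 0) \<le> (\<Sum>j\<le>k. norm (A N j 0))"
        by (auto intro!: member_le_sum)
    qed
    then show "\<forall>\<^sub>F N in sequentially. norm (A N k t) \<le> K * (\<Sum>j\<le>k. norm (A N j 0))"
      by simp
    have "(\<lambda>N. \<Sum>j\<le>k. norm (A N j 0)) \<longlonglongrightarrow> (\<Sum>j\<le>k. 0)"
      by (intro tendsto_sum tendsto_norm_zero init)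
    then show "(\<lambda>N. K * (\<Sum>j\<le>k. norm (A N j 0))) \<longlonglongrightarrow> 0"
      by (intro tendsto_mult_right_zero) simp
  qed
  moreover have "A N k t = (\<integral>x. (u t x - zonal_partial_sum a e N t x) * of_real ((x \<bullet> w) ^ k) \<partial>surface_measure)" for N
  proof -
    have "A N k t = (\<integral>x. u t x * X k x - U N t x * X k x \<partial>surface_measure)"
      by (simp add: A_def mu_def mU[symmetric] uX UX)
    also have "\<dots> = (\<integral>x. (u t x - zonal_partial_sum a e N t x) * of_real ((x \<bullet> w) ^ k) \<partial>surface_measure)"
      by (rule Bochner_Integration.integral_cong) (simp_all add: U_def X_def algebra_simps)
    finally show ?thesis .
  qed
  ultimately show ?thesis by simp
qed

text \<open>Since \<kappa>_n = O(n^((d-1)/2)), the exponent is -p + (d-1)/2 = -\<gamma> - 1/2. For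
  increments, b_n - b_m = (a_n - a_m) \<kappa>_n + a_m (\<kappa>_n - \<kappa>_m) with m = n - 1, and
  each part gains a factor 1/n.\<close>

lemma coefficient_bounds:
  fixes a :: "nat \<Rightarrow> complex" and p C :: real
  assumes p: "real d / 2 < p"
    and a: "\<And>n. n \<ge> 1 \<Longrightarrow> norm (a n) \<le> C / real n powr p"
    and da: "\<And>n. n \<ge> 1 \<Longrightarrow> norm (a n - a (n - 1)) \<le> C / real n powr (p + 1)"
  defines "\<gamma> \<equiv> p - real d / 2" and "b \<equiv> \<lambda>n. a n * of_real (zonal_coeff e d n)"
  shows "\<exists>C'. (\<forall>n\<ge>1. norm (b n) \<le> C' * real n powr (- \<gamma> - 1 / 2)) \<and>
    (\<forall>n\<ge>2. norm (b n - b (n - 1)) \<le> C' * real n powr (- \<gamma> - 3 / 2))"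
proof -
  define \<kappa> where "\<kappa> = zonal_coeff e d"
  define q where "q = (real d - 1) / 2"
  \<comment> \<open>From 2n + 1 \<le> 3n for n \<ge> 1 in \<open>zonal_coeff_upper\<close>, after a
    square root.\<close>
  define B where "B = 3 powr q"
  have q: "0 \<le> q" using d by (simp add: q_def)
  have C: "0 \<le> C" using order_trans[OF norm_ge_zero a[of 1]] by simp
  have B: "0 < B" by (simp add: B_def)
  have \<gamma>: "0 < \<gamma>" using p by (simp add: \<gamma>_def)
  have \<kappa>pos: "0 < \<kappa> n" for n unfolding \<kappa>_def by (rule zonal_coeff_pos[OF e d DIM])
  have \<kappa>: "\<kappa> n \<le> B * real n powr q" if "n \<ge> 1" for n
  proof (rule power2_le_imp_le)
    have "(\<kappa> n)\<^sup>2 \<le> real (2 * n + 1) ^ (d - 1)"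
      unfolding \<kappa>_def by (rule zonal_coeff_upper[OF e d DIM])
    also have "\<dots> \<le> (3 * real n) ^ (d - 1)"
      using that by (intro power_mono) auto
    also have "\<dots> = (3 * real n) powr (2 * q)"
    proof -
      have "2 * q = real (d - 1)" using d by (simp add: q_def of_nat_diff)
      then show ?thesis using that by (simp add: powr_realpow)
    qed
    also have "\<dots> = (B * real n powr q)\<^sup>2"
      using that by (simp add: B_def power_mult_distrib powr_power powr_mult mult.commute)
    finally show "(\<kappa> n)\<^sup>2 \<le> (B * real n powr q)\<^sup>2" .
  qed (use B in simp)
  have pq: "- p + q = - \<gamma> - 1 / 2"
    by (simp add: q_def \<gamma>_def field_simps)
  have b1: "norm (b n) \<le> C * B * real n powr (- \<gamma> - 1 / 2)" if "n \<ge> 1" for n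
  proof -
    have "norm (b n) = norm (a n) * \<kappa> n" using \<kappa>pos[of n] by (simp add: b_def \<kappa>_def norm_mult)
    also have "\<dots> \<le> (C / real n powr p) * (B * real n powr q)"
      using a[OF that] \<kappa>[OF that] \<kappa>pos[of n] C by (intro mult_mono) auto
    also have "\<dots> = C * B * real n powr (- p + q)"
      unfolding powr_add powr_minus by (simp add: divide_inverse)
    finally show ?thesis by (simp only: pq)
  qed
  \<comment> \<open>The summand 1 stems from the increment of a. In the other one, d - 1 comes from
    \<open>zonal_coeff_diff\<close>, and n - 1 \<ge> n/2 for n \<ge> 2 costs
    2^(\<gamma>+1/2).\<close>
  define C' where "C' = C * B * (1 + 2 powr (\<gamma> + 1 / 2) * (real d - 1))"
  have "norm (b n - b (n - 1)) \<le> C' * real n powr (- \<gamma> - 3 / 2)" if n: "n \<ge> 2" for n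
  proof -
    obtain m where m: "n = Suc m" "m \<ge> 1" using n by (cases n) auto
    have "b n - b m = (a n - a m) * of_real (\<kappa> n) + a m * of_real (\<kappa> n - \<kappa> m)"
      by (simp add: b_def \<kappa>_def algebra_simps)
    then have "norm (b n - b m) \<le> norm (a n - a m) * \<kappa> n + norm (a m) * \<bar>\<kappa> n - \<kappa> m\<bar>"
      using \<kappa>pos[of n] norm_triangle_ineq[of "(a n - a m) * of_real (\<kappa> n)" "a m * of_real (\<kappa> n - \<kappa> m)"]
      by (simp only: norm_mult norm_of_real abs_of_pos)
    also have "\<dots> \<le> C * B * real n powr (- \<gamma> - 3 / 2) +
       C * B * (2 powr (\<gamma> + 1 / 2) * (real d - 1)) * real n powr (- \<gamma> - 3 / 2)"
    proof (rule add_mono)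
      have "norm (a n - a m) * \<kappa> n \<le> (C / real n powr (p + 1)) * (B * real n powr q)"
        using da[of n] \<kappa>[of n] \<kappa>pos[of n] C m by (intro mult_mono) auto
      also have "\<dots> = C * B * real n powr (- (p + 1) + q)"
        unfolding powr_add[of _ "- (p + 1)"] powr_minus by (simp add: divide_inverse)
      also have "- (p + 1) + q = - \<gamma> - 3 / 2" using pq by simp
      finally show "norm (a n - a m) * \<kappa> n \<le> C * B * real n powr (- \<gamma> - 3 / 2)" .
      have "norm (a m) * \<bar>\<kappa> n - \<kappa> m\<bar> \<le> norm (a m) * (\<kappa> m * (real (d - 1) / (2 * real m + 1)))"
        using zonal_coeff_diff[OF e d DIM, of m] by (intro mult_left_mono) (auto simp: \<kappa>_def m)
      also have "\<dots> = norm (b m) * (real (d - 1) / (2 * real m + 1))"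
        using \<kappa>pos[of m] by (simp add: b_def \<kappa>_def norm_mult)
      also have "\<dots> \<le> (C * B * real m powr (- \<gamma> - 1 / 2)) * ((real d - 1) / real n)"
        using b1[OF m(2)] d m C B by (intro mult_mono divide_left_mono frac_le) (auto simp: of_nat_diff)
      also have "\<dots> \<le> (C * B * (2 powr (\<gamma> + 1 / 2) * real n powr (- \<gamma> - 1 / 2))) * ((real d - 1) / real n)"
      proof (intro mult_right_mono mult_left_mono)
        have "real m powr (- \<gamma> - 1 / 2) \<le> (real n / 2) powr (- \<gamma> - 1 / 2)"
          using m \<gamma> by (intro powr_mono2') auto
        also have "\<dots> = 2 powr (\<gamma> + 1 / 2) * real n powr (- \<gamma> - 1 / 2)"
        proof -
          have "(2::real) powr (\<gamma> + 1 / 2) * 2 powr (- \<gamma> - 1 / 2) = 1"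
            by (simp flip: powr_add)
          then show ?thesis by (simp add: powr_divide field_simps)
        qed
        finally show "real m powr (- \<gamma> - 1 / 2) \<le> 2 powr (\<gamma> + 1 / 2) * real n powr (- \<gamma> - 1 / 2)" .
      qed (use C B d in auto)
      also have "\<dots> = C * B * (2 powr (\<gamma> + 1 / 2) * (real d - 1)) * (real n powr (- \<gamma> - 1 / 2) / real n)"
        by simp
      also have "real n powr (- \<gamma> - 1 / 2) / real n = real n powr (- \<gamma> - 3 / 2)"
      proof -
        have "- \<gamma> - 3 / 2 = (- \<gamma> - 1 / 2) - 1" by simp
        then show ?thesis using n by (simp only: powr_diff) simp
      qed
      finally show "norm (a m) * \<bar>\<kappa> n - \<kappa> m\<bar> \<le> C * B * (2 powr (\<gamma> + 1 / 2) * (real d - 1)) * real n powr (- \<gamma> - 3 / 2)" .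
    qed
    finally show ?thesis by (simp add: m C'_def algebra_simps)
  qed
  moreover have "norm (b n) \<le> C' * real n powr (- \<gamma> - 1 / 2)" if "n \<ge> 1" for n
  proof -
    have "C * B * 1 \<le> C'" unfolding C'_def using C B d by (intro mult_left_mono) auto
    then have "C * B * real n powr (- \<gamma> - 1 / 2) \<le> C' * real n powr (- \<gamma> - 1 / 2)"
      by (intro mult_right_mono) auto
    then show ?thesis using b1[OF that] by linarith
  qed
  ultimately show ?thesis by blast
qed

text \<open>The classical characterisation by dyadic blocks: block k is bounded by 2^(-kh) and has
  Lipschitz constant 2^(k(1-h)), for every h < \<gamma>. Interpolating between both bounds gives
  order s < h with a geometrically decaying factor, and the blocks sum up.\<close>

lemma weyl_bounded_imp_hoelder:
  fixes a :: "nat \<Rightarrow> complex" and p C :: real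
  assumes t: "weyl_bounded t" and p: "real d / 2 < p" "p < real d / 2 + 1"
    and a: "\<And>n. n \<ge> 1 \<Longrightarrow> norm (a n) \<le> C / real n powr p"
    and da: "\<And>n. n \<ge> 1 \<Longrightarrow> norm (a n - a (n - 1)) \<le> C / real n powr (p + 1)"
  obtains g B where "\<And>K x. x \<in> sphere 0 1 \<Longrightarrow> norm (zonal_partial_sum a e (2 ^ K) t x) \<le> B"
    and "\<And>x. x \<in> sphere 0 1 \<Longrightarrow> (\<lambda>K. zonal_partial_sum a e (2 ^ K) t x) \<longlonglongrightarrow> g x"
    and "\<And>s. 0 < s \<Longrightarrow> s < p - real d / 2 \<Longrightarrow> hoelder_on s (sphere 0 1) g"
proof -
  define \<gamma> where "\<gamma> = p - real d / 2"
  have \<gamma>: "0 < \<gamma>" "\<gamma> < 1" using p by (auto simp: \<gamma>_def)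
  define b where "b n = a n * of_real (zonal_coeff e d n)" for n
  obtain C' where b: "\<And>n. 1 \<le> n \<Longrightarrow> norm (b n) \<le> C' * real n powr (- \<gamma> - 1 / 2)"
    "\<And>n. 2 \<le> n \<Longrightarrow> norm (b n - b (n - 1)) \<le> C' * real n powr (- \<gamma> - 3 / 2)"
    using coefficient_bounds[OF p(1) a da] unfolding b_def \<gamma>_def by blast
  define c where "c n = b n * cis (- t * (real n * (real n + real d - 1)))" for n
  define G where "G k x = (\<Sum>n = 2 ^ k..<2 ^ Suc k. c n * of_real (poly (zonal_poly d n) (x \<bullet> e)))" for k x
  have le1: "\<bar>x \<bullet> e\<bar> \<le> 1" if "x \<in> sphere 0 1" for x
    using Cauchy_Schwarz_ineq2[of x e] that e by simp
  have block: "\<exists>A\<ge>0. \<forall>k. \<forall>x\<in>sphere 0 1. \<forall>y\<in>sphere 0 1. norm (G k x) \<le> A * 2 powr (- (real k * g)) \<and>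
      norm (G k x - G k y) \<le> A * 2 powr (real k * (1 - g)) * (2 * norm (x - y))" if less: "g < \<gamma>" for g
  proof -
    obtain A where A: "0 \<le> A" "\<And>k z w. norm z \<le> 1 \<Longrightarrow> norm w \<le> 1 \<Longrightarrow>
        norm (dyadic_block c k z) \<le> A * 2 powr (- (real k * g)) \<and>
        norm (dyadic_block c k z - dyadic_block c k w) \<le> A * 2 powr (real k * (1 - g)) * norm (z - w)"
      using dyadic_block_bound[OF t \<gamma>(1) less b, of d] unfolding c_def[abs_def] by blast
    have "norm (G k x) \<le> A * 2 powr (- (real k * g))" if "x \<in> sphere 0 1" for k x
      unfolding G_def
    proof (rule zonal_sum_bound[OF d le1[OF that]])
      show "norm (\<Sum>n = 2 ^ k..<2 ^ Suc k. c n * z ^ n) \<le> A * 2 powr (- (real k * g))" if "norm z \<le> 1" for z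
        using A(2)[OF that that, of k] by (simp add: dyadic_block_def)
    qed
    moreover have "norm (G k x - G k y) \<le> A * 2 powr (real k * (1 - g)) * (2 * norm (x - y))"
      if x: "x \<in> sphere 0 1" and y: "y \<in> sphere 0 1" for k x y
    proof -
      have "norm (G k x - G k y) \<le> A * 2 powr (real k * (1 - g)) *
          (\<bar>x \<bullet> e - y \<bullet> e\<bar> + \<bar>sqrt (1 - (x \<bullet> e)\<^sup>2) - sqrt (1 - (y \<bullet> e)\<^sup>2)\<bar>)"
        unfolding G_def
      proof (rule zonal_sum_lipschitz[OF d le1[OF x] le1[OF y]])
        show "norm ((\<Sum>n = 2 ^ k..<2 ^ Suc k. c n * z ^ n) - (\<Sum>n = 2 ^ k..<2 ^ Suc k. c n * w ^ n))
            \<le> A * 2 powr (real k * (1 - g)) * norm (z - w)" if "norm z \<le> 1" "norm w \<le> 1" for z w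
          using A(2)[OF that, of k] by (simp add: dyadic_block_def)
      qed (use A in auto)
      also have "\<dots> \<le> A * 2 powr (real k * (1 - g)) * (norm (x - y) + norm (x - y))"
        using polar_coordinates_lipschitz[OF e, of x y] x y A by (intro mult_left_mono add_mono) auto
      finally show ?thesis by simp
    qed
    ultimately show ?thesis using A(1) by blast
  qed
  define P where "P K x = zonal_partial_sum a e (2 ^ K) t x" for K x
  have P: "P K x = c 0 + (\<Sum>k<K. G k x)" for K x
  proof (induction K)
    case 0
    then show ?case by (simp add: P_def zonal_partial_sum_def c_def b_def zonal_eq[OF e d DIM])
  next
    case (Suc K)
    have z: "a n * cis (- t * (real n * (real n + real (DIM('a) - 1) - 1))) * of_real (zonal e n x) =
        c n * of_real (poly (zonal_poly d n) (x \<bullet> e))" for n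
      using DIM by (simp add: c_def b_def zonal_eq[OF e d DIM])
    have "P (Suc K) x = P K x + G K x"
      unfolding P_def zonal_partial_sum_def G_def z lessThan_atLeast0
      by (rule sum.atLeastLessThan_concat[symmetric]) auto
    then show ?case using Suc by simp
  qed
  define g where "g x = c 0 + (\<Sum>k. G k x)" for x
  have geometric: "2 powr (- (real k * s)) = (2 powr (- s)) ^ k" for k and s :: real
    by (simp add: powr_realpow[symmetric] powr_powr mult.commute)
  have ratio: "2 powr (- s) < 1" if "0 < s" for s :: real
    using powr_less_mono[of "- s" 0 2] that by simp
  \<comment> \<open>Any exponent in (0, \<gamma>) makes the series absolutely and uniformly
    convergent; \<gamma>/2 is a concrete choice.\<close>
  obtain A0 where A0: "0 \<le> A0" "\<And>k x. x \<in> sphere 0 1 \<Longrightarrow> norm (G k x) \<le> A0 * (2 powr (- (\<gamma> / 2))) ^ k"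
    using block[of "\<gamma> / 2"] \<gamma> unfolding geometric by auto
  have geo: "summable (\<lambda>k. A0 * (2 powr (- (\<gamma> / 2))) ^ k)"
    using ratio[of "\<gamma> / 2"] \<gamma> by (intro summable_mult summable_geometric) simp
  have summ: "summable (\<lambda>k. norm (G k x))" if "x \<in> sphere 0 1" for x
    using A0(2)[OF that] by (intro summable_comparison_test'[OF geo, of 0]) auto
  show ?thesis
  proof (rule that)
    fix x :: 'a assume x: "x \<in> sphere 0 1"
    have "(\<lambda>K. P K x) \<longlonglongrightarrow> g x"
      unfolding P g_def
      by (intro tendsto_add tendsto_const summable_LIMSEQ summable_norm_cancel[OF summ[OF x]])
    then show "(\<lambda>K. zonal_partial_sum a e (2 ^ K) t x) \<longlonglongrightarrow> g x" by (simp add: P_def)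
    fix K
    have "norm (\<Sum>k<K. G k x) \<le> (\<Sum>k<K. A0 * (2 powr (- (\<gamma> / 2))) ^ k)"
      by (intro sum_norm_le A0 x)
    also have "\<dots> \<le> (\<Sum>k. A0 * (2 powr (- (\<gamma> / 2))) ^ k)"
      using A0(1) by (intro sum_le_suminf geo) auto
    finally show "norm (zonal_partial_sum a e (2 ^ K) t x) \<le> norm (c 0) + (\<Sum>k. A0 * (2 powr (- (\<gamma> / 2))) ^ k)"
      using norm_triangle_ineq[of "c 0" "\<Sum>k<K. G k x"] unfolding P_def[symmetric] P by linarith
  next
    fix s assume s: "0 < s" "s < p - real d / 2"
    then have s1: "s < \<gamma>" "s < 1" using \<gamma> by (auto simp: \<gamma>_def)
    \<comment> \<open>The midpoint leaves room on both sides: h < \<gamma> for the block bounds, s <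
      h for the ratio \<open>\<rho>\<close> < 1.\<close>
    define h where "h = (s + \<gamma>) / 2"
    have h: "s < h" "h < \<gamma>" using s1 by (auto simp: h_def)
    obtain A where A: "0 \<le> A" "\<And>k x. x \<in> sphere 0 1 \<Longrightarrow> norm (G k x) \<le> A * 2 powr (- (real k * h))"
      "\<And>k x y. x \<in> sphere 0 1 \<Longrightarrow> y \<in> sphere 0 1 \<Longrightarrow>
        norm (G k x - G k y) \<le> A * 2 powr (real k * (1 - h)) * (2 * norm (x - y))"
      using block[OF h(2)] by blast
    define \<rho> where "\<rho> = 2 powr (- (h - s))"
    have \<rho>: "0 \<le> \<rho>" "\<rho> < 1" unfolding \<rho>_def using ratio[of "h - s"] h by auto
    have term_le: "norm (G k x - G k y) \<le> (2 * A * dist x y powr s) * \<rho> ^ k"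
      if x: "x \<in> sphere 0 1" and y: "y \<in> sphere 0 1" for k x y
    proof -
      \<comment> \<open>The distance in units of the wavelength 2^(-k). The Lipschitz bound serves
        \<delta> \<le> 1, where \<delta> \<le> \<delta>^s, and the supremum bound serves \<delta> >
        1, where 1 \<le> \<delta>^s.\<close>
      define \<delta> where "\<delta> = 2 powr real k * dist x y"
      have \<delta>0: "0 \<le> \<delta>" by (simp add: \<delta>_def)
      have "norm (G k x - G k y) \<le> 2 * A * 2 powr (- (real k * h)) * \<delta> powr s"
      proof (cases "\<delta> \<le> 1")
        case True
        have "norm (G k x - G k y) \<le> A * 2 powr (real k + - (real k * h)) * (2 * norm (x - y))"
          using A(3)[OF x y, of k] by (simp add: algebra_simps)
        also have "\<dots> = 2 * A * 2 powr (- (real k * h)) * \<delta>"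
          unfolding powr_add \<delta>_def dist_norm by simp
        also have "\<delta> \<le> \<delta> powr s"
          using powr_mono'[of s 1 \<delta>] s1 \<delta>0 True by simp
        finally show ?thesis using A(1) by (simp add: mult_left_mono)
      next
        case False
        have "norm (G k x - G k y) \<le> 2 * A * 2 powr (- (real k * h)) * 1"
          using norm_triangle_ineq4[of "G k x" "G k y"] A(2)[OF x, of k] A(2)[OF y, of k] by simp
        also have "\<dots> \<le> 2 * A * 2 powr (- (real k * h)) * \<delta> powr s"
          using A(1) False s by (intro mult_left_mono ge_one_powr_ge_zero) auto
        finally show ?thesis .
      qed
      also have "\<delta> powr s = 2 powr (real k * s) * dist x y powr s"
        by (simp add: \<delta>_def powr_mult powr_powr)
      also have "2 * A * 2 powr (- (real k * h)) * (2 powr (real k * s) * dist x y powr s) =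
          2 * A * dist x y powr s * 2 powr (- (real k * h) + real k * s)"
        by (simp only: powr_add mult_ac)
      also have "- (real k * h) + real k * s = - (real k * (h - s))" by (simp add: algebra_simps)
      finally show ?thesis by (simp only: geometric \<rho>_def)
    qed
    have "dist (g x) (g y) \<le> 2 * A / (1 - \<rho>) * dist x y powr s"
      if x: "x \<in> sphere 0 1" and y: "y \<in> sphere 0 1" for x y
    proof -
      have sums: "(\<lambda>k. (2 * A * dist x y powr s) * \<rho> ^ k) sums ((2 * A * dist x y powr s) * (1 / (1 - \<rho>)))"
        using \<rho> by (intro sums_mult geometric_sums) simp
      have "g x - g y = (\<Sum>k. G k x - G k y)"
        unfolding g_def using suminf_diff[OF summable_norm_cancel[OF summ[OF x]] summable_norm_cancel[OF summ[OF y]]] by simp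
      also have "norm \<dots> \<le> (\<Sum>k. (2 * A * dist x y powr s) * \<rho> ^ k)"
        by (rule norm_suminf_le[OF term_le[OF x y] sums_summable[OF sums]])
      also have "\<dots> = 2 * A / (1 - \<rho>) * dist x y powr s"
        using sums_unique[OF sums] by simp
      finally show ?thesis by (simp add: dist_norm)
    qed
    then show "hoelder_on s (sphere 0 1) g" unfolding hoelder_on_def by blast
  qed
qed

end

lemma hoelder_on_Re: "hoelder_on s S g \<Longrightarrow> hoelder_on s S (\<lambda>x. Re (g x))"
  and hoelder_on_Im: "hoelder_on s S g \<Longrightarrow> hoelder_on s S (\<lambda>x. Im (g x))"
proof -
  have "dist (Re z) (Re w) \<le> dist z w" "dist (Im z) (Im w) \<le> dist z w" for z w
    using abs_Re_le_cmod[of "z - w"] abs_Im_le_cmod[of "z - w"] by (simp_all add: dist_norm)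
  then show "hoelder_on s S g \<Longrightarrow> hoelder_on s S (\<lambda>x. Re (g x))"
    "hoelder_on s S g \<Longrightarrow> hoelder_on s S (\<lambda>x. Im (g x))"
    unfolding hoelder_on_def by (meson order_trans)+
qed

text \<open>The function g is the pointwise limit of the dyadic partial sums at time t. It has the
  same moments as u(t), hence equals it almost everywhere, and Hoelder continuity of every order
  below p - d/2 yields the dimension bound for both graphs.\<close>

theorem corollary1p4:
  fixes d :: nat and p C :: real and a :: "nat \<Rightarrow> complex"
    and e :: "'a::euclidean_space"
    and f :: "'a \<Rightarrow> complex" and u :: "real \<Rightarrow> 'a \<Rightarrow> complex"
  assumes "d \<ge> 2" and "DIM('a) = d + 1" and "norm e = 1"
    and "real d / 2 < p" and "p < real d / 2 + 1"
    and "\<And>n. n \<ge> 1 \<Longrightarrow> norm (a n) \<le> C / real n powr p"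
    and "\<And>n. n \<ge> 1 \<Longrightarrow> norm (a n - a (n - 1)) \<le> C / real n powr (p + 1)"
    and "square_integrable surface_measure f"
    and "(\<lambda>N. L2_dist_sq surface_measure f (\<lambda>x. \<Sum>n<N. a n * of_real (zonal e n x))) \<longlonglongrightarrow> 0"
    and "schroedinger_solution f u"
  shows "AE t in lborel. \<exists>g. (AE x in surface_measure. u t x = g x) \<and>
           (\<forall>\<gamma>. 0 < \<gamma> \<and> \<gamma> < p - real d / 2 \<longrightarrow> hoelder_on \<gamma> (sphere 0 1) g) \<and>
           max_graph_dim g \<le> ereal (real d + 1 - (p - real d / 2))"
  using AE_weyl_bounded
proof eventually_elim
  case (elim t)
  note d = assms(1) and DIM = assms(2) and e = assms(3) and p = assms(4,5)
  define P where "P K x = zonal_partial_sum a e (2 ^ K) t x" for K x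
  obtain g B where bound: "\<And>K x. x \<in> sphere 0 1 \<Longrightarrow> norm (P K x) \<le> B"
    and lim: "\<And>x. x \<in> sphere 0 1 \<Longrightarrow> (\<lambda>K. P K x) \<longlonglongrightarrow> g x"
    and hoelder: "\<And>s. 0 < s \<Longrightarrow> s < p - real d / 2 \<Longrightarrow> hoelder_on s (sphere 0 1) g"
    using weyl_bounded_imp_hoelder[OF e d DIM elim p assms(6,7)] unfolding P_def by metis
  have gc: "continuous_on (sphere 0 1) g"
    using p by (intro hoelder_on_imp_continuous_on[OF hoelder[of "(p - real d / 2) / 2"]]) auto
  have Pc: "continuous_on (sphere 0 1) (P K)" for K
    unfolding P_def by (rule continuous_on_zonal_partial_sum[OF e d DIM])
  have "square_integrable surface_measure (u t)"
    using assms(10) by (simp add: schroedinger_solution_def)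
  then have ui: "integrable surface_measure (u t)"
    by (rule square_integrable_imp_integrable_surface)
  have vi: "integrable surface_measure (\<lambda>x. u t x - g x)"
    using ui integrable_surface_measure[OF gc] by simp
  \<comment> \<open>The same sequence of moments, taken along N = 2^K, has two limits: 0 by
    comparison with the weak solution, and the moment of u(t) - g by dominated convergence with the
    bound \<open>B\<close> on all partial sums.\<close>
  have moments: "(\<integral>x. (u t x - g x) * of_real ((x \<bullet> w) ^ k) \<partial>surface_measure) = 0" for w k
  proof (rule LIMSEQ_unique)
    have sub: "filterlim (\<lambda>K. (2::nat) ^ K) at_top sequentially"
      by (rule filterlim_subseq) (simp add: strict_mono_def)
    show "(\<lambda>K. \<integral>x. (u t x - P K x) * of_real ((x \<bullet> w) ^ k) \<partial>surface_measure) \<longlonglongrightarrow> 0"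
      unfolding P_def
      by (rule filterlim_compose[OF solution_moments_tendsto[OF e d DIM assms(8,9,10)] sub])
    show "(\<lambda>K. \<integral>x. (u t x - P K x) * of_real ((x \<bullet> w) ^ k) \<partial>surface_measure)
        \<longlonglongrightarrow> (\<integral>x. (u t x - g x) * of_real ((x \<bullet> w) ^ k) \<partial>surface_measure)"
    proof (rule integral_dominated_convergence[where w = "\<lambda>x. (norm (u t x) + B) * norm w ^ k"])
      show "(\<lambda>x. (u t x - g x) * of_real ((x \<bullet> w) ^ k)) \<in> borel_measurable surface_measure"
        by (intro borel_measurable_integrable integrable_times_continuous_surface vi continuous_intros)
      show "(\<lambda>x. (u t x - P K x) * of_real ((x \<bullet> w) ^ k)) \<in> borel_measurable surface_measure" for K
        by (intro borel_measurable_integrable integrable_times_continuous_surface Bochner_Integration.integrable_diff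
          ui integrable_surface_measure Pc continuous_intros)
      show "integrable surface_measure (\<lambda>x. (norm (u t x) + B) * norm w ^ k)"
        by (intro integrable_mult_left Bochner_Integration.integrable_add integrable_norm ui
          integrable_surface_measure continuous_intros)
      show "AE x in surface_measure. (\<lambda>K. (u t x - P K x) * of_real ((x \<bullet> w) ^ k)) \<longlonglongrightarrow>
          (u t x - g x) * of_real ((x \<bullet> w) ^ k)"
        by (intro AE_I2 tendsto_intros lim) simp
      show "AE x in surface_measure. norm ((u t x - P K x) * of_real ((x \<bullet> w) ^ k)) \<le> (norm (u t x) + B) * norm w ^ k" for K
      proof (rule AE_I2)
        fix x :: 'a assume "x \<in> space surface_measure"
        then have x: "x \<in> sphere 0 1" by simp
        have "\<bar>x \<bullet> w\<bar> \<le> norm w" using Cauchy_Schwarz_ineq2[of x w] x by simp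
        then have "norm (complex_of_real ((x \<bullet> w) ^ k)) \<le> norm w ^ k"
          by (simp add: norm_power power_mono)
        moreover have "norm (u t x - P K x) \<le> norm (u t x) + B"
          using norm_triangle_ineq4[of "u t x" "P K x"] bound[OF x, of K] by linarith
        ultimately show "norm ((u t x - P K x) * of_real ((x \<bullet> w) ^ k)) \<le> (norm (u t x) + B) * norm w ^ k"
          unfolding norm_mult by (intro mult_mono order_trans[OF norm_ge_zero]) auto
      qed
    qed
  qed
  have "AE x in surface_measure. u t x - g x = 0"
    by (rule AE_eq_zero_surface[OF vi moments])
  then have "AE x in surface_measure. u t x = g x" by eventually_elim simp
  moreover have "max_graph_dim g \<le> ereal (real DIM('a) - (p - real d / 2))"
    unfolding max_graph_dim_def using p
    by (intro max.boundedI fractal_dim_graph_le hoelder_on_Re hoelder_on_Im hoelder) auto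
  ultimately show ?case using hoelder DIM by (intro exI[of _ g]) (auto simp: add.commute)
qed

end
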